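(* Let $I\subset\mathbb N$ be non-empty, let $S$ be a measurable surface of $\ell^2$ with codimension $\Gamma_{\mathbb N\setminus I}$, and let $\{(S\cap U_i,P_{I_i}): i\in\Lambda\}$ be a family of locally finite coordinate pairings of $S$ that covers $S$. Then there exists a Borel measure $\mu_S$ on $S$ such that $$\mu_S(E)=\mu(E,S\cap U_i)\qquad\text{for all } i\in\Lambda\text{ and all } E\in\mathscr B(S\cap U_i),$$ where $\mu(\cdot,S\cap U_i)$ is the local surface measure of the coordinate pairing $(S\cap U_i,P_{I_i})$.
   Context: Fix positive numbers $(a_i)_{i\ge1}$ with $\sum_i a_i<\infty$. $\ell^2$ is the real Hilbert space of square-summable sequences indexed by $\mathbb N=\{1,2,\dots\}$, with standard orthonormal basis $(\mathbf e_i)$. For $I\subset\mathbb N$, $P_I$ denotes both the closed span of $\{\mathbf e_i:i\in I\}$ (which is $\{0\}$ if $I=\emptyset$) and the orthogonal projection onto it. For non-empty $I\subset \mathbb N$, $\mu_I$ is the Borel probability measure on $P_I\cong \ell^2(I)$ obtained by restricting to $\ell^2(I)$ the product over $i\in I$ of the Gaussian measures $\frac{1}{\sqrt{2\pi a_i^2}}e^{-x_i^2/(2a_i^2)}dx_i$. For non-empty $I_1,I_2\subset\mathbb N$ write $I_1\sim I_2$ if there are finite sets $K_1\subset I_1$, $K_2\subset\mathbb N\setminus I_1$ with $|K_1|=|K_2|$ and $I_2=(I_1\setminus K_1)\cup K_2$; let $\Gamma_I=\{I'\subset\mathbb N: I'\sim I\}$. A non-empty set $S\subset\ell^2$ is a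 surface with codimension $\Gamma_{\mathbb N\setminus I}$ if for every $\mathbf x\in S$ there are an open neighbourhood $U$ of $\mathbf x$ in $\ell^2$ and $I_1\in\Gamma_I$ such that $P_{I_1}|_{S\cap U}$ is a homeomorphism onto an open subset $U_{I_1}$ of $P_{I_1}$; such a pair $(S\cap U,P_{I_1})$ is called a coordinate pairing of $S$. Then $S\cap U=\{\mathbf y+f(\mathbf y):\mathbf y\in U_{I_1}\}$ for a function $f:U_{I_1}\to P_{\mathbb N\setminus I_1}$, which is assumed to be continuously Fréchet differentiable. Write $f_i=\langle f,\mathbf e_i\rangle$ and, for $\mathbf x=\mathbf y+f(\mathbf y)$, $$n_{I_1}(\mathbf x)=\Big(1+\sum_{I_0,J_0}\big|\det\big(D_{x_j}f_i(\mathbf y)\big)_{i\in J_0,\,j\in I_0}\big|^2\Big)^{1/2},$$ the sum being over finite non-empty $I_0\subset I_1$, $J_0\subset\mathbb N\setminus I_1$ with $|I_0|=|J_0|$. For $J\subset\mathbb N$, $C_J$ is the set of $\sum_{i\in J}x_i\mathbf e_i\in P_J$ with $\sum_{i\in J}\big|\ln\frac1{\sqrt{2\pi}a_i}-\frac{x_i^2}{2a_i^2}\big|<\infty$, and $F_J(\mathbf x)=\exp\sum_{i\in J}\big(\ln\frac1{\sqrt{2\pi}a_i}-\frac{x_i^2}{2a_i^2}\big)$ on $C_J$ (so $F_\emptyset=1$). The coordinate pairing $(S\cap U,P_{I_1})$ is locally finite if $f(U_{I_1})\subset C_{\mathbb N\setminus I_1}$ and $\sup_{\mathbf y\in U_{I_1}}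 n_{I_1}(\mathbf y+f(\mathbf y))\,F_{\mathbb N\setminus I_1}(f(\mathbf y))<\infty$; its local surface measure is $$\mu(E,S\cap U)=\int_{P_{I_1}E}n_{I_1}(\mathbf y+f(\mathbf y))\,F_{\mathbb N\setminus I_1}(f(\mathbf y))\,d\mu_{I_1}(\mathbf y),\quad E\in\mathscr B(S\cap U).$$ $S$ is a measurable surface if it is covered by a family of locally finite coordinate pairings. *)

theory Defs
  imports "HOL-Probability.Probability" "Jordan_Normal_Form.Determinant"
begin

text \<open>Coordinates are indexed by the type \<^typ>\<open>nat\<close>, i.e. from 0 instead of from 1.\<close>

typedef ell2 = "{x :: nat \<Rightarrow> real. summable (\<lambda>i. (x i)\<^sup>2)}"
  morphisms coord Abs_ell2
  by (rule exI[of _ "\<lambda>_. 0"]) simp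

setup_lifting type_definition_ell2

lemma summable_coord_sq: "summable (\<lambda>i. (coord x i)\<^sup>2)"
  using coord[of x] by simp

lemma summable_mult_sq:
  fixes x y :: "nat \<Rightarrow> real"
  assumes "summable (\<lambda>i. (x i)\<^sup>2)" "summable (\<lambda>i. (y i)\<^sup>2)"
  shows "summable (\<lambda>i. x i * y i)"
proof (rule summable_comparison_test')
  show "summable (\<lambda>i. (x i)\<^sup>2 + (y i)\<^sup>2)"
    using assms by (rule summable_add)
  fix n :: nat
  have "0 \<le> (\<bar>x n\<bar> - \<bar>y n\<bar>)\<^sup>2" by simp
  then have "2 * (\<bar>x n\<bar> * \<bar>y n\<bar>) \<le> (x n)\<^sup>2 + (y n)\<^sup>2"
    by (simp add: power2_diff)
  moreover have "0 \<le> \<bar>x n\<bar> * \<bar>y n\<bar>" by simp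
  ultimately show "norm (x n * y n) \<le> (x n)\<^sup>2 + (y n)\<^sup>2"
    unfolding real_norm_def abs_mult by linarith
qed

lemma summable_add_sq:
  fixes x y :: "nat \<Rightarrow> real"
  assumes "summable (\<lambda>i. (x i)\<^sup>2)" "summable (\<lambda>i. (y i)\<^sup>2)"
  shows "summable (\<lambda>i. (x i + y i)\<^sup>2)"
proof -
  have "summable (\<lambda>i. (x i)\<^sup>2 + (y i)\<^sup>2 + 2 * (x i * y i))"
    using assms by (intro summable_add summable_mult summable_mult_sq)
  then show ?thesis by (simp add: power2_sum mult.assoc)
qed

lemma summable_scale_sq:
  fixes x :: "nat \<Rightarrow> real"
  assumes "summable (\<lambda>i. (x i)\<^sup>2)"
  shows "summable (\<lambda>i. (c * x i)\<^sup>2)"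
  using assms by (simp add: power_mult_distrib summable_mult)

instantiation ell2 :: real_vector
begin

lift_definition zero_ell2 :: ell2 is "\<lambda>_. 0" by simp
lift_definition plus_ell2 :: "ell2 \<Rightarrow> ell2 \<Rightarrow> ell2" is "\<lambda>x y i. x i + y i"
  by (rule summable_add_sq)
lift_definition uminus_ell2 :: "ell2 \<Rightarrow> ell2" is "\<lambda>x i. - x i" by simp
lift_definition minus_ell2 :: "ell2 \<Rightarrow> ell2 \<Rightarrow> ell2" is "\<lambda>x y i. x i - y i"
  using summable_add_sq[where y = "\<lambda>i. - y i" for y] by simp
lift_definition scaleR_ell2 :: "real \<Rightarrow> ell2 \<Rightarrow> ell2" is "\<lambda>c x i. c * x i"
  by (rule summable_scale_sq)

instance
  by standard (transfer, simp add: fun_eq_iff algebra_simps)+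

end

instantiation ell2 :: real_inner
begin

definition inner_ell2 :: "ell2 \<Rightarrow> ell2 \<Rightarrow> real"
  where "inner_ell2 x y = (\<Sum>i. coord x i * coord y i)"

definition norm_ell2 :: "ell2 \<Rightarrow> real"
  where "norm_ell2 x = sqrt (inner x x)"

definition dist_ell2 :: "ell2 \<Rightarrow> ell2 \<Rightarrow> real"
  where "dist_ell2 x y = norm (x - y)"

definition sgn_ell2 :: "ell2 \<Rightarrow> ell2"
  where "sgn_ell2 x = x /\<^sub>R norm x"

definition uniformity_ell2 :: "(ell2 \<times> ell2) filter"
  where "uniformity_ell2 = (INF e\<in>{0 <..}. principal {(x, y). dist x y < e})"

definition open_ell2 :: "ell2 set \<Rightarrow> bool"
  where "open_ell2 S = (\<forall>x\<in>S. \<forall>\<^sub>F (x', y) in uniformity. x' = x \<longrightarrow> y \<in> S)"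

instance
proof
  have mult: "summable (\<lambda>i. coord x i * coord y i)" for x y
    by (intro summable_mult_sq summable_coord_sq)
  fix x y z :: ell2 and r :: real
  show "inner x y = inner y x"
    by (simp add: inner_ell2_def mult.commute)
  show "inner (x + y) z = inner x z + inner y z"
    by (simp add: inner_ell2_def plus_ell2.rep_eq distrib_right suminf_add mult)
  show "inner (r *\<^sub>R x) y = r * inner x y"
    by (simp add: inner_ell2_def scaleR_ell2.rep_eq mult.assoc suminf_mult mult)
  show "0 \<le> inner x x"
    by (simp add: inner_ell2_def suminf_nonneg mult)
  show "inner x x = 0 \<longleftrightarrow> x = 0"
    unfolding inner_ell2_def
    by (subst suminf_eq_zero_iff)
      (auto simp: mult coord_inject[symmetric] zero_ell2.rep_eq fun_eq_iff)
qed (simp_all add: norm_ell2_def dist_ell2_def sgn_ell2_def uniformity_ell2_def open_ell2_def)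

end

lift_definition basis_vec :: "nat \<Rightarrow> ell2" is "\<lambda>i j. if j = i then 1 else 0"
proof -
  fix i :: nat
  show "summable (\<lambda>j. (if j = i then 1 else 0 :: real)\<^sup>2)"
    by (rule summable_finite[of "{i}"]) auto
qed

lemma inner_basis_vec [simp]: "inner x (basis_vec i) = coord x i"
proof -
  have "(\<Sum>j. coord x j * (if j = i then 1 else 0)) = (\<Sum>j\<in>{i}. coord x j * (if j = i then 1 else 0))"
    by (rule suminf_finite) auto
  then show ?thesis by (simp add: inner_ell2_def basis_vec.rep_eq)
qed

definition coord_space :: "nat set \<Rightarrow> ell2 set"
  where "coord_space I = closure (span (basis_vec ` I))"

definition orth_proj :: "ell2 set \<Rightarrow> ell2 \<Rightarrow> ell2"
  where "orth_proj V x = (THE y. y \<in> V \<and> (\<forall>v\<in>V. inner (x - y) v = 0))"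

abbreviation coord_proj :: "nat set \<Rightarrow> ell2 \<Rightarrow> ell2"
  where "coord_proj I \<equiv> orth_proj (coord_space I)"

lemma coord_simps [simp]:
  "coord 0 i = 0" "coord (x + y) i = coord x i + coord y i"
  "coord (x - y) i = coord x i - coord y i" "coord (- x) i = - coord x i"
  "coord (c *\<^sub>R x) i = c * coord x i"
  by (simp_all add: zero_ell2.rep_eq plus_ell2.rep_eq minus_ell2.rep_eq uminus_ell2.rep_eq
      scaleR_ell2.rep_eq)

lemma coord_sum: "coord (sum f A) i = (\<Sum>j\<in>A. coord (f j) i)"
  by (induction A rule: infinite_finite_induct) auto

lemma coord_space_iff: "x \<in> coord_space I \<longleftrightarrow> (\<forall>i. i \<notin> I \<longrightarrow> coord x i = 0)"
proof
  assume x: "x \<in> coord_space I"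
  show "\<forall>i. i \<notin> I \<longrightarrow> coord x i = 0"
  proof (intro allI impI)
    fix i assume i: "i \<notin> I"
    have "subspace {x. inner x (basis_vec i) = 0}"
      by (auto simp: subspace_def)
    moreover have "basis_vec ` I \<subseteq> {x. inner x (basis_vec i) = 0}"
      using i by (auto simp: basis_vec.rep_eq)
    ultimately have "span (basis_vec ` I) \<subseteq> {x. inner x (basis_vec i) = 0}"
      by (simp add: span_minimal)
    moreover have "closed {x. inner x (basis_vec i) = 0}"
      by (intro closed_Collect_eq continuous_intros)
    ultimately have "coord_space I \<subseteq> {x. inner x (basis_vec i) = 0}"
      unfolding coord_space_def by (rule closure_minimal)
    with x show "coord x i = 0" by auto
  qed
next
  assume x: "\<forall>i. i \<notin> I \<longrightarrow> coord x i = 0"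
  define X where "X n = (\<Sum>j<n. coord x j *\<^sub>R basis_vec j)" for n
  have X_span: "X n \<in> span (basis_vec ` I)" for n
    unfolding X_def
  proof (rule span_sum)
    fix j
    show "coord x j *\<^sub>R basis_vec j \<in> span (basis_vec ` I)"
      using x by (cases "j \<in> I") (auto intro: span_scale span_base span_zero)
  qed
  have X_coord: "coord (X n) i = (if i < n then coord x i else 0)" for n i
    by (simp add: X_def coord_sum basis_vec.rep_eq if_distrib[of "\<lambda>t. _ * t"] cong: if_cong)
  have "(norm (x - X n))\<^sup>2 = (\<Sum>i. (coord x i)\<^sup>2) - (\<Sum>i<n. (coord x i)\<^sup>2)" for n
  proof -
    have "(norm (x - X n))\<^sup>2 = (\<Sum>i. (coord (x - X n) i)\<^sup>2)"
      unfolding power2_norm_eq_inner inner_ell2_def by (simp add: power2_eq_square)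
    also have "\<dots> = (\<Sum>i. (coord (x - X n) (i + n))\<^sup>2)
        + (\<Sum>i<n. (coord (x - X n) i)\<^sup>2)"
      by (rule suminf_split_initial_segment[OF summable_coord_sq])
    also have "\<dots> = (\<Sum>i. (coord x (i + n))\<^sup>2)"
      by (simp add: X_coord)
    also have "\<dots> = (\<Sum>i. (coord x i)\<^sup>2) - (\<Sum>i<n. (coord x i)\<^sup>2)"
      using suminf_split_initial_segment[OF summable_coord_sq, of x n] by simp
    finally show ?thesis .
  qed
  moreover have "(\<lambda>n. (\<Sum>i. (coord x i)\<^sup>2) - (\<Sum>i<n. (coord x i)\<^sup>2)) \<longlonglongrightarrow> 0"
    using tendsto_diff[OF tendsto_const summable_LIMSEQ[OF summable_coord_sq[of x]],
        of "\<Sum>i. (coord x i)\<^sup>2"] by simp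
  ultimately have "(\<lambda>n. (norm (x - X n))\<^sup>2) \<longlonglongrightarrow> 0" by simp
  then have "(\<lambda>n. sqrt ((norm (x - X n))\<^sup>2)) \<longlonglongrightarrow> sqrt 0"
    by (rule tendsto_real_sqrt)
  then have "(\<lambda>n. norm (X n - x)) \<longlonglongrightarrow> 0" by (simp add: norm_minus_commute)
  then have "X \<longlonglongrightarrow> x"
    using Lim_null tendsto_norm_zero_iff by blast
  then show "x \<in> coord_space I"
    unfolding coord_space_def closure_sequential using X_span by blast
qed

lemma coord_coord_proj: "coord (coord_proj I x) i = (if i \<in> I then coord x i else 0)"
proof -
  let ?g = "\<lambda>i. if i \<in> I then coord x i else 0"
  have "summable (\<lambda>i. (?g i)\<^sup>2)"
    by (rule summable_comparison_test'[OF summable_coord_sq[of x]]) auto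
  then have g: "coord (Abs_ell2 ?g) = ?g" by (simp add: Abs_ell2_inverse)
  have "orth_proj (coord_space I) x = Abs_ell2 ?g"
    unfolding orth_proj_def
  proof (rule the_equality)
    have "inner (x - Abs_ell2 ?g) v = 0" if "v \<in> coord_space I" for v
    proof -
      have "coord (x - Abs_ell2 ?g) i * coord v i = 0" for i
        using that by (auto simp: coord_space_iff g)
      then show ?thesis by (simp only: inner_ell2_def suminf_zero)
    qed
    then show "Abs_ell2 ?g \<in> coord_space I \<and> (\<forall>v\<in>coord_space I. inner (x - Abs_ell2 ?g) v = 0)"
      by (simp add: coord_space_iff g)
  next
    fix y assume y: "y \<in> coord_space I \<and> (\<forall>v\<in>coord_space I. inner (x - y) v = 0)"
    have "coord y i = ?g i" for i
    proof (cases "i \<in> I")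
      case True
      then have "basis_vec i \<in> coord_space I"
        by (auto simp: coord_space_iff basis_vec.rep_eq)
      with y have "inner (x - y) (basis_vec i) = 0" by blast
      with True show ?thesis by simp
    next
      case False
      with y show ?thesis by (simp add: coord_space_iff)
    qed
    then show "y = Abs_ell2 ?g"
      by (simp add: coord_inject[symmetric] g fun_eq_iff)
  qed
  then show ?thesis by (simp add: g)
qed

text \<open>The product measure lives on functions on \<^term>\<open>I\<close>; it is restricted to the
  square-summable ones, which are then extended by zero outside \<^term>\<open>I\<close>.\<close>

definition gauss_measure :: "(nat \<Rightarrow> real) \<Rightarrow> nat set \<Rightarrow> ell2 measure"
  where "gauss_measure a I =
    distr
      (restrict_space (\<Pi>\<^sub>M i\<in>I. density lborel (normal_density 0 (a i)))
        {x. (\<lambda>i. (x i)\<^sup>2) summable_on I})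
      (restrict_space borel (coord_space I))
      (\<lambda>x. Abs_ell2 (\<lambda>i. if i \<in> I then x i else 0))"

definition C_set :: "(nat \<Rightarrow> real) \<Rightarrow> nat set \<Rightarrow> ell2 set"
  where "C_set a J = {x \<in> coord_space J.
    (\<lambda>i. \<bar>ln (1 / (sqrt (2 * pi) * a i)) - (coord x i)\<^sup>2 / (2 * (a i)\<^sup>2)\<bar>) summable_on J}"

text \<open>Only meaningful on \<^term>\<open>C_set a J\<close>.\<close>

definition F_dens :: "(nat \<Rightarrow> real) \<Rightarrow> nat set \<Rightarrow> ell2 \<Rightarrow> real"
  where "F_dens a J x =
    exp (\<Sum>\<^sub>\<infinity>i\<in>J. ln (1 / (sqrt (2 * pi) * a i)) - (coord x i)\<^sup>2 / (2 * (a i)\<^sup>2))"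

definition index_sim :: "nat set \<Rightarrow> nat set \<Rightarrow> bool"
  where "index_sim I1 I2 \<longleftrightarrow> I1 \<noteq> {} \<and> I2 \<noteq> {} \<and>
    (\<exists>K1 K2. finite K1 \<and> finite K2 \<and> K1 \<subseteq> I1 \<and> K2 \<subseteq> - I1 \<and> card K1 = card K2 \<and>
      I2 = (I1 - K1) \<union> K2)"

definition index_class :: "nat set \<Rightarrow> nat set set"
  where "index_class I = {I'. index_sim I' I}"

definition graph_fun :: "ell2 set \<Rightarrow> ell2 set \<Rightarrow> nat set \<Rightarrow> ell2 \<Rightarrow> ell2"
  where "graph_fun S U I1 y = the_inv_into (S \<inter> U) (coord_proj I1) y - y"

text \<open>Continuous Frechet differentiability on a relatively open subset \<^term>\<open>V\<close> of a coordinate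
  subspace. The derivative \<^term>\<open>f' y\<close> is determined only on that subspace; a continuous family
  of derivatives defined there extends to the whole space by composition with the
  orthogonal projection.\<close>

definition C1_on :: "ell2 set \<Rightarrow> (ell2 \<Rightarrow> ell2) \<Rightarrow> bool"
  where "C1_on V f \<longleftrightarrow> (\<exists>f' :: ell2 \<Rightarrow> ell2 \<Rightarrow>\<^sub>L ell2.
    (\<forall>y\<in>V. (f has_derivative blinfun_apply (f' y)) (at y within V)) \<and> continuous_on V f')"

text \<open>The index set \<^term>\<open>I\<close> stands for the codimension class of its complement.\<close>

definition coordinate_pairing :: "nat set \<Rightarrow> ell2 set \<Rightarrow> ell2 set \<Rightarrow> nat set \<Rightarrow> bool"
  where "coordinate_pairing I S U I1 \<longleftrightarrow>
    open U \<and> S \<inter> U \<noteq> {} \<and> I1 \<in> index_class I \<and>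
    (\<exists>g. homeomorphism (S \<inter> U) (coord_proj I1 ` (S \<inter> U)) (coord_proj I1) g) \<and>
    openin (top_of_set (coord_space I1)) (coord_proj I1 ` (S \<inter> U)) \<and>
    C1_on (coord_proj I1 ` (S \<inter> U)) (graph_fun S U I1)"

definition surface :: "nat set \<Rightarrow> ell2 set \<Rightarrow> bool"
  where "surface I S \<longleftrightarrow> S \<noteq> {} \<and> (\<forall>x\<in>S. \<exists>U I1. x \<in> U \<and> coordinate_pairing I S U I1)"

definition partial :: "(ell2 \<Rightarrow> ell2) \<Rightarrow> nat \<Rightarrow> nat \<Rightarrow> ell2 \<Rightarrow> real"
  where "partial f j i y = deriv (\<lambda>t. inner (f (y + t *\<^sub>R basis_vec j)) (basis_vec i)) 0"

text \<open>The choice of enumerations only affects the sign; only the absolute value is used.\<close>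

definition jac_minor :: "(ell2 \<Rightarrow> ell2) \<Rightarrow> ell2 \<Rightarrow> nat set \<Rightarrow> nat set \<Rightarrow> real"
  where "jac_minor f y I0 J0 = Determinant.det (Matrix.mat (card J0) (card I0)
    (\<lambda>(r, c). partial f (sorted_list_of_set I0 ! c) (sorted_list_of_set J0 ! r) y))"

definition minor_indices :: "nat set \<Rightarrow> (nat set \<times> nat set) set"
  where "minor_indices I1 = {(I0, J0). finite I0 \<and> finite J0 \<and> I0 \<noteq> {} \<and> J0 \<noteq> {} \<and>
    I0 \<subseteq> I1 \<and> J0 \<subseteq> - I1 \<and> card I0 = card J0}"

text \<open>The sum of squared minors may diverge, in which case the value is infinite.\<close>

definition normal_factor :: "ell2 set \<Rightarrow> ell2 set \<Rightarrow> nat set \<Rightarrow> ell2 \<Rightarrow> ennreal"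
  where "normal_factor S U I1 x =
    (let D = (\<lambda>(I0, J0). \<bar>jac_minor (graph_fun S U I1) (coord_proj I1 x) I0 J0\<bar>\<^sup>2)
     in if D summable_on minor_indices I1
        then ennreal (sqrt (1 + infsum D (minor_indices I1))) else \<infinity>)"

definition surface_density ::
  "(nat \<Rightarrow> real) \<Rightarrow> ell2 set \<Rightarrow> ell2 set \<Rightarrow> nat set \<Rightarrow> ell2 \<Rightarrow> ennreal"
  where "surface_density a S U I1 y =
    normal_factor S U I1 (y + graph_fun S U I1 y)
      * ennreal (F_dens a (- I1) (graph_fun S U I1 y))"

definition locally_finite_pairing ::
  "(nat \<Rightarrow> real) \<Rightarrow> nat set \<Rightarrow> ell2 set \<Rightarrow> ell2 set \<Rightarrow> nat set \<Rightarrow> bool"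
  where "locally_finite_pairing a I S U I1 \<longleftrightarrow>
    coordinate_pairing I S U I1 \<and>
    graph_fun S U I1 ` (coord_proj I1 ` (S \<inter> U)) \<subseteq> C_set a (- I1) \<and>
    (SUP y\<in>coord_proj I1 ` (S \<inter> U). surface_density a S U I1 y) < \<infinity>"

definition local_surface_measure ::
  "(nat \<Rightarrow> real) \<Rightarrow> ell2 set \<Rightarrow> ell2 set \<Rightarrow> nat set \<Rightarrow> ell2 set \<Rightarrow> ennreal"
  where "local_surface_measure a S U I1 E =
    (\<integral>\<^sup>+y\<in>coord_proj I1 ` E. surface_density a S U I1 y \<partial>gauss_measure a I1)"

definition measurable_surface :: "(nat \<Rightarrow> real) \<Rightarrow> nat set \<Rightarrow> ell2 set \<Rightarrow> bool"
  where "measurable_surface a I S \<longleftrightarrow> surface I S \<and>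
    (\<exists>\<P>. (\<forall>(U, I1)\<in>\<P>. locally_finite_pairing a I S U I1) \<and> S \<subseteq> (\<Union>(U, I1)\<in>\<P>. U))"

end

theory Submission
  imports Defs
begin

text \<open>Let \<open>I1\<close> and \<open>I2\<close> be the index sets of two overlapping coordinate pairings. They differ in
  finitely many indices, so a change of variables in several dimensions would compare the two local
  surface measures. Instead, one coordinate \<open>j \<in> I1 - I2\<close> is exchanged at a time for a suitable
  \<open>i \<in> I2 - I1\<close>, by induction on \<^term>\<open>card (I1 - I2)\<close>. Such an \<open>i\<close> with \<open>\<partial>\<^sub>j f\<^sub>i \<noteq> 0\<close> exists because the
  tangent space projects injectively to \<open>P\<^sub>I\<^sub>2\<close>, and near the given point the surface is again a graph
  over \<open>P\<^sub>I\<^sub>3\<close> for \<open>I3 = I1 - {j} \<union> {i}\<close>, by the intermediate value theorem along the lines in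
  direction \<open>j\<close>. On each such line the exchange is a one-dimensional substitution, and Fubini's theorem
  gives the equality of the two measures, because the squared normal factor, a sum of squares
  of the Pluecker coordinates of the tangent space normalised by the coordinate at \<open>I1\<close>, is
  multiplied by \<open>(\<partial>\<^sub>j f\<^sub>i)\<^sup>2\<close> under renormalisation. The local measures thus agree on overlaps and are
  glued along a countable subcover.\<close>

section \<open>Topology and measurability in the sequence space\<close>

text \<open>An inverse function theorem for the passage between two index sets would need
  derivatives that depend continuously on the point in operator norm. A single exchange only needs
  strict monotonicity of one real function on each line. A chart therefore only records tangency and
  the continuity of the single entries of its tangent projection, and both survive an exchange. A
  pivot entry is known to be nonzero only near a given point, so the measures are compared near
  points before they are compared on whole overlaps. Nothing bounds the density on an intermediate
  chart, so normal factors and integrals take values in \<open>ennreal\<close> throughout. The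
  weight \<open>F_dens\<close> is made for the exchange. Replacing \<open>j\<close> by
  \<open>i\<close> moves the Gaussian factor of coordinate \<open>j\<close> from the measure into
  the weight and that of coordinate \<open>i\<close> the other way. With \<open>A = I - {j}\<close>,
  both sides then carry the weight of the complement of \<open>A\<close>. What remains is the
  absolute value of the pivot entry, which is at once the ratio of the normal factors and the
  Jacobian of the substitution on the line.\<close>

lemma ell2_eqI: "(\<And>i. coord x i = coord y i) \<Longrightarrow> x = y"
  by (simp add: coord_inject[symmetric] fun_eq_iff)

lemma coord_basis_vec [simp]: "coord (basis_vec i) k = (if k = i then 1 else 0)"
  by (simp add: basis_vec.rep_eq)

lemma bounded_linear_coord: "bounded_linear (\<lambda>x. coord x i)"
  using bounded_linear_inner_left[of "basis_vec i"] by simp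

lemmas continuous_on_coord [continuous_intros] =
  bounded_linear.continuous_on[OF bounded_linear_coord]

lemma norm_basis_vec [simp]: "norm (basis_vec i) = 1"
  by (simp add: norm_eq_sqrt_inner)

lemma abs_coord_le_norm: "\<bar>coord x i\<bar> \<le> norm x"
  using Cauchy_Schwarz_ineq2[of x "basis_vec i"] by simp

lemma norm_sq_ell2: "(norm x)\<^sup>2 = (\<Sum>i. (coord x i)\<^sup>2)"
  unfolding power2_norm_eq_inner inner_ell2_def by (simp add: power2_eq_square)

lemma norm_ell2_le:
  assumes "\<And>i. \<bar>coord x i\<bar> \<le> \<bar>coord y i\<bar>"
  shows "norm x \<le> norm y"
proof -
  have "(norm x)\<^sup>2 \<le> (norm y)\<^sup>2"
    unfolding norm_sq_ell2
    by (intro suminf_le summable_coord_sq) (use assms in \<open>simp add: abs_le_square_iff\<close>)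
  then show ?thesis
    by (simp add: power2_le_iff_abs_le)
qed

lemma bounded_linear_coord_proj: "bounded_linear (coord_proj K)"
proof
  show "coord_proj K (x + y) = coord_proj K x + coord_proj K y" for x y
    by (rule ell2_eqI) (simp add: coord_coord_proj)
  show "coord_proj K (r *\<^sub>R x) = r *\<^sub>R coord_proj K x" for r x
    by (rule ell2_eqI) (simp add: coord_coord_proj)
  have "norm (coord_proj K x) \<le> norm x * 1" for x
    by (simp, rule norm_ell2_le) (simp add: coord_coord_proj)
  then show "\<exists>B. \<forall>x. norm (coord_proj K x) \<le> norm x * B"
    by blast
qed

lemma norm_coord_proj_le: "norm (coord_proj K x) \<le> norm x"
  by (rule norm_ell2_le) (simp add: coord_coord_proj)

lemmas continuous_on_coord_proj [continuous_intros] =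
  bounded_linear.continuous_on[OF bounded_linear_coord_proj]
lemmas coord_proj_diff = linear_diff[OF bounded_linear.linear[OF bounded_linear_coord_proj]]
lemmas coord_proj_add = linear_add[OF bounded_linear.linear[OF bounded_linear_coord_proj]]

lemma coord_proj_in [simp]: "coord_proj K x \<in> coord_space K"
  by (simp add: coord_space_iff coord_coord_proj)

lemma coord_proj_id: "x \<in> coord_space K \<Longrightarrow> coord_proj K x = x"
  by (rule ell2_eqI) (auto simp: coord_space_iff coord_coord_proj)

lemma coord_proj_idem [simp]: "coord_proj K (coord_proj K x) = coord_proj K x"
  by (simp add: coord_proj_id)

lemma coord_proj_compl: "coord_proj K x + coord_proj (- K) x = x"
  by (rule ell2_eqI) (simp add: coord_coord_proj)

lemma coord_proj_basis_vec: "coord_proj K (basis_vec k) = (if k \<in> K then basis_vec k else 0)"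
  by (rule ell2_eqI) (auto simp: coord_coord_proj)

lemma subspace_coord_space: "subspace (coord_space K)"
  by (auto simp: subspace_def coord_space_iff)

lemma basis_vec_in_coord_space [simp]: "basis_vec k \<in> coord_space K \<longleftrightarrow> k \<in> K"
  by (auto simp: coord_space_iff)

lemma closed_coord_space: "closed (coord_space K)"
  by (simp add: coord_space_def)

section \<open>Separability: balls around finite rational combinations of the basis\<close>

definition rational_vec :: "rat list \<Rightarrow> ell2"
  where "rational_vec q = (\<Sum>j<length q. of_rat (q ! j) *\<^sub>R basis_vec j)"

lemma rational_vec_dense:
  assumes "0 < e"
  shows "\<exists>q. dist (rational_vec q) x < e"
proof -
  have "x \<in> closure (span (range basis_vec))"
    using coord_space_iff[of x UNIV] by (simp add: coord_space_def)
  then obtain v where v: "v \<in> span (range basis_vec)" "dist v x < e / 2"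
    using assms unfolding closure_approachable by (meson half_gt_zero)
  obtain n where n: "\<And>i. i \<ge> n \<Longrightarrow> coord v i = 0"
  proof -
    have "\<exists>n. \<forall>i\<ge>n. coord v i = 0"
      using v(1)
    proof (induction rule: span_induct_alt)
      case base then show ?case by simp
    next
      case (step c b y)
      then obtain k n where "b = basis_vec k" "\<forall>i\<ge>n. coord y i = 0" by blast
      then show ?case by (intro exI[of _ "max n (Suc k)"]) auto
    qed
    then show ?thesis using that by blast
  qed
  \<comment> \<open>An error of \<open>e / (2 * Suc n)\<close> in each of \<open>n\<close>
    coordinates adds up to at most \<open>e / 2\<close>; \<open>Suc n\<close> keeps the quotient
    positive for \<open>n = 0\<close>.\<close>
  have "\<exists>r. \<bar>of_rat r - coord v j\<bar> < e / (2 * real (Suc n))" for j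
  proof -
    have "coord v j - e / (2 * real (Suc n)) < coord v j + e / (2 * real (Suc n))"
    proof -
      have "0 < e / (2 * real (Suc n))" using assms by simp
      then show ?thesis by linarith
    qed
    then obtain r where "coord v j - e / (2 * real (Suc n)) < of_rat r"
      "of_rat r < coord v j + e / (2 * real (Suc n))"
      using of_rat_dense by blast
    then show ?thesis by (intro exI[of _ r]) (simp add: abs_less_iff)
  qed
  then obtain r where r: "\<And>j. \<bar>of_rat (r j) - coord v j\<bar> < e / (2 * real (Suc n))" by metis
  let ?q = "map r [0..<n]"
  have "v = (\<Sum>j<n. coord v j *\<^sub>R basis_vec j)"
    by (rule ell2_eqI)
      (simp add: coord_sum n if_distrib[of "\<lambda>t. _ * t"] cong: if_cong)
  moreover have "rational_vec ?q = (\<Sum>j<n. of_rat (r j) *\<^sub>R basis_vec j)"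
    by (simp add: rational_vec_def)
  ultimately have "rational_vec ?q - v = (\<Sum>j<n. (of_rat (r j) - coord v j) *\<^sub>R basis_vec j)"
    by (metis (no_types, lifting) scaleR_diff_left sum.cong sum_subtractf)
  then have "norm (rational_vec ?q - v) \<le> (\<Sum>j<n. norm ((of_rat (r j) - coord v j) *\<^sub>R basis_vec j))"
    by (simp only: norm_sum)
  also have "\<dots> \<le> (\<Sum>j<n. e / (2 * real (Suc n)))"
    using r by (intro sum_mono) (simp add: less_imp_le)
  also have "\<dots> \<le> e / 2"
    using assms by (simp add: field_simps)
  finally have "dist (rational_vec ?q) v \<le> e / 2"
    by (simp add: dist_norm)
  with v(2) have "dist (rational_vec ?q) x < e"
    using dist_triangle[of "rational_vec ?q" x v] by linarith
  then show ?thesis by blast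
qed

definition rational_ball :: "rat list \<times> nat \<Rightarrow> ell2 set"
  where "rational_ball p = ball (rational_vec (fst p)) (1 / real (Suc (snd p)))"

lemma rational_ball_basis:
  assumes "open O'" "x \<in> O'"
  shows "\<exists>p. x \<in> rational_ball p \<and> rational_ball p \<subseteq> O'"
proof -
  obtain e where e: "0 < e" "ball x e \<subseteq> O'"
    using assms by (meson open_contains_ball)
  then obtain n where n: "1 / real (Suc n) < e / 2"
    by (meson half_gt_zero nat_approx_posE)
  obtain q where q: "dist (rational_vec q) x < 1 / real (Suc n)"
    using rational_vec_dense[of "1 / real (Suc n)" x] by auto
  have "y \<in> ball x e" if "y \<in> ball (rational_vec q) (1 / real (Suc n))" for y
    using q n that dist_triangle3[of x y "rational_vec q"] unfolding mem_ball by linarith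
  then have "ball (rational_vec q) (1 / real (Suc n)) \<subseteq> O'"
    using e(2) by (meson subsetD subsetI)
  then show ?thesis
    using q by (intro exI[of _ "(q, n)"]) (simp only: rational_ball_def fst_conv snd_conv mem_ball simp_thms)
qed

text \<open>Second countability yields countable subcovers, and also the measurability of sums such
  as \<open>z + s *\<^sub>R basis_vec j\<close> as functions of the pair.\<close>

instance ell2 :: second_countable_topology
proof
  have "topological_basis (range rational_ball)"
  proof (rule topological_basisI)
    fix O' :: "ell2 set" and x assume "open O'" "x \<in> O'"
    then obtain p where "x \<in> rational_ball p" "rational_ball p \<subseteq> O'"
      using rational_ball_basis by blast
    then show "\<exists>B'\<in>range rational_ball. x \<in> B' \<and> B' \<subseteq> O'" by blast
  qed (auto simp: rational_ball_def)
  then have "open = generate_topology (range rational_ball)"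
    by (rule topological_basis_imp_subbasis)
  then show "\<exists>B::ell2 set set. countable B \<and> open = generate_topology B"
    by (meson countableI_type countable_image)
qed

text \<open>An open set is a countable union of rational balls, and the distance to a fixed centre
  is the root of a series in the coordinates.\<close>

lemma borel_measurable_ell2I:
  fixes f :: "'a \<Rightarrow> ell2"
  assumes "\<And>i. (\<lambda>w. coord (f w) i) \<in> borel_measurable M"
  shows "f \<in> borel_measurable M"
proof (rule borel_measurableI)
  fix O' :: "ell2 set" assume "open O'"
  let ?Q = "{p. rational_ball p \<subseteq> O'}"
  have eq: "O' = (\<Union>p\<in>?Q. rational_ball p)"
    using rational_ball_basis[OF \<open>open O'\<close>] by blast
  have ball: "f -` ball c r \<inter> space M \<in> sets M" for c r
  proof -
    have "dist c (f w) = sqrt (\<Sum>i. (coord c i - coord (f w) i)\<^sup>2)" for w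
      by (simp add: dist_norm norm_sq_ell2[of "c - f w", simplified, symmetric])
    then have "f -` ball c r \<inter> space M = {w \<in> space M. sqrt (\<Sum>i. (coord c i - coord (f w) i)\<^sup>2) < r}"
      by auto
    also have "\<dots> \<in> sets M"
      using assms by measurable
    finally show ?thesis .
  qed
  have "f -` O' \<inter> space M = (\<Union>p\<in>?Q. f -` rational_ball p \<inter> space M)"
    by (subst eq) blast
  also have "\<dots> \<in> sets M"
    by (rule sets.countable_UN'') (auto simp: ball rational_ball_def)
  finally show "f -` O' \<inter> space M \<in> sets M" .
qed

section \<open>Minors under an exchange of one index\<close>

text \<open>The absolute value removes the sign that depends on the order of the indices, so rows
  and columns can be treated as plain sets.\<close>

definition absdet :: "nat set \<Rightarrow> nat set \<Rightarrow> (nat \<Rightarrow> nat \<Rightarrow> real) \<Rightarrow> real"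
  where "absdet R C M = \<bar>Determinant.det (Matrix.mat (card R) (card C)
    (\<lambda>(r, c). M (sorted_list_of_set R ! r) (sorted_list_of_set C ! c)))\<bar>"

lemma sorted_list_of_set_nth_in: "i < card A \<Longrightarrow> sorted_list_of_set A ! i \<in> A"
  by (metis card.infinite length_sorted_list_of_set not_less0 nth_mem set_sorted_list_of_set)

lemma absdet_cong:
  assumes "\<And>r c. r \<in> R \<Longrightarrow> c \<in> C \<Longrightarrow> M r c = N r c"
  shows "absdet R C M = absdet R C N"
proof -
  have "Matrix.mat (card R) (card C) (\<lambda>(r, c). M (sorted_list_of_set R ! r) (sorted_list_of_set C ! c))
    = Matrix.mat (card R) (card C) (\<lambda>(r, c). N (sorted_list_of_set R ! r) (sorted_list_of_set C ! c))"
    by (rule eq_matI) (auto simp: assms sorted_list_of_set_nth_in)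
  then show ?thesis by (simp add: absdet_def)
qed

lemma absdet_mult:
  assumes "finite B" "card R = card B" "card C = card B"
    and "\<And>r c. r \<in> R \<Longrightarrow> c \<in> C \<Longrightarrow> M r c = (\<Sum>l\<in>B. N r l * K l c)"
  shows "absdet R C M = absdet R B N * absdet B C K"
proof -
  define n where "n = card B"
  let ?s = sorted_list_of_set
  let ?N = "Matrix.mat n n (\<lambda>(r, c). N (?s R ! r) (?s B ! c))"
  let ?K = "Matrix.mat n n (\<lambda>(r, c). K (?s B ! r) (?s C ! c))"
  have bij: "bij_betw (\<lambda>l. ?s B ! l) {0..<n} B"
    using assms(1) bij_betw_nth[of "?s B" "{0..<n}" B] by (simp add: n_def lessThan_atLeast0)
  have "Matrix.mat n n (\<lambda>(r, c). M (?s R ! r) (?s C ! c)) = ?N * ?K"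
  proof (rule eq_matI)
    fix r c assume rc: "r < dim_row (?N * ?K)" "c < dim_col (?N * ?K)"
    then have "M (?s R ! r) (?s C ! c) = (\<Sum>l\<in>B. N (?s R ! r) l * K l (?s C ! c))"
      by (intro assms sorted_list_of_set_nth_in) (auto simp: n_def assms)
    also have "\<dots> = (\<Sum>l = 0..<n. N (?s R ! r) (?s B ! l) * K (?s B ! l) (?s C ! c))"
      by (rule sum.reindex_bij_betw[OF bij, symmetric])
    finally show "Matrix.mat n n (\<lambda>(r, c). M (?s R ! r) (?s C ! c)) $$ (r, c) = (?N * ?K) $$ (r, c)"
      using rc by (simp add: scalar_prod_def)
  qed auto
  then have "Determinant.det (Matrix.mat n n (\<lambda>(r, c). M (?s R ! r) (?s C ! c)))
      = Determinant.det ?N * Determinant.det ?K"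
    by (simp add: det_mult[of _ n])
  then show ?thesis
    by (simp add: absdet_def assms(2,3) n_def[symmetric] abs_mult)
qed

lemma remove1_nth_distinct:
  "distinct xs \<Longrightarrow> p < length xs \<Longrightarrow> remove1 (xs ! p) xs = take p xs @ drop (Suc p) xs"
proof (induction xs arbitrary: p)
  case (Cons x xs)
  then show ?case by (cases p) auto
qed simp

text \<open>The index shift is the one in \<open>mat_delete\<close>, so deleting an element of the
  index set matches deleting a row or a column.\<close>

lemma sorted_list_of_set_remove_nth:
  assumes "finite A" "p < card A" "r < card A - 1"
  shows "sorted_list_of_set (A - {sorted_list_of_set A ! p}) ! r
    = sorted_list_of_set A ! (if r < p then r else Suc r)"
proof -
  have "sorted_list_of_set (A - {sorted_list_of_set A ! p})
      = take p (sorted_list_of_set A) @ drop (Suc p) (sorted_list_of_set A)"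
    using assms by (simp add: sorted_list_of_set_remove remove1_nth_distinct)
  then show ?thesis using assms by (auto simp: nth_append)
qed

text \<open>Laplace expansion along row \<open>d\<close>, which has a single entry that may be
  nonzero.\<close>

lemma absdet_remove_row:
  assumes fin: "finite R" "finite C" and card: "card R = card C" and "d \<in> R" "e \<in> C"
    and row: "\<And>c. c \<in> C \<Longrightarrow> c \<noteq> e \<Longrightarrow> M d c = 0"
  shows "absdet R C M = \<bar>M d e\<bar> * absdet (R - {d}) (C - {e}) M"
proof -
  define n where "n = card R"
  let ?s = sorted_list_of_set
  let ?M = "Matrix.mat n n (\<lambda>(r, c). M (?s R ! r) (?s C ! c))"
  obtain p where p: "p < n" "?s R ! p = d"
    using \<open>d \<in> R\<close> fin by (metis in_set_conv_nth length_sorted_list_of_set n_def set_sorted_list_of_set)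
  obtain q where q: "q < n" "?s C ! q = e"
    using \<open>e \<in> C\<close> fin card
    by (metis in_set_conv_nth length_sorted_list_of_set n_def set_sorted_list_of_set)
  have "Determinant.det ?M = (\<Sum>c<n. ?M $$ (p, c) * cofactor ?M p c)"
    by (rule laplace_expansion_row) (use p in auto)
  also have "\<dots> = (\<Sum>c\<in>{q}. ?M $$ (p, c) * cofactor ?M p c)"
  proof (rule sum.mono_neutral_right)
    show "\<forall>c\<in>{..<n} - {q}. ?M $$ (p, c) * cofactor ?M p c = 0"
    proof
      fix c assume c: "c \<in> {..<n} - {q}"
      have "?s C ! c \<noteq> ?s C ! q"
        using c q fin card by (subst nth_eq_iff_index_eq) (auto simp: n_def)
      then have "M d (?s C ! c) = 0"
        using c card q by (intro row sorted_list_of_set_nth_in) (auto simp: n_def)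
      then show "?M $$ (p, c) * cofactor ?M p c = 0"
        using c p by simp
    qed
  qed (use q in auto)
  finally have "\<bar>Determinant.det ?M\<bar> = \<bar>M d e\<bar> * \<bar>Determinant.det (mat_delete ?M p q)\<bar>"
    using p q by (simp add: cofactor_def abs_mult power_abs)
  moreover have "mat_delete ?M p q = Matrix.mat (n - 1) (n - 1)
      (\<lambda>(r, c). M (?s (R - {d}) ! r) (?s (C - {e}) ! c))"
    unfolding mat_delete_def using p q fin card
    by (intro eq_matI)
      (auto simp: n_def sorted_list_of_set_remove_nth simp flip: p(2) q(2))
  ultimately show ?thesis
    using fin card assms(4,5) by (simp add: absdet_def n_def)
qed

text \<open>Read from right to left, this pads a minor with indices common to rows and columns,
  which brings minors for different index sets to the same rows.\<close>

lemma absdet_remove_identity_rows: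
  assumes "finite D" "finite R" "finite C" "card R = card C" "D \<subseteq> R" "D \<subseteq> C"
    and "\<And>d c. d \<in> D \<Longrightarrow> c \<in> C \<Longrightarrow> M d c = (if c = d then 1 else 0)"
  shows "absdet R C M = absdet (R - D) (C - D) M"
  using assms
proof (induction D)
  case (insert d D)
  then have "absdet R C M = absdet (R - D) (C - D) M" by auto
  also have "\<dots> = \<bar>M d d\<bar> * absdet (R - D - {d}) (C - D - {d}) M"
  proof (rule absdet_remove_row)
    show "card (R - D) = card (C - D)"
      using insert.prems insert.hyps by (simp add: card_Diff_subset)
  qed (use insert in auto)
  also have "M d d = 1"
    using insert.prems(6)[of d d] insert.prems(5) by auto
  also have "\<bar>1\<bar> * absdet (R - D - {d}) (C - D - {d}) M = absdet (R - insert d D) (C - insert d D) M"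
    unfolding Diff_insert[of _ d D] by simp
  finally show ?case .
qed simp

lemma absdet_singleton: "absdet {i} {j} M = \<bar>M i j\<bar>"
  using absdet_remove_row[of "{i}" "{j}" i j M] by (simp add: absdet_def)

lemma absdet_empty [simp]: "absdet {} {} M = 1"
  by (simp add: absdet_def)

section \<open>Classes of index sets under finite exchanges\<close>

definition exch :: "nat set \<Rightarrow> nat set set"
  where "exch I = {I'. finite (I' - I) \<and> finite (I - I') \<and> card (I' - I) = card (I - I')}"

text \<open>Counting inside one finite set that contains all differences turns membership into an
  equality of cardinalities, from which transitivity is immediate.\<close>

lemma exch_card_iff:
  assumes "finite F" "I - I' \<subseteq> F" "I' - I \<subseteq> F"
  shows "I' \<in> exch I \<longleftrightarrow> card (I' \<inter> F) = card (I \<inter> F)"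
proof -
  have fin: "finite (I' - I)" "finite (I - I')"
    using assms by (auto intro: finite_subset)
  have "card (I \<inter> F) = card (I \<inter> I' \<inter> F) + card (I - I')"
    using assms fin by (subst card_Un_disjoint[symmetric]) (auto intro: arg_cong[of _ _ card])
  moreover have "card (I' \<inter> F) = card (I \<inter> I' \<inter> F) + card (I' - I)"
    using assms fin by (subst card_Un_disjoint[symmetric]) (auto intro: arg_cong[of _ _ card])
  ultimately show ?thesis
    using fin by (auto simp: exch_def)
qed

lemma exch_sym: "I' \<in> exch I \<longleftrightarrow> I \<in> exch I'"
  by (auto simp: exch_def)

lemma exch_trans:
  assumes "I' \<in> exch I" "I'' \<in> exch I'"
  shows "I'' \<in> exch I"
proof -
  let ?F = "(I - I') \<union> (I' - I) \<union> (I' - I'') \<union> (I'' - I')"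
  have "finite ?F" using assms by (auto simp: exch_def)
  then have "card (I' \<inter> ?F) = card (I \<inter> ?F)" "card (I'' \<inter> ?F) = card (I' \<inter> ?F)"
    using assms exch_card_iff[of ?F I I'] exch_card_iff[of ?F I' I''] by auto
  then show ?thesis
    using \<open>finite ?F\<close> exch_card_iff[of ?F I I''] by auto
qed

lemma exch_eq: "I' \<in> exch I \<Longrightarrow> exch I' = exch I"
  using exch_trans exch_sym by blast

lemma exch_swap: "j \<in> I \<Longrightarrow> i \<notin> I \<Longrightarrow> insert i (I - {j}) \<in> exch I"
proof -
  assume "j \<in> I" "i \<notin> I"
  then have "insert i (I - {j}) - I = {i}" "I - insert i (I - {j}) = {j}" by auto
  then show ?thesis by (simp add: exch_def)
qed

lemma index_sim_exch: "index_sim I1 I2 \<Longrightarrow> I2 \<in> exch I1"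
proof -
  assume "index_sim I1 I2"
  then obtain K1 K2 where K: "finite K1" "finite K2" "K1 \<subseteq> I1" "K2 \<subseteq> - I1" "card K1 = card K2"
    "I2 = (I1 - K1) \<union> K2"
    by (auto simp: index_sim_def)
  then have "I2 - I1 = K2" "I1 - I2 = K1" by auto
  then show ?thesis using K by (simp add: exch_def)
qed

text \<open>A pair \<open>(I\<^sub>0, J\<^sub>0)\<close> of finite sets is encoded by \<open>I' = I - I\<^sub>0 \<union> J\<^sub>0\<close>. The pair of empty sets
  is included and contributes the summand 1 of the squared normal factor.\<close>

definition minor_sq_sum :: "nat set \<Rightarrow> (nat \<Rightarrow> nat \<Rightarrow> real) \<Rightarrow> ennreal"
  where "minor_sq_sum I M =
    (\<integral>\<^sup>+I'. ennreal ((absdet (I' - I) (I - I') M)\<^sup>2) \<partial>count_space (exch I))"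

text \<open>The columns of \<open>M\<close> in \<open>I\<close> and those of \<open>N\<close> in
  \<open>insert i (I - {j})\<close> are two bases of the same space, each with an identity block in
  its own rows. Their minors are the Pluecker coordinates in two normalisations, so they differ by
  one factor that does not depend on \<open>I'\<close>. The sets \<open>R\<close>, \<open>C\<close>,
  \<open>C'\<close> pad both minors to the same rows.\<close>

lemma absdet_pivot:
  assumes ij: "j \<in> I" "i \<notin> I" and c: "M i j \<noteq> 0"
    and M: "\<And>l k. l \<in> I \<Longrightarrow> k \<in> I \<Longrightarrow> M l k = (if l = k then 1 else 0)"
    and Mi: "\<And>l. M l i = 0"
    and N: "\<And>l k. N l k = M l k + ((if k = i then 1 else 0) - M i k) / M i j * M l j"
    and I': "I' \<in> exch I"
  shows "absdet (I' - I) (I - I') M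
    = \<bar>M i j\<bar> * absdet (I' - insert i (I - {j})) (insert i (I - {j}) - I') N"
proof -
  define D where "D = I - {j} - I'"
  define R where "R = I' - (I - {j})"
  define C where "C = insert j D"
  define C' where "C' = insert i D"
  have fin: "finite D" "finite R" "finite C" "finite C'"
  proof -
    have "D \<subseteq> I - I'" "R \<subseteq> insert j (I' - I)" by (auto simp: D_def R_def)
    then show "finite D" "finite R"
      using I' by (auto simp: exch_def intro: finite_subset)
    then show "finite C" "finite C'" by (auto simp: C_def C'_def)
  qed
  have D: "i \<notin> D" "j \<notin> D" using ij by (auto simp: D_def)
  have cardC: "card C = card C'" "card C = Suc (card D)"
    using fin D by (auto simp: C_def C'_def)
  have RC: "R - {j} \<inter> I' = I' - I" "C - {j} \<inter> I' = I - I'"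
    using ij by (auto simp: R_def C_def D_def)
  have card: "card R = card C"
  proof (cases "j \<in> I'")
    case True
    then have "R = insert j (I' - I)" "C = insert j (I - I')"
      using ij by (auto simp: R_def C_def D_def)
    then show ?thesis using I' ij True by (simp add: exch_def)
  next
    case False
    then have "R = I' - I" "C = I - I'"
      using ij by (auto simp: R_def C_def D_def)
    then show ?thesis using I' by (simp add: exch_def)
  qed
  \<comment> \<open>A column of \<open>M\<close> is the combination of columns of \<open>N\<close>
    whose coefficients are its entries in the rows \<open>insert i (I - {j})\<close>. For a column
    in \<open>C\<close> only the rows in \<open>C'\<close> contribute, because the other
    coefficients lie in the identity block off the diagonal.\<close>
  have "absdet R C M = absdet R C' N * absdet C' C M"
  proof (rule absdet_mult)
    fix r k assume r: "r \<in> R" and k: "k \<in> C"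
    have "(\<Sum>l\<in>C'. N r l * M l k) = N r i * M i k + (\<Sum>l\<in>D. N r l * M l k)"
      using fin D by (simp add: C'_def)
    also have "N r i = M r j / M i j"
      by (simp add: N Mi)
    also have "(\<Sum>l\<in>D. N r l * M l k) = (if k = j then 0 else N r k)"
    proof (cases "k = j")
      case True
      then show ?thesis
        using D ij by (auto simp: M D_def intro!: sum.neutral)
    next
      case False
      with k have kD: "k \<in> D" by (simp add: C_def)
      then have "(\<Sum>l\<in>D. N r l * M l k) = (\<Sum>l\<in>D. if l = k then N r k else 0)"
        by (intro sum.cong) (auto simp: M D_def)
      then show ?thesis using False kD fin by simp
    qed
    also have "M r j / M i j * M i k + (if k = j then 0 else N r k) = M r k"
    proof (cases "k = j")
      case True
      then show ?thesis using c by simp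
    next
      case False
      moreover have "k \<noteq> i" using False k D by (auto simp: C_def)
      ultimately show ?thesis using c by (simp add: N)
    qed
    finally show "M r k = (\<Sum>l\<in>C'. N r l * M l k)" by simp
  qed (use fin card cardC in auto)
  also have "absdet C' C M = absdet (C' - D) (C - D) M"
    by (rule absdet_remove_identity_rows) (use fin cardC ij in \<open>auto simp: C_def C'_def D_def M\<close>)
  also have "C' - D = {i}" using D by (auto simp: C'_def)
  also have "C - D = {j}" using D by (auto simp: C_def)
  \<comment> \<open>Row \<open>j\<close> is an identity row of \<open>M\<close> and occurs in
    \<open>R\<close> only if \<open>j\<close> lies in \<open>I'\<close>; the intersection covers
    both cases. The same holds for row \<open>i\<close> of \<open>N\<close> below.\<close>
  also have "absdet R C M = absdet (R - {j} \<inter> I') (C - {j} \<inter> I') M"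
    by (rule absdet_remove_identity_rows)
      (use fin card ij in \<open>auto simp: C_def R_def D_def M\<close>)
  also have "absdet R C' N = absdet (R - {i} \<inter> I') (C' - {i} \<inter> I') N"
    by (rule absdet_remove_identity_rows)
      (use fin card cardC ij c in \<open>auto simp: C'_def R_def D_def M N Mi\<close>)
  also have "R - {i} \<inter> I' = I' - insert i (I - {j})"
    using ij by (auto simp: R_def)
  also have "C' - {i} \<inter> I' = insert i (I - {j}) - I'"
    using ij by (auto simp: C'_def D_def)
  finally show ?thesis
    by (simp add: absdet_singleton RC mult.commute)
qed

text \<open>Both sums range over the same class, so the identity for minors applies term by term,
  and in \<open>ennreal\<close> no convergence has to be known.\<close>

lemma minor_sq_sum_pivot:
  assumes ij: "j \<in> I" "i \<notin> I" and c: "M i j \<noteq> 0"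
    and M: "\<And>l k. l \<in> I \<Longrightarrow> k \<in> I \<Longrightarrow> M l k = (if l = k then 1 else 0)"
    and Mi: "\<And>l. M l i = 0"
    and N: "\<And>l k. N l k = M l k + ((if k = i then 1 else 0) - M i k) / M i j * M l j"
  shows "minor_sq_sum I M = ennreal ((M i j)\<^sup>2) * minor_sq_sum (insert i (I - {j})) N"
proof -
  let ?I = "insert i (I - {j})"
  have "minor_sq_sum I M = (\<integral>\<^sup>+I'. ennreal ((M i j)\<^sup>2) * ennreal ((absdet (I' - ?I) (?I - I') N)\<^sup>2)
      \<partial>count_space (exch I))"
    unfolding minor_sq_sum_def
    by (intro nn_integral_cong)
      (simp add: absdet_pivot[OF assms] power_mult_distrib ennreal_mult'[symmetric])
  also have "\<dots> = ennreal ((M i j)\<^sup>2) * minor_sq_sum ?I N"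
    unfolding minor_sq_sum_def exch_eq[OF exch_swap[OF ij]]
    by (rule nn_integral_cmult) simp
  finally show ?thesis .
qed

section \<open>Charts with tangent projections\<close>

lemma basis_vec_nonzero [simp]: "basis_vec k \<noteq> 0"
  using norm_basis_vec[of k] by (metis norm_zero zero_neq_one)

definition chart_point :: "nat set \<Rightarrow> ell2 set \<Rightarrow> ell2 \<Rightarrow> ell2"
  where "chart_point I S = the_inv_into S (coord_proj I)"

text \<open>\<open>L x\<close> is the projection onto the tangent space at \<open>x\<close> along the coordinates outside \<open>I\<close>.
  Requiring only tangency of this space, instead of a continuously differentiable graph function,
  makes the conditions easy to transfer from one index set to another.\<close>

locale chart =
  fixes I :: "nat set" and S :: "ell2 set" and L :: "ell2 \<Rightarrow> ell2 \<Rightarrow> ell2"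
  assumes homeo: "\<exists>g. homeomorphism S (coord_proj I ` S) (coord_proj I) g"
    and open_image: "openin (top_of_set (coord_space I)) (coord_proj I ` S)"
    and bounded_linear_L: "\<And>x. x \<in> S \<Longrightarrow> bounded_linear (L x)"
    and proj_L: "\<And>x w. x \<in> S \<Longrightarrow> coord_proj I (L x w) = coord_proj I w"
    and L_proj: "\<And>x w. x \<in> S \<Longrightarrow> L x (coord_proj I w) = L x w"
    and continuous_on_L: "\<And>k l. continuous_on S (\<lambda>x. coord (L x (basis_vec k)) l)"
    and tangent: "\<And>x e. x \<in> S \<Longrightarrow> 0 < e \<Longrightarrow>
      \<forall>\<^sub>F x' in at x within S. norm (x' - x - L x (x' - x)) \<le> e * norm (x' - x)"
begin

abbreviation "g \<equiv> chart_point I S"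
abbreviation "V \<equiv> coord_proj I ` S"

lemma inj_on_proj: "inj_on (coord_proj I) S"
  using homeo by (metis homeomorphism_apply1 inj_on_inverseI)

lemma chart_point_proj [simp]: "x \<in> S \<Longrightarrow> g (coord_proj I x) = x"
  by (simp add: chart_point_def the_inv_into_f_f inj_on_proj)

lemma chart_point_in: "y \<in> V \<Longrightarrow> g y \<in> S"
  by auto

lemma proj_chart_point: "y \<in> V \<Longrightarrow> coord_proj I (g y) = y"
  by auto

lemma continuous_on_chart_point: "continuous_on V g"
proof -
  obtain h where h: "homeomorphism S V (coord_proj I) h" using homeo by blast
  then have "continuous_on V h" by (simp add: homeomorphism_def)
  moreover have "h y = g y" if "y \<in> V" for y
    using that h by (auto simp: homeomorphism_def)
  ultimately show ?thesis by (simp cong: continuous_on_cong)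
qed

lemma coord_L: "x \<in> S \<Longrightarrow> l \<in> I \<Longrightarrow> coord (L x w) l = coord w l"
  using proj_L[of x w] by (metis coord_coord_proj)

lemma L_outside: "x \<in> S \<Longrightarrow> k \<notin> I \<Longrightarrow> L x (basis_vec k) = 0"
  using L_proj[of x "basis_vec k"] bounded_linear_L[of x]
  by (simp add: coord_proj_basis_vec linear_0 bounded_linear.linear)

lemma slice_in_V:
  assumes x: "x \<in> S" and k: "k \<in> I"
  shows "\<forall>\<^sub>F s in nhds 0. coord_proj I x + s *\<^sub>R basis_vec k \<in> V"
proof -
  obtain T where T: "open T" "V = coord_space I \<inter> T"
    using open_image by (auto simp: openin_open)
  have "((\<lambda>s. coord_proj I x + s *\<^sub>R basis_vec k) \<longlongrightarrow> coord_proj I x + 0 *\<^sub>R basis_vec k) (nhds 0)"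
    by (intro tendsto_intros filterlim_ident)
  moreover have "coord_proj I x + 0 *\<^sub>R basis_vec k \<in> T"
    using x T by auto
  ultimately have "\<forall>\<^sub>F s in nhds 0. coord_proj I x + s *\<^sub>R basis_vec k \<in> T"
    using T(1) topological_tendstoD by blast
  then show ?thesis
    by (rule eventually_mono)
      (use k in \<open>auto simp: T(2) intro!: subspace_add subspace_scale subspace_coord_space\<close>)
qed

lemma filterlim_slice:
  assumes x: "x \<in> S" and k: "k \<in> I"
  shows "filterlim (\<lambda>s. g (coord_proj I x + s *\<^sub>R basis_vec k)) (at x within S) (at 0)"
  unfolding filterlim_at
proof
  let ?p = "\<lambda>s. coord_proj I x + s *\<^sub>R basis_vec k"
  have ev: "\<forall>\<^sub>F s in at 0. ?p s \<in> V"
    using slice_in_V[OF x k] by (simp add: eventually_at_filter eventually_mono)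
  moreover have "\<forall>\<^sub>F s in at (0::real). s \<noteq> 0"
    by (simp add: eventually_at_filter)
  ultimately show "\<forall>\<^sub>F s in at 0. g (?p s) \<in> S \<and> g (?p s) \<noteq> x"
  proof eventually_elim
    case (elim s)
    have "g (?p s) \<noteq> x"
    proof
      assume "g (?p s) = x"
      then have "?p s = coord_proj I x" using proj_chart_point[OF elim(1)] by simp
      then have "coord (s *\<^sub>R basis_vec k) k = 0" by simp
      with elim(2) show False by simp
    qed
    with elim show ?case by (simp add: chart_point_in)
  qed
  have "continuous (at (coord_proj I x) within V) g"
    using continuous_on_chart_point x by (simp add: continuous_on_eq_continuous_within)
  then have "(g \<longlongrightarrow> g (coord_proj I x)) (at (coord_proj I x) within V)"
    by (simp add: continuous_within)
  moreover have "filterlim ?p (at (coord_proj I x) within V) (at 0)"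
    unfolding filterlim_at
  proof
    show "\<forall>\<^sub>F s in at 0. ?p s \<in> V \<and> ?p s \<noteq> coord_proj I x"
      using ev \<open>\<forall>\<^sub>F s in at (0::real). s \<noteq> 0\<close>
    proof eventually_elim
      case (elim s)
      have "?p s \<noteq> coord_proj I x"
      proof
        assume "?p s = coord_proj I x"
        then have "coord (s *\<^sub>R basis_vec k) k = 0" by simp
        with elim(2) show False by simp
      qed
      with elim show ?case by simp
    qed
    have "(?p \<longlongrightarrow> coord_proj I x + 0 *\<^sub>R basis_vec k) (at 0)"
      by (intro tendsto_intros)
    then show "(?p \<longlongrightarrow> coord_proj I x) (at 0)" by simp
  qed
  ultimately show "((\<lambda>s. g (?p s)) \<longlongrightarrow> x) (at 0)"
    using x by (auto intro: filterlim_compose)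
qed

text \<open>Tangency bounds the error by the distance of the points on the surface. That distance
  has to be bounded by a multiple of the parameter \<open>s\<close> before a derivative
  results.\<close>

lemma slice_has_vector_derivative:
  assumes x: "x \<in> S" and k: "k \<in> I"
  shows "((\<lambda>s. g (coord_proj I x + s *\<^sub>R basis_vec k)) has_vector_derivative L x (basis_vec k)) (at 0)"
  unfolding has_vector_derivative_def has_derivative_within_alt2
proof (intro conjI allI impI)
  let ?p = "\<lambda>s. coord_proj I x + s *\<^sub>R basis_vec k"
  let ?b = "L x (basis_vec k)"
  show "bounded_linear (\<lambda>s. s *\<^sub>R ?b)" by (rule bounded_linear_scaleR_left)
  fix e :: real assume "0 < e"
  \<comment> \<open>The bound 1/2 absorbs the error term and gives
    \<open>norm ?u \<le> 2 * (\<bar>s\<bar> * norm ?b)\<close>; the other bound turns this into an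
    error of at most \<open>e * \<bar>s\<bar>\<close>. Adding 1 excludes a zero denominator.\<close>
  define d where "d = min (1/2) (e / (2 * (norm ?b + 1)))"
  have d: "0 < d" "d \<le> 1/2" "d * (2 * norm ?b) \<le> e"
  proof -
    show "0 < d" using \<open>0 < e\<close> by (auto simp: d_def intro!: divide_pos_pos add_nonneg_pos)
    show "d \<le> 1/2" unfolding d_def by (rule min.cobounded1)
    have "d * (2 * norm ?b) \<le> e / (2 * (norm ?b + 1)) * (2 * (norm ?b + 1))"
      using \<open>0 < e\<close> \<open>0 < d\<close> by (intro mult_mono) (auto simp: d_def)
    also have "\<dots> = e"
      using norm_ge_zero[of ?b] by (simp add: add_nonneg_eq_0_iff)
    finally show "d * (2 * norm ?b) \<le> e" .
  qed
  have "\<forall>\<^sub>F x' in at x within S. norm (x' - x - L x (x' - x)) \<le> d * norm (x' - x)"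
    by (rule tangent[OF x d(1)])
  then have "\<forall>\<^sub>F s in at 0. norm (g (?p s) - x - L x (g (?p s) - x)) \<le> d * norm (g (?p s) - x)"
    using filterlim_slice[OF x k] by (rule eventually_compose_filterlim)
  moreover have "\<forall>\<^sub>F s in at 0. ?p s \<in> V"
    using slice_in_V[OF x k] by (simp add: eventually_at_filter eventually_mono)
  ultimately show "\<forall>\<^sub>F s in at 0. norm (g (?p s) - g (?p 0) - (s - 0) *\<^sub>R ?b) \<le> e * norm (s - 0)"
  proof eventually_elim
    case (elim s)
    let ?u = "g (?p s) - x"
    have "L x ?u = L x (coord_proj I ?u)" by (simp add: L_proj x)
    also have "coord_proj I ?u = s *\<^sub>R basis_vec k"
      using proj_chart_point[OF elim(2)] by (simp add: coord_proj_diff)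
    also have "L x (s *\<^sub>R basis_vec k) = s *\<^sub>R ?b"
      using bounded_linear_L[OF x] by (simp add: linear_scale bounded_linear.linear)
    finally have 1: "norm (?u - s *\<^sub>R ?b) \<le> d * norm ?u" using elim(1) by simp
    also have "d * norm ?u \<le> 1/2 * norm ?u" using d by (intro mult_right_mono) auto
    finally have "norm ?u \<le> 2 * (\<bar>s\<bar> * norm ?b)"
      using norm_triangle_ineq2[of ?u "s *\<^sub>R ?b"] by simp
    then have "d * norm ?u \<le> d * (2 * (\<bar>s\<bar> * norm ?b))"
      using d by (intro mult_left_mono) auto
    also have "\<dots> = d * (2 * norm ?b) * \<bar>s\<bar>" by simp
    also have "\<dots> \<le> e * \<bar>s\<bar>" using d by (intro mult_right_mono) auto
    finally show ?case using 1 x by simp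
  qed
qed

lemma slice_has_real_derivative:
  assumes z: "z + s *\<^sub>R basis_vec k \<in> V" and k: "k \<in> I"
  shows "((\<lambda>t. coord (g (z + t *\<^sub>R basis_vec k)) l) has_real_derivative
    coord (L (g (z + s *\<^sub>R basis_vec k)) (basis_vec k)) l) (at s)"
proof -
  let ?x = "g (z + s *\<^sub>R basis_vec k)"
  have x: "?x \<in> S" "coord_proj I ?x = z + s *\<^sub>R basis_vec k"
    using z chart_point_in proj_chart_point by auto
  have "((\<lambda>t. coord (g (coord_proj I ?x + t *\<^sub>R basis_vec k)) l) has_vector_derivative
      coord (L ?x (basis_vec k)) l) (at 0)"
    by (rule bounded_linear.has_vector_derivative[OF bounded_linear_coord
          slice_has_vector_derivative[OF x(1) k]])
  then have "((\<lambda>t. coord (g (z + (t + s) *\<^sub>R basis_vec k)) l) has_real_derivative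
      coord (L ?x (basis_vec k)) l) (at 0)"
    by (simp add: x(2) has_real_derivative_iff_has_vector_derivative algebra_simps)
  then show ?thesis
    using DERIV_shift[of "\<lambda>t. coord (g (z + t *\<^sub>R basis_vec k)) l" _ 0 s] by simp
qed

end

text \<open>The vector \<open>L1 x (basis_vec k)\<close> is the velocity of a curve in
  \<open>S1\<close> that runs in \<open>S2\<close> near \<open>x\<close>. Dividing the tangency
  estimate of the second chart by the parameter and passing to the limit shows that
  \<open>L2 x\<close> fixes this velocity. The inclusion of the surfaces is only required near
  \<open>x\<close>.\<close>

lemma tangent_agree:
  assumes "chart I1 S1 L1" "chart I2 S2 L2" and x: "x \<in> S1" "x \<in> S2" and k: "k \<in> I1"
    and O': "open O'" "x \<in> O'" "S1 \<inter> O' \<subseteq> S2"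
  shows "L2 x (L1 x (basis_vec k)) = L1 x (basis_vec k)"
proof -
  interpret A: chart I1 S1 L1 by fact
  interpret B: chart I2 S2 L2 by fact
  let ?c = "\<lambda>s. A.g (coord_proj I1 x + s *\<^sub>R basis_vec k)"
  let ?b = "L1 x (basis_vec k)"
  have lin: "bounded_linear (L2 x)" by (rule B.bounded_linear_L) fact
  have lim: "((\<lambda>s. (?c s - x) /\<^sub>R s) \<longlongrightarrow> ?b) (at 0)"
  proof -
    have "((\<lambda>s. norm (?c s - x - s *\<^sub>R ?b) / norm s) \<longlongrightarrow> 0) (at 0)"
      using A.slice_has_vector_derivative[OF x(1) k] x
      by (simp add: has_vector_derivative_def has_derivative_at)
    moreover have "\<forall>\<^sub>F s in at 0. norm (?c s - x - s *\<^sub>R ?b) / norm s = norm ((?c s - x) /\<^sub>R s - ?b)"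
      unfolding eventually_at_filter
    proof (intro always_eventually allI impI)
      fix s :: real assume "s \<noteq> 0"
      then have "(?c s - x) /\<^sub>R s - ?b = (?c s - x - s *\<^sub>R ?b) /\<^sub>R s"
        by (simp add: scaleR_diff_right)
      then show "norm (?c s - x - s *\<^sub>R ?b) / norm s = norm ((?c s - x) /\<^sub>R s - ?b)"
        by (simp add: divide_inverse mult.commute)
    qed
    ultimately have "((\<lambda>s. norm ((?c s - x) /\<^sub>R s - ?b)) \<longlongrightarrow> 0) (at 0)"
      by (rule Lim_transform_eventually)
    then show ?thesis
      by (simp add: tendsto_norm_zero_iff LIM_zero_iff)
  qed
  have fl: "filterlim ?c (at x within S2) (at 0)"
    unfolding filterlim_at
  proof
    have f1: "filterlim ?c (at x within S1) (at 0)" by (rule A.filterlim_slice) fact+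
    show t: "(?c \<longlongrightarrow> x) (at 0)" using f1 by (simp add: filterlim_at)
    have "\<forall>\<^sub>F s in at 0. ?c s \<in> S1 \<and> ?c s \<noteq> x" using f1 by (simp add: filterlim_at)
    moreover have "\<forall>\<^sub>F s in at 0. ?c s \<in> O'" using t O' by (simp add: topological_tendstoD)
    ultimately show "\<forall>\<^sub>F s in at 0. ?c s \<in> S2 \<and> ?c s \<noteq> x"
      by eventually_elim (use O' in auto)
  qed
  have le: "norm (?b - L2 x ?b) \<le> e * norm ?b" if "0 < e" for e
  proof (rule tendsto_le)
    show "((\<lambda>s. norm ((?c s - x) /\<^sub>R s - L2 x ((?c s - x) /\<^sub>R s))) \<longlongrightarrow> norm (?b - L2 x ?b)) (at 0)"
      by (intro tendsto_intros lim bounded_linear.tendsto[OF lin])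
    show "((\<lambda>s. e * norm ((?c s - x) /\<^sub>R s)) \<longlongrightarrow> e * norm ?b) (at 0)"
      by (intro tendsto_intros lim)
    have "\<forall>\<^sub>F s in at 0. norm (?c s - x - L2 x (?c s - x)) \<le> e * norm (?c s - x)"
      using B.tangent[OF x(2) that] fl by (rule eventually_compose_filterlim)
    then show "\<forall>\<^sub>F s in at 0. norm ((?c s - x) /\<^sub>R s - L2 x ((?c s - x) /\<^sub>R s)) \<le> e * norm ((?c s - x) /\<^sub>R s)"
    proof eventually_elim
      case (elim s)
      have "L2 x ((?c s - x) /\<^sub>R s) = L2 x (?c s - x) /\<^sub>R s"
        using lin by (simp add: linear_scale bounded_linear.linear)
      then have "norm ((?c s - x) /\<^sub>R s - L2 x ((?c s - x) /\<^sub>R s)) = norm (?c s - x - L2 x (?c s - x)) / \<bar>s\<bar>"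
        by (simp add: scaleR_diff_right[symmetric] divide_inverse mult.commute)
      also have "\<dots> \<le> e * norm (?c s - x) / \<bar>s\<bar>"
        using elim by (intro divide_right_mono) auto
      finally show ?case by (simp add: divide_inverse mult_ac)
    qed
  qed simp
  have "norm (?b - L2 x ?b) \<le> 0"
  proof (rule field_le_epsilon)
    fix e :: real assume "0 < e"
    have n: "0 < norm ?b + 1" using norm_ge_zero[of ?b] by linarith
    have "norm (?b - L2 x ?b) \<le> e / (norm ?b + 1) * norm ?b"
      using \<open>0 < e\<close> n by (intro le) simp
    also have "\<dots> \<le> e / (norm ?b + 1) * (norm ?b + 1)"
      using \<open>0 < e\<close> n by (intro mult_left_mono) auto
    also have "\<dots> = e" using n by simp
    finally show "norm (?b - L2 x ?b) \<le> 0 + e" by simp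
  qed
  then show ?thesis by simp
qed

lemma ex_pivot:
  assumes "chart I1 S1 L1" "chart I2 S2 L2" and x: "x \<in> S1" "x \<in> S2"
    and O': "open O'" "x \<in> O'" "S1 \<inter> O' \<subseteq> S2"
    and j: "j \<in> I1" "j \<notin> I2"
  shows "\<exists>i\<in>I2 - I1. coord (L1 x (basis_vec j)) i \<noteq> 0"
proof (rule ccontr)
  interpret A: chart I1 S1 L1 by fact
  interpret B: chart I2 S2 L2 by fact
  let ?b = "L1 x (basis_vec j)"
  assume "\<not> ?thesis"
  \<comment> \<open>In \<open>I1\<close> the vector \<open>?b\<close> has the coordinates of
    \<open>basis_vec j\<close>, and \<open>j\<close> is not in \<open>I2\<close>; the coordinates in
    \<open>I2 - I1\<close> vanish by the assumption to be refuted.\<close>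
  then have "coord ?b l = 0" if "l \<in> I2" for l
    using that A.coord_L[OF x(1)] j by (cases "l \<in> I1") auto
  then have "coord_proj I2 ?b = 0"
    by (intro ell2_eqI) (simp add: coord_coord_proj)
  then have "L2 x ?b = 0"
    using B.L_proj[OF x(2), of ?b] B.bounded_linear_L[OF x(2)]
    by (simp add: linear_0 bounded_linear.linear)
  then have "?b = 0"
    using tangent_agree[OF assms(1,2) x j(1) O'] by simp
  moreover have "coord ?b j = 1" using A.coord_L[OF x(1) j(1)] by simp
  ultimately show False by simp
qed

text \<open>The projection onto the same tangent space, now along the coordinates outside
  \<^term>\<open>insert i (I - {j})\<close>.\<close>

definition pivot :: "(ell2 \<Rightarrow> ell2 \<Rightarrow> ell2) \<Rightarrow> nat \<Rightarrow> nat \<Rightarrow> ell2 \<Rightarrow> ell2 \<Rightarrow> ell2"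
  where "pivot L j i x w = L x w
    + ((coord w i - coord (L x w) i) / coord (L x (basis_vec j)) i) *\<^sub>R L x (basis_vec j)"

lemma (in chart) ball_in_V:
  assumes "y \<in> V" "open O'" "g y \<in> O'"
  shows "\<exists>r>0. \<forall>y'\<in>coord_space I. dist y' y < r \<longrightarrow> y' \<in> V \<and> g y' \<in> O'"
proof -
  have "openin (top_of_set V) (V \<inter> g -` O')"
    by (rule continuous_openin_preimage_gen[OF continuous_on_chart_point assms(2)])
  then have "openin (top_of_set (coord_space I)) (V \<inter> g -` O')"
    using open_image openin_trans by blast
  moreover have "y \<in> V \<inter> g -` O'" using assms by blast
  ultimately obtain r where r: "r > 0" "ball y r \<inter> coord_space I \<subseteq> V \<inter> g -` O'"
    unfolding openin_contains_ball by blast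
  have "y' \<in> V \<and> g y' \<in> O'" if "y' \<in> coord_space I" "dist y' y < r" for y'
    using r(2) that by (auto simp: dist_commute)
  then show ?thesis using r(1) by blast
qed

section \<open>Exchange of one index of a chart near a point\<close>

context chart
begin

context
  fixes j i :: nat
  assumes ji: "j \<in> I" "i \<notin> I"
begin

abbreviation "I3 \<equiv> insert i (I - {j})"
abbreviation "c x \<equiv> coord (L x (basis_vec j)) i"

text \<open>The number \<open>\<sigma>\<close> will be the sign of the pivot entry, so that
  increasing and decreasing coordinates are treated together.\<close>

lemma slice_less:
  assumes "s1 < s2" and "\<And>s. s1 \<le> s \<Longrightarrow> s \<le> s2 \<Longrightarrow> z + s *\<^sub>R basis_vec j \<in> V"
    and "\<And>s. s1 \<le> s \<Longrightarrow> s \<le> s2 \<Longrightarrow> 0 < \<sigma> * c (g (z + s *\<^sub>R basis_vec j))"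
  shows "\<sigma> * coord (g (z + s1 *\<^sub>R basis_vec j)) i < \<sigma> * coord (g (z + s2 *\<^sub>R basis_vec j)) i"
proof (rule DERIV_pos_imp_increasing[OF assms(1)])
  fix s assume "s1 \<le> s" "s \<le> s2"
  then show "\<exists>y. ((\<lambda>t. \<sigma> * coord (g (z + t *\<^sub>R basis_vec j)) i) has_real_derivative y) (at s) \<and> 0 < y"
    using assms(2,3)[of s] slice_has_real_derivative[of z s j i] ji
    by (intro exI[of _ "\<sigma> * c (g (z + s *\<^sub>R basis_vec j))"] conjI DERIV_cmult) auto
qed

context
  fixes y0 :: ell2 and r \<sigma> :: real
  assumes B: "\<And>y. y \<in> coord_space I \<Longrightarrow> dist y y0 < r \<Longrightarrow> y \<in> V \<and> 0 < \<sigma> * c (g y)"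
    and y0: "y0 \<in> coord_space I" and \<sigma>: "\<bar>\<sigma>\<bar> = 1"
begin

abbreviation "S3 \<equiv> S \<inter> {x. dist (coord_proj I x) y0 < r}"

text \<open>The ball in the coordinate space is convex, so the segment between the two points stays
  where the pivot entry has constant sign.\<close>

lemma slice_less_ball:
  assumes "s1 < s2" and "z + s1 *\<^sub>R basis_vec j \<in> coord_space I \<inter> ball y0 r"
    and "z + s2 *\<^sub>R basis_vec j \<in> coord_space I \<inter> ball y0 r"
  shows "\<sigma> * coord (g (z + s1 *\<^sub>R basis_vec j)) i < \<sigma> * coord (g (z + s2 *\<^sub>R basis_vec j)) i"
proof -
  have conv: "convex (coord_space I \<inter> ball y0 r)"
    by (intro convex_Int convex_ball subspace_imp_convex subspace_coord_space)
  have in_ball: "z + s *\<^sub>R basis_vec j \<in> coord_space I \<inter> ball y0 r" if "s1 \<le> s" "s \<le> s2" for s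
  proof -
    define u where "u = (s - s1) / (s2 - s1)"
    have u: "0 \<le> u" "u \<le> 1" "u * (s2 - s1) = s - s1" using that assms(1) by (auto simp: u_def)
    have "(1 - u) *\<^sub>R (z + s1 *\<^sub>R basis_vec j) + u *\<^sub>R (z + s2 *\<^sub>R basis_vec j)
        = z + (s1 + u * (s2 - s1)) *\<^sub>R basis_vec j"
      by (simp add: algebra_simps)
    also have "\<dots> = z + s *\<^sub>R basis_vec j" using u by simp
    finally show ?thesis
      using convexD_alt[OF conv assms(2,3) u(1,2)] by simp
  qed
  show ?thesis
    using assms(1) in_ball B by (intro slice_less) (auto simp: dist_commute)
qed

text \<open>Two points with the same projection to \<open>I3\<close> lie over one line in direction
  \<open>j\<close> and share coordinate \<open>i\<close>, which is strictly monotone along that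
  line.\<close>

lemma inj_on_exchange: "inj_on (coord_proj I3) S3"
proof (rule inj_onI)
  fix x x' assume x: "x \<in> S3" and x': "x' \<in> S3" and eq: "coord_proj I3 x = coord_proj I3 x'"
  let ?y = "coord_proj I x"
  define s where "s = coord x' j - coord x j"
  have co: "coord x l = coord x' l" if "l \<in> I3" for l
    using eq that by (metis coord_coord_proj)
  have y': "coord_proj I x' = ?y + s *\<^sub>R basis_vec j"
    using co ji by (intro ell2_eqI) (auto simp: coord_coord_proj s_def)
  have co_g: "coord (g (?y + s *\<^sub>R basis_vec j)) i = coord (g (?y + 0 *\<^sub>R basis_vec j)) i"
    using x x' co[of i] by (simp flip: y')
  have mem: "?y + 0 *\<^sub>R basis_vec j \<in> coord_space I \<inter> ball y0 r"
    "?y + s *\<^sub>R basis_vec j \<in> coord_space I \<inter> ball y0 r"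
    using x x' by (auto simp: dist_commute simp flip: y')
  have "s = 0"
  proof (rule linorder_cases[of s 0])
    assume "s < 0"
    from slice_less_ball[OF this mem(2) mem(1)] co_g show ?thesis by simp
  next
    assume "0 < s"
    from slice_less_ball[OF this mem] co_g show ?thesis by simp
  qed
  then have "coord_proj I x = coord_proj I x'" using y' by simp
  then show "x = x'" using x x' inj_on_proj by (auto dest: inj_onD)
qed

lemma near:
  assumes "y \<in> coord_space I" "dist y y0 < r" "open O'" "g y \<in> O'"
  obtains d where "d > 0" "\<And>y'. y' \<in> coord_space I \<Longrightarrow> dist y' y < d \<Longrightarrow> dist y' y0 < r \<and> g y' \<in> O'"
proof -
  obtain d where d: "d > 0" "\<forall>y'\<in>coord_space I. dist y' y < d \<longrightarrow> y' \<in> V \<and> g y' \<in> O'"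
    using ball_in_V[of y O'] B[OF assms(1,2)] assms by blast
  show ?thesis
  proof (rule that[of "min d (r - dist y y0)"])
    show "0 < min d (r - dist y y0)" using d assms by simp
    fix y' assume "y' \<in> coord_space I" "dist y' y < min d (r - dist y y0)"
    then show "dist y' y0 < r \<and> g y' \<in> O'"
      using d dist_triangle[of y' y0 y] by auto
  qed
qed

text \<open>Admitting an arbitrary open \<open>O'\<close> shows that the projection is an open map
  on \<open>S3\<close>. This gives the open image and the continuity of the inverse at once.\<close>

lemma open_exchange:
  assumes "open O'"
  shows "openin (top_of_set (coord_space I3)) (coord_proj I3 ` (S3 \<inter> O'))"
  unfolding openin_contains_ball
proof (intro conjI ballI)
  show "coord_proj I3 ` (S3 \<inter> O') \<subseteq> coord_space I3" by auto
  fix w0 assume "w0 \<in> coord_proj I3 ` (S3 \<inter> O')"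
  then obtain x where x: "x \<in> S" "dist (coord_proj I x) y0 < r" "x \<in> O'" and w0: "w0 = coord_proj I3 x"
    by auto
  define y where "y = coord_proj I x"
  have y: "y \<in> coord_space I" "dist y y0 < r" "g y = x" using x by (auto simp: y_def)
  have ej: "s *\<^sub>R basis_vec j \<in> coord_space I" for s
    using ji by (intro subspace_scale subspace_coord_space) simp
  obtain \<rho> where \<rho>: "\<rho> > 0"
    "\<And>y'. y' \<in> coord_space I \<Longrightarrow> dist y' y < \<rho> \<Longrightarrow> dist y' y0 < r \<and> g y' \<in> O'"
    using near[OF y(1,2) assms] x y by auto
  \<comment> \<open>Half of \<open>\<rho>\<close> is kept for the step in direction
    \<open>j\<close>, the other half for the displacement \<open>z\<close> in the remaining
    coordinates.\<close>
  define \<epsilon> where "\<epsilon> = \<rho> / 2"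
  have \<epsilon>: "0 < \<epsilon>" using \<rho> by (simp add: \<epsilon>_def)
  have yj: "y + s *\<^sub>R basis_vec j \<in> coord_space I" for s
    using y ej by (intro subspace_add subspace_coord_space)
  have ydist: "dist (y + s *\<^sub>R basis_vec j) y0 < r" if "\<bar>s\<bar> \<le> \<epsilon>" for s
  proof -
    have "dist (y + s *\<^sub>R basis_vec j) y < \<rho>" using that \<epsilon> by (simp add: dist_norm \<epsilon>_def)
    then show ?thesis using \<rho>(2) yj by blast
  qed
  let ?\<alpha> = "\<lambda>s. \<sigma> * coord (g (y + s *\<^sub>R basis_vec j)) i"
  have lt: "?\<alpha> (- \<epsilon>) < ?\<alpha> 0" "?\<alpha> 0 < ?\<alpha> \<epsilon>"
    using \<epsilon> yj ydist[of "-\<epsilon>"] ydist[of \<epsilon>] ydist[of 0] yj[of 0]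
    by (auto intro!: slice_less_ball simp del: scaleR_zero_left scaleR_minus_left simp: dist_commute)
  \<comment> \<open>The midpoints leave a margin on both sides: at the displaced ends the coordinate
    stays beyond \<open>m1\<close> and \<open>m2\<close>, while the wanted value stays between
    them.\<close>
  define m1 where "m1 = (?\<alpha> (- \<epsilon>) + ?\<alpha> 0) / 2"
  define m2 where "m2 = (?\<alpha> 0 + ?\<alpha> \<epsilon>) / 2"
  have m: "?\<alpha> (- \<epsilon>) < m1" "m1 < ?\<alpha> 0" "?\<alpha> 0 < m2" "m2 < ?\<alpha> \<epsilon>"
    using lt by (auto simp: m1_def m2_def)
  have open1: "open {x. \<sigma> * coord x i < m1}" "open {x. m2 < \<sigma> * coord x i}"
    by (intro open_Collect_less continuous_intros)+
  obtain d1 where d1: "d1 > 0" "\<And>y'. y' \<in> coord_space I \<Longrightarrow> dist y' (y + (-\<epsilon>) *\<^sub>R basis_vec j) < d1 \<Longrightarrow>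
      dist y' y0 < r \<and> g y' \<in> {x. \<sigma> * coord x i < m1}"
    using near[OF yj ydist open1(1), of "-\<epsilon>"] \<epsilon> m by auto
  obtain d2 where d2: "d2 > 0" "\<And>y'. y' \<in> coord_space I \<Longrightarrow> dist y' (y + \<epsilon> *\<^sub>R basis_vec j) < d2 \<Longrightarrow>
      dist y' y0 < r \<and> g y' \<in> {x. m2 < \<sigma> * coord x i}"
    using near[OF yj ydist open1(2), of "\<epsilon>"] \<epsilon> m by auto
  \<comment> \<open>The radii \<open>d1\<close> and \<open>d2\<close> control the two ends of the
    displaced segment, \<open>\<epsilon>\<close> keeps it within distance \<open>\<rho>\<close>, and
    the last two entries keep the target value between \<open>m1\<close> and
    \<open>m2\<close>.\<close>
  define d where "d = Min {d1, d2, \<epsilon>, ?\<alpha> 0 - m1, m2 - ?\<alpha> 0}"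
  have d: "d > 0" "d \<le> d1" "d \<le> d2" "d \<le> \<epsilon>" "d \<le> ?\<alpha> 0 - m1" "d \<le> m2 - ?\<alpha> 0"
    using d1 d2 \<epsilon> m by (auto simp: d_def)
  have "ball w0 d \<inter> coord_space I3 \<subseteq> coord_proj I3 ` (S3 \<inter> O')"
  proof
    fix w assume w: "w \<in> ball w0 d \<inter> coord_space I3"
    \<comment> \<open>The prescribed change of the coordinates in \<open>I - {j}\<close>. Coordinate
      \<open>j\<close> is left free and is used to reach the prescribed coordinate
      \<open>i\<close>.\<close>
    define z where "z = coord_proj (I - {j}) (w - x)"
    have "norm z \<le> norm (w - w0)"
      by (rule norm_ell2_le) (simp add: z_def w0 coord_coord_proj)
    then have z: "norm z < d" using w by (simp add: dist_norm norm_minus_commute)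
    have zI: "z + s *\<^sub>R basis_vec j \<in> coord_space I" for s
      using ji by (auto simp: z_def coord_space_iff coord_coord_proj)
    have yz: "y + z + s *\<^sub>R basis_vec j \<in> coord_space I" for s
      using subspace_add[OF subspace_coord_space y(1) zI] by (simp add: add.assoc)
    have "\<bar>\<sigma> * coord w i - ?\<alpha> 0\<bar> = \<bar>coord (w - w0) i\<bar>"
      using \<sigma> y(3) by (simp add: w0 coord_coord_proj abs_mult flip: right_diff_distrib)
    also have "\<dots> \<le> norm (w - w0)" by (rule abs_coord_le_norm)
    also have "\<dots> < d" using w by (simp add: dist_norm norm_minus_commute)
    finally have wi: "m1 < \<sigma> * coord w i" "\<sigma> * coord w i < m2"
      using d by linarith+
    have sdist: "dist (y + z + s *\<^sub>R basis_vec j) y < \<rho>" if "\<bar>s\<bar> \<le> \<epsilon>" for s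
    proof -
      have "dist (y + z + s *\<^sub>R basis_vec j) y \<le> norm z + \<bar>s\<bar>"
        using norm_triangle_ineq[of z "s *\<^sub>R basis_vec j"] by (simp add: dist_norm add.assoc)
      then show ?thesis using z d that by (simp add: \<epsilon>_def)
    qed
    have "\<exists>s. -\<epsilon> \<le> s \<and> s \<le> \<epsilon> \<and> \<sigma> * coord (g (y + z + s *\<^sub>R basis_vec j)) i = \<sigma> * coord w i"
    proof (rule IVT')
      have "dist (y + z + (-\<epsilon>) *\<^sub>R basis_vec j) (y + (-\<epsilon>) *\<^sub>R basis_vec j) < d1"
        using z d by (simp add: dist_norm)
      then show "\<sigma> * coord (g (y + z + (-\<epsilon>) *\<^sub>R basis_vec j)) i \<le> \<sigma> * coord w i"
        using d1(2)[OF yz] wi by fastforce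
      have "dist (y + z + \<epsilon> *\<^sub>R basis_vec j) (y + \<epsilon> *\<^sub>R basis_vec j) < d2"
        using z d by (simp add: dist_norm)
      then show "\<sigma> * coord w i \<le> \<sigma> * coord (g (y + z + \<epsilon> *\<^sub>R basis_vec j)) i"
        using d2(2)[OF yz] wi by fastforce
      show "continuous_on {-\<epsilon>..\<epsilon>} (\<lambda>s. \<sigma> * coord (g (y + z + s *\<^sub>R basis_vec j)) i)"
      proof (intro continuous_at_imp_continuous_on ballI)
        fix s assume "s \<in> {-\<epsilon>..\<epsilon>}"
        then have "y + z + s *\<^sub>R basis_vec j \<in> V"
          using sdist[of s] \<rho>(2)[OF yz] B[OF yz] by (auto simp: abs_le_iff)
        then show "isCont (\<lambda>s. \<sigma> * coord (g (y + z + s *\<^sub>R basis_vec j)) i) s"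
          using slice_has_real_derivative[of "y + z" s j i] ji
          by (intro continuous_intros DERIV_isCont) auto
      qed
    qed (use \<epsilon> in auto)
    then obtain s where "-\<epsilon> \<le> s" "s \<le> \<epsilon>"
      and s2: "\<sigma> * coord (g (y + z + s *\<^sub>R basis_vec j)) i = \<sigma> * coord w i"
      by blast
    then have "\<bar>s\<bar> \<le> \<epsilon>" by simp
    note s = this s2
    define x' where "x' = g (y + z + s *\<^sub>R basis_vec j)"
    have b: "dist (y + z + s *\<^sub>R basis_vec j) y0 < r" "x' \<in> O'"
      using \<rho>(2)[OF yz sdist] s by (auto simp: x'_def)
    then have inV: "y + z + s *\<^sub>R basis_vec j \<in> V" using B yz by blast
    then have x': "x' \<in> S" "coord_proj I x' = y + z + s *\<^sub>R basis_vec j"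
      using chart_point_in proj_chart_point unfolding x'_def by blast+
    have "coord_proj I3 x' = w"
    proof (rule ell2_eqI)
      fix l
      consider "l = i" | "l \<in> I - {j}" "l \<noteq> i" | "l \<notin> I3" by auto
      then show "coord (coord_proj I3 x') l = coord w l"
      proof cases
        case 1
        then show ?thesis using s(2) \<sigma> by (auto simp: coord_coord_proj x'_def)
      next
        case 2
        then have "coord x' l = coord (coord_proj I x') l" by (simp add: coord_coord_proj)
        then show ?thesis
          using 2 unfolding x'(2) by (simp add: coord_coord_proj y_def z_def)
      next
        case 3
        then show ?thesis using w by (auto simp: coord_coord_proj coord_space_iff)
      qed
    qed
    then show "w \<in> coord_proj I3 ` (S3 \<inter> O')"
      using x' b by (intro image_eqI[of _ _ x']) auto
  qed
  then show "\<exists>e>0. ball w0 e \<inter> coord_space I3 \<subseteq> coord_proj I3 ` (S3 \<inter> O')"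
    using d(1) by blast
qed

lemma c_nonzero: "x \<in> S3 \<Longrightarrow> c x \<noteq> 0"
  using B[of "coord_proj I x"] by auto

lemma chart_exchange: "chart I3 S3 (pivot L j i)"
proof (rule chart.intro)
  have cont: "continuous_on S3 (coord_proj I3)"
    by (intro continuous_intros)
  obtain h where "homeomorphism S3 (coord_proj I3 ` S3) (coord_proj I3) h"
  proof (rule homeomorphism_injective_open_map[OF cont refl inj_on_exchange])
    fix W assume "openin (top_of_set S3) W"
    then obtain O' where O': "open O'" "W = S3 \<inter> O'" by (auto simp: openin_open)
    show "openin (top_of_set (coord_proj I3 ` S3)) (coord_proj I3 ` W)"
      unfolding O'(2) by (rule openin_subset_trans[OF open_exchange[OF O'(1)]]) auto
  qed blast
  then show "\<exists>h. homeomorphism S3 (coord_proj I3 ` S3) (coord_proj I3) h" by blast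
  show "openin (top_of_set (coord_space I3)) (coord_proj I3 ` S3)"
    using open_exchange[of UNIV] by simp
next
  fix x assume x: "x \<in> S3"
  then have xS: "x \<in> S" by simp
  have c: "c x \<noteq> 0" by (rule c_nonzero) fact
  have lin: "bounded_linear (L x)" by (rule bounded_linear_L) fact
  show lin3: "bounded_linear (pivot L j i x)"
    unfolding pivot_def
    by (intro bounded_linear_add lin bounded_linear_compose[OF bounded_linear_scaleR_left]
        bounded_linear_compose[OF bounded_linear_divide] bounded_linear_sub bounded_linear_coord
        bounded_linear_compose[OF bounded_linear_coord])
  show "coord_proj I3 (pivot L j i x w) = coord_proj I3 w" for w
  proof (rule ell2_eqI)
    fix l
    show "coord (coord_proj I3 (pivot L j i x w)) l = coord (coord_proj I3 w) l"
      using c coord_L[OF xS] ji by (auto simp: coord_coord_proj pivot_def)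
  qed
  show "pivot L j i x (coord_proj I3 w) = pivot L j i x w" for w
  proof -
    \<comment> \<open>The only coordinate of \<open>?v\<close> in \<open>I\<close> is
      \<open>j\<close>, and its coordinate \<open>i\<close> vanishes. The correction term of
      \<open>pivot\<close> therefore cancels \<open>coord w j *\<^sub>R L x (basis_vec j)\<close>
      exactly.\<close>
    let ?v = "w - coord_proj I3 w"
    have "L x ?v = L x (coord_proj I ?v)" by (simp add: L_proj xS)
    also have "coord_proj I ?v = coord w j *\<^sub>R basis_vec j"
      using ji by (intro ell2_eqI) (auto simp: coord_coord_proj)
    also have "L x (coord w j *\<^sub>R basis_vec j) = coord w j *\<^sub>R L x (basis_vec j)"
      using lin by (simp add: linear_scale bounded_linear.linear)
    finally have "pivot L j i x ?v = 0"
      using c unfolding pivot_def by (simp add: coord_coord_proj)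
    then show ?thesis
      using linear_diff[OF bounded_linear.linear[OF lin3], of w "coord_proj I3 w"] by simp
  qed
  fix e :: real assume "0 < e"
  obtain K where K: "K > 0" "\<And>v. norm (pivot L j i x v) \<le> norm v * K"
    using bounded_linear.pos_bounded[OF lin3] by blast
  have "\<forall>\<^sub>F x' in at x within S. norm (x' - x - L x (x' - x)) \<le> e / (1 + K) * norm (x' - x)"
    using \<open>0 < e\<close> K by (intro tangent xS) simp
  then have "\<forall>\<^sub>F x' in at x within S3. norm (x' - x - L x (x' - x)) \<le> e / (1 + K) * norm (x' - x)"
    by (rule filter_leD[OF at_le, rotated]) simp
  then show "\<forall>\<^sub>F x' in at x within S3. norm (x' - x - pivot L j i x (x' - x)) \<le> e * norm (x' - x)"
  proof eventually_elim
    case (elim x')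
    let ?u = "x' - x"
    \<comment> \<open>The pivoted map is the identity on the range of \<open>L x\<close>. Its error
      at \<open>?u\<close> is thus determined by \<open>?u - L x ?u\<close>, at the cost of the
      factor \<open>1 + K\<close> that the tolerance \<open>e / (1 + K)\<close> anticipates.\<close>
    have "L x (L x ?u) = L x (coord_proj I (L x ?u))" by (simp add: L_proj xS)
    also have "\<dots> = L x ?u" by (simp add: proj_L L_proj xS)
    finally have "pivot L j i x (L x ?u) = L x ?u" by (simp add: pivot_def)
    then have "?u - pivot L j i x ?u = (?u - L x ?u) - pivot L j i x (?u - L x ?u)"
      by (simp add: linear_diff[OF bounded_linear.linear[OF lin3]])
    also have "norm \<dots> \<le> norm (?u - L x ?u) + norm (?u - L x ?u) * K"
      by (rule order_trans[OF norm_triangle_ineq4]) (intro add_mono order_refl K)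
    also have "\<dots> = (1 + K) * norm (?u - L x ?u)" by (simp add: algebra_simps)
    also have "\<dots> \<le> (1 + K) * (e / (1 + K) * norm ?u)"
      using elim K by (intro mult_left_mono) auto
    also have "\<dots> = e * norm ?u" using K by simp
    finally show ?case .
  qed
next
  fix k l
  have contL: "continuous_on S3 (\<lambda>x. coord (L x (basis_vec k')) l')" for k' l'
    using continuous_on_L by (rule continuous_on_subset) simp
  show "continuous_on S3 (\<lambda>x. coord (pivot L j i x (basis_vec k)) l)"
    unfolding pivot_def coord_simps using c_nonzero
    by (intro contL continuous_on_add continuous_on_mult continuous_on_divide continuous_on_diff
        continuous_on_const) auto
qed

end

lemma ex_chart_exchange:
  assumes x0: "x0 \<in> S" "c x0 \<noteq> 0"
  shows "\<exists>U. open U \<and> x0 \<in> U \<and> chart I3 (S \<inter> U) (pivot L j i) \<and> (\<forall>x\<in>S \<inter> U. c x \<noteq> 0)"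
proof -
  define \<sigma> where "\<sigma> = sgn (c x0)"
  let ?y0 = "coord_proj I x0"
  have \<sigma>: "\<bar>\<sigma>\<bar> = 1" "0 < \<sigma> * c x0" using x0 by (auto simp: \<sigma>_def sgn_if)
  have "continuous_on V (\<lambda>y. \<sigma> * c (g y))"
    by (intro continuous_intros continuous_on_compose2[OF continuous_on_L continuous_on_chart_point]) auto
  then have "openin (top_of_set V) (V \<inter> (\<lambda>y. \<sigma> * c (g y)) -` {0<..})"
    by (rule continuous_openin_preimage_gen) simp
  then have "openin (top_of_set (coord_space I)) (V \<inter> (\<lambda>y. \<sigma> * c (g y)) -` {0<..})"
    using open_image openin_trans by blast
  moreover have "?y0 \<in> V \<inter> (\<lambda>y. \<sigma> * c (g y)) -` {0<..}" using x0 \<sigma> by simp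
  ultimately obtain r where r: "r > 0" "ball ?y0 r \<inter> coord_space I \<subseteq> V \<inter> (\<lambda>y. \<sigma> * c (g y)) -` {0<..}"
    unfolding openin_contains_ball by blast
  then have B: "y \<in> V \<and> 0 < \<sigma> * c (g y)" if "y \<in> coord_space I" "dist y ?y0 < r" for y
    using that by (auto simp: dist_commute)
  let ?U = "{x. dist (coord_proj I x) ?y0 < r}"
  have "open ?U" by (intro open_Collect_less continuous_intros)
  moreover have "chart I3 (S \<inter> ?U) (pivot L j i)"
    by (rule chart_exchange[OF B coord_proj_in \<sigma>(1)])
  moreover have "\<forall>x\<in>S \<inter> ?U. c x \<noteq> 0"
    using c_nonzero[OF B coord_proj_in \<sigma>(1)] by blast
  ultimately show ?thesis using r(1) by (intro exI[of _ ?U]) auto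
qed

end

end

section \<open>Coordinate pairings as charts\<close>

text \<open>The sum of squared minors may diverge; the root is then infinite, in accordance with
  \<open>normal_factor\<close>.\<close>

definition esqrt :: "ennreal \<Rightarrow> ennreal"
  where "esqrt t = (if t = \<infinity> then \<infinity> else ennreal (sqrt (enn2real t)))"

lemma measurable_esqrt [measurable]: "esqrt \<in> borel_measurable borel"
  unfolding esqrt_def by measurable

lemma esqrt_ennreal: "0 \<le> r \<Longrightarrow> esqrt (ennreal r) = ennreal (sqrt r)"
  by (simp add: esqrt_def)

lemma esqrt_mult_square:
  assumes "c \<noteq> 0"
  shows "esqrt (ennreal (c\<^sup>2) * t) = ennreal \<bar>c\<bar> * esqrt t"
proof (cases t)
  case (real r)
  then show ?thesis
    by (simp add: esqrt_ennreal real_sqrt_mult flip: ennreal_mult)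
next
  case top
  then show ?thesis
    using assms by (simp add: esqrt_def ennreal_mult_top)
qed

text \<open>In a chart, column \<open>k\<close> in \<open>I\<close> is the tangent vector over
  \<open>basis_vec k\<close>: the rows in \<open>I\<close> form the identity block, the rows outside
  \<open>I\<close> contain the partial derivatives of the graph function. Columns outside
  \<open>I\<close> vanish.\<close>

abbreviation tmat :: "(ell2 \<Rightarrow> ell2 \<Rightarrow> ell2) \<Rightarrow> ell2 \<Rightarrow> nat \<Rightarrow> nat \<Rightarrow> real"
  where "tmat L x \<equiv> \<lambda>l k. coord (L x (basis_vec k)) l"

definition chart_normal :: "nat set \<Rightarrow> (ell2 \<Rightarrow> ell2 \<Rightarrow> ell2) \<Rightarrow> ell2 \<Rightarrow> ennreal"
  where "chart_normal I L x = esqrt (minor_sq_sum I (tmat L x))"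

lemma minor_sq_sum_cong:
  assumes "\<And>l k. l \<notin> I \<Longrightarrow> k \<in> I \<Longrightarrow> M l k = N l k"
  shows "minor_sq_sum I M = minor_sq_sum I N"
  unfolding minor_sq_sum_def
  by (intro nn_integral_cong arg_cong[of _ _ "\<lambda>t. ennreal (t\<^sup>2)"] absdet_cong assms) auto

lemma (in chart) chart_normal_pivot:
  assumes "x \<in> S" "j \<in> I" "i \<notin> I" "coord (L x (basis_vec j)) i \<noteq> 0"
  shows "chart_normal I L x = ennreal \<bar>coord (L x (basis_vec j)) i\<bar>
    * chart_normal (insert i (I - {j})) (pivot L j i) x"
proof -
  have "minor_sq_sum I (tmat L x) = ennreal ((coord (L x (basis_vec j)) i)\<^sup>2)
      * minor_sq_sum (insert i (I - {j})) (tmat (pivot L j i) x)"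
    by (rule minor_sq_sum_pivot)
      (use assms in \<open>auto simp: coord_L L_outside pivot_def\<close>)
  then show ?thesis
    using assms(4) by (simp add: chart_normal_def esqrt_mult_square)
qed

section \<open>Measurability of the normal factor\<close>

lemma countable_exch: "countable (exch I)"
proof -
  have "exch I \<subseteq> (\<lambda>(A, B). (I - A) \<union> B) ` ({A. finite A} \<times> {B. finite B})"
  proof
    fix I' assume "I' \<in> exch I"
    moreover have "I' = (I - (I - I')) \<union> (I' - I)" by auto
    ultimately show "I' \<in> (\<lambda>(A, B). (I - A) \<union> B) ` ({A. finite A} \<times> {B. finite B})"
      by (auto simp: exch_def intro!: image_eqI[of _ _ "(I - I', I' - I)"])
  qed
  moreover have "countable ({A :: nat set. finite A} \<times> {B :: nat set. finite B})"
    by (intro countable_SIGMA) (simp_all add: uncountable_def countable_Collect_finite)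
  ultimately show ?thesis
    by (meson countable_image countable_subset)
qed

text \<open>The Leibniz formula is a polynomial in the entries; a non-square matrix has determinant
  0 by convention.\<close>

lemma borel_measurable_absdet:
  assumes [measurable]: "\<And>l k. (\<lambda>x. M x l k) \<in> borel_measurable N"
  shows "(\<lambda>x. absdet R C (M x)) \<in> borel_measurable N"
proof (cases "card R = card C")
  case True
  have "Determinant.det (Matrix.mat (card R) (card C)
      (\<lambda>(r, c). M x (sorted_list_of_set R ! r) (sorted_list_of_set C ! c)))
    = (\<Sum>p\<in>{p. p permutes {0..<card C}}. signof p *
      (\<Prod>i = 0..<card C. M x (sorted_list_of_set R ! i) (sorted_list_of_set C ! p i)))" for x
    by (subst det_def'[of _ "card C"])
      (auto simp: True permutes_in_image intro!: sum.cong prod.cong)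
  then show ?thesis
    unfolding absdet_def by simp
next
  case False
  then show ?thesis
    by (simp add: absdet_def Determinant.det_def)
qed

text \<open>The class of index sets is countable, so its counting measure is sigma-finite and the
  sum is a measurable function of the parameter.\<close>

lemma borel_measurable_minor_sq_sum:
  assumes "\<And>l k. (\<lambda>x. M x l k) \<in> borel_measurable N"
  shows "(\<lambda>x. minor_sq_sum I (M x)) \<in> borel_measurable N"
proof -
  interpret sigma_finite_measure "count_space (exch I)"
    by (rule sigma_finite_measure_count_space_countable[OF countable_exch])
  have "(\<lambda>(I', x). ennreal ((absdet (I' - I) (I - I') (M x))\<^sup>2))
      \<in> borel_measurable (count_space (exch I) \<Otimes>\<^sub>M N)"
    using assms by (intro measurable_pair_measure_countable1[OF countable_exch])
      (simp, intro measurable_compose[OF _ measurable_ennreal] borel_measurable_power borel_measurable_absdet)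
  then show ?thesis
    unfolding minor_sq_sum_def
    by (intro borel_measurable_nn_integral) (use measurable_pair_swap_iff in fastforce)
qed

lemma (in chart) borel_measurable_chart_normal:
  "chart_normal I L \<in> borel_measurable (restrict_space borel S)"
proof -
  have "(\<lambda>x. minor_sq_sum I (tmat L x)) \<in> borel_measurable (restrict_space borel S)"
    by (intro borel_measurable_minor_sq_sum borel_measurable_continuous_on_restrict continuous_on_L)
  then show ?thesis
    unfolding chart_normal_def[abs_def] by measurable
qed

text \<open>This links the case distinction on summability in \<open>normal_factor\<close> with
  unconditional sums in \<open>ennreal\<close>.\<close>

lemma nn_integral_count_space_infsum:
  fixes D :: "'a \<Rightarrow> real"
  assumes "\<And>x. x \<in> A \<Longrightarrow> 0 \<le> D x"
  shows "(\<integral>\<^sup>+x. ennreal (D x) \<partial>count_space A) = (if D summable_on A then ennreal (infsum D A) else \<infinity>)"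
proof (cases "D summable_on A")
  case True
  then have "Infinite_Sum.abs_summable_on D A"
    by (rule summable_on_iff_abs_summable_on_real[THEN iffD1])
  then have "Infinite_Set_Sum.abs_summable_on D A"
    by (simp only: abs_summable_equivalent)
  then have "(\<integral>\<^sup>+x. ennreal (D x) \<partial>count_space A) = ennreal (infsetsum D A)"
    using assms by (rule nn_integral_conv_infsetsum)
  with True \<open>Infinite_Set_Sum.abs_summable_on D A\<close> show ?thesis
    by (simp add: infsetsum_infsum)
next
  case False
  have "(\<integral>\<^sup>+x. ennreal (D x) \<partial>count_space A) = \<infinity>"
  proof (rule ccontr)
    assume fin: "(\<integral>\<^sup>+x. ennreal (D x) \<partial>count_space A) \<noteq> \<infinity>"
    have "(\<integral>\<^sup>+x. ennreal (norm (D x)) \<partial>count_space A) = (\<integral>\<^sup>+x. ennreal (D x) \<partial>count_space A)"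
      using assms by (intro nn_integral_cong) simp
    then have "Infinite_Set_Sum.abs_summable_on D A"
      using fin by (simp add: abs_summable_on_def integrable_iff_bounded less_top)
    then have "Infinite_Sum.abs_summable_on D A"
      by (simp only: abs_summable_equivalent)
    then have "D summable_on A"
      by (rule summable_on_iff_abs_summable_on_real[THEN iffD2])
    with False show False by simp
  qed
  with False show ?thesis by simp
qed

lemma minor_indices_diff:
  assumes "(I0, J0) \<in> minor_indices I"
  shows "I - ((I - I0) \<union> J0) = I0" "((I - I0) \<union> J0) - I = J0"
proof -
  have "I0 \<subseteq> I" "J0 \<inter> I = {}" using assms by (auto simp: minor_indices_def)
  then show "I - ((I - I0) \<union> J0) = I0" "((I - I0) \<union> J0) - I = J0" by blast+
qed

text \<open>Within the class, one of the two differences is empty exactly if the other is. Removing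
  \<open>I\<close> therefore removes just the pair of empty sets.\<close>

lemma bij_betw_minor_indices:
  "bij_betw (\<lambda>(I0, J0). (I - I0) \<union> J0) (minor_indices I) (exch I - {I})"
proof (rule bij_betw_byWitness[where f' = "\<lambda>I'. (I - I', I' - I)"])
  note eq = minor_indices_diff
  show "\<forall>p\<in>minor_indices I. (\<lambda>I'. (I - I', I' - I)) ((\<lambda>(I0, J0). (I - I0) \<union> J0) p) = p"
  proof
    fix p assume "p \<in> minor_indices I"
    then show "(\<lambda>I'. (I - I', I' - I)) ((\<lambda>(I0, J0). (I - I0) \<union> J0) p) = p"
      by (cases p) (simp only: prod.case eq)
  qed
  show "\<forall>I'\<in>exch I - {I}. (\<lambda>(I0, J0). (I - I0) \<union> J0) ((\<lambda>I'. (I - I', I' - I)) I') = I'"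
    by auto
  show "(\<lambda>(I0, J0). (I - I0) \<union> J0) ` minor_indices I \<subseteq> exch I - {I}"
  proof clarify
    fix I0 J0 assume p: "(I0, J0) \<in> minor_indices I"
    then have "I0 \<noteq> {}" by (simp add: minor_indices_def)
    then have "(I - I0) \<union> J0 \<noteq> I" using eq(1)[OF p] by auto
    moreover have "(I - I0) \<union> J0 \<in> exch I"
      unfolding exch_def mem_Collect_eq eq[OF p] using p by (simp add: minor_indices_def)
    ultimately show "(I - I0) \<union> J0 \<in> exch I - {I}" by simp
  qed
  show "(\<lambda>I'. (I - I', I' - I)) ` (exch I - {I}) \<subseteq> minor_indices I"
  proof (rule image_subsetI)
    fix I' assume "I' \<in> exch I - {I}"
    then have I': "I' \<in> exch I" "I' \<noteq> I" by auto
    have "I' - I = {} \<longleftrightarrow> I - I' = {}"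
      using I'(1) unfolding exch_def by (metis (mono_tags, lifting) card_0_eq mem_Collect_eq)
    with I'(2) have "I' - I \<noteq> {}" "I - I' \<noteq> {}" by blast+
    then show "(I - I', I' - I) \<in> minor_indices I"
      using I'(1) unfolding minor_indices_def exch_def by auto
  qed
qed

lemma minor_sq_sum_eq:
  "minor_sq_sum I M = 1 + (\<integral>\<^sup>+p. ennreal ((absdet (snd p) (fst p) M)\<^sup>2) \<partial>count_space (minor_indices I))"
proof -
  let ?f = "\<lambda>I'. ennreal ((absdet (I' - I) (I - I') M)\<^sup>2)"
  have "{I} \<union> (exch I - {I}) = exch I" by (auto simp: exch_def)
  then have "minor_sq_sum I M = (\<integral>\<^sup>+I'\<in>{I} \<union> (exch I - {I}). ?f I' \<partial>count_space UNIV)"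
    by (simp add: minor_sq_sum_def nn_integral_count_space_indicator)
  also have "\<dots> = (\<integral>\<^sup>+I'\<in>{I}. ?f I' \<partial>count_space UNIV) + (\<integral>\<^sup>+I'\<in>exch I - {I}. ?f I' \<partial>count_space UNIV)"
    by (rule nn_integral_disjoint_pair_countspace) auto
  also have "(\<integral>\<^sup>+I'\<in>{I}. ?f I' \<partial>count_space UNIV) = (\<integral>\<^sup>+I'. ?f I' \<partial>count_space {I})"
    by (simp add: nn_integral_count_space_indicator)
  also have "\<dots> = 1"
    by (simp add: nn_integral_count_space_finite)
  also have "(\<integral>\<^sup>+I'\<in>exch I - {I}. ?f I' \<partial>count_space UNIV) = (\<integral>\<^sup>+I'. ?f I' \<partial>count_space (exch I - {I}))"
    by (simp add: nn_integral_count_space_indicator)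
  also have "\<dots> = (\<integral>\<^sup>+p. ?f ((\<lambda>(I0, J0). (I - I0) \<union> J0) p) \<partial>count_space (minor_indices I))"
    by (rule nn_integral_bij_count_space[OF bij_betw_minor_indices, symmetric])
  also have "\<dots> = (\<integral>\<^sup>+p. ennreal ((absdet (snd p) (fst p) M)\<^sup>2) \<partial>count_space (minor_indices I))"
  proof (intro nn_integral_cong)
    fix p assume "p \<in> space (count_space (minor_indices I))"
    then show "?f ((\<lambda>(I0, J0). (I - I0) \<union> J0) p) = ennreal ((absdet (snd p) (fst p) M)\<^sup>2)"
      by (cases p) (simp only: space_count_space prod.case fst_conv snd_conv minor_indices_diff)
  qed
  finally show ?thesis .
qed

lemma graph_fun_eq: "graph_fun S U I y = chart_point I (S \<inter> U) y - y"
  by (simp add: graph_fun_def chart_point_def)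

text \<open>The graph function differs from the surface point by its argument, which has no
  coordinate \<open>l\<close> outside \<open>I\<close>.\<close>

lemma partial_graph_fun:
  assumes "chart I (S \<inter> U) L" "x \<in> S \<inter> U" "k \<in> I" "l \<notin> I"
  shows "partial (graph_fun S U I) k l (coord_proj I x) = coord (L x (basis_vec k)) l"
proof -
  interpret chart I "S \<inter> U" L by fact
  have "((\<lambda>t. coord (g (coord_proj I x + t *\<^sub>R basis_vec k)) l) has_real_derivative
      coord (L (g (coord_proj I x + 0 *\<^sub>R basis_vec k)) (basis_vec k)) l) (at 0)"
    by (rule slice_has_real_derivative) (use assms in auto)
  moreover have "coord (g (coord_proj I x + t *\<^sub>R basis_vec k)) l
      = inner (graph_fun S U I (coord_proj I x + t *\<^sub>R basis_vec k)) (basis_vec l)" for t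
    using assms(3,4) by (auto simp: graph_fun_eq coord_coord_proj)
  ultimately show ?thesis
    unfolding partial_def using assms(2) by (simp add: DERIV_imp_deriv)
qed

lemma normal_factor_eq:
  assumes "chart I (S \<inter> U) L" and x: "x \<in> S \<inter> U"
  shows "normal_factor S U I x = chart_normal I L x"
proof -
  define D where "D = (\<lambda>(I0, J0). \<bar>jac_minor (graph_fun S U I) (coord_proj I x) I0 J0\<bar>\<^sup>2)"
  have D: "D p = (absdet (snd p) (fst p) (tmat L x))\<^sup>2" if "p \<in> minor_indices I" for p
  proof -
    obtain I0 J0 where p: "p = (I0, J0)" by (cases p)
    have "\<bar>jac_minor (graph_fun S U I) (coord_proj I x) I0 J0\<bar>
        = absdet J0 I0 (\<lambda>l k. partial (graph_fun S U I) k l (coord_proj I x))"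
      by (simp add: jac_minor_def absdet_def)
    also have "\<dots> = absdet J0 I0 (tmat L x)"
      by (intro absdet_cong partial_graph_fun[OF assms])
        (use that in \<open>auto simp: p minor_indices_def\<close>)
    finally show ?thesis by (simp only: D_def p prod.case fst_conv snd_conv)
  qed
  have D_nonneg: "0 \<le> D p" for p by (simp add: D_def case_prod_beta)
  have "minor_sq_sum I (tmat L x) = 1 + (\<integral>\<^sup>+p. ennreal (D p) \<partial>count_space (minor_indices I))"
    unfolding minor_sq_sum_eq by (intro arg_cong[of _ _ "\<lambda>t. 1 + t"] nn_integral_cong) (simp add: D)
  also have "\<dots> = 1 + (if D summable_on minor_indices I then ennreal (infsum D (minor_indices I)) else \<infinity>)"
    by (subst nn_integral_count_space_infsum) (simp_all add: D_nonneg)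
  also have "\<dots> = (if D summable_on minor_indices I then ennreal (1 + infsum D (minor_indices I)) else \<infinity>)"
    using infsum_nonneg[of "minor_indices I" D] D_nonneg by (simp add: ennreal_plus)
  finally have "chart_normal I L x = (if D summable_on minor_indices I
      then ennreal (sqrt (1 + infsum D (minor_indices I))) else \<infinity>)"
    unfolding chart_normal_def using infsum_nonneg[of "minor_indices I" D] D_nonneg
    by (simp add: esqrt_ennreal) (simp add: esqrt_def)
  then show ?thesis
    unfolding normal_factor_def D_def[symmetric] Let_def by simp
qed

text \<open>With this \<open>L\<close>, the deviation from tangency is the complementary projection
  of the remainder of the graph function, and passing to base points does not increase
  distances.\<close>

lemma coordinate_pairing_chart:
  assumes "coordinate_pairing I S U I1"
  shows "\<exists>L. chart I1 (S \<inter> U) L"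
proof -
  let ?S = "S \<inter> U" and ?P = "coord_proj I1" and ?Q = "coord_proj (- I1)"
  let ?V = "?P ` ?S" and ?f = "graph_fun S U I1"
  have homeo: "\<exists>g. homeomorphism ?S ?V ?P g" and op: "openin (top_of_set (coord_space I1)) ?V"
    and "C1_on ?V ?f"
    using assms by (auto simp: coordinate_pairing_def)
  then obtain f' :: "ell2 \<Rightarrow> ell2 \<Rightarrow>\<^sub>L ell2" where
    f': "\<And>y. y \<in> ?V \<Longrightarrow> (?f has_derivative blinfun_apply (f' y)) (at y within ?V)"
    and cont: "continuous_on ?V f'"
    unfolding C1_on_def by blast
  \<comment> \<open>Applying \<open>?Q\<close> spares a proof that the derivative takes values in \<open>coord_space (- I1)\<close>.\<close>
  define L where "L x w = ?P w + ?Q (blinfun_apply (f' (?P x)) (?P w))" for x w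
  have inj: "inj_on ?P ?S"
    using homeo by (metis homeomorphism_apply1 inj_on_inverseI)
  have f: "?f (?P x) = ?Q x" if "x \<in> ?S" for x
    using coord_proj_compl[of I1 x] that inj
    by (simp add: graph_fun_def the_inv_into_f_f algebra_simps)
  have "chart I1 ?S L"
  proof (rule chart.intro[OF homeo op])
    fix x w assume x: "x \<in> ?S"
    show "bounded_linear (L x)"
      unfolding L_def
      by (intro bounded_linear_add bounded_linear_coord_proj
          bounded_linear_compose[OF bounded_linear_coord_proj]
          bounded_linear_compose[OF blinfun.bounded_linear_right])
    have "?P (?Q v) = 0" for v
      by (rule ell2_eqI) (simp add: coord_coord_proj)
    then show "?P (L x w) = ?P w"
      by (simp add: L_def coord_proj_add)
    show "L x (?P w) = L x w"
      by (simp add: L_def)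
  next
    fix k l
    have "continuous_on ?S (\<lambda>x. f' (?P x))"
      by (rule continuous_on_compose2[OF cont]) (auto intro: continuous_intros)
    then show "continuous_on ?S (\<lambda>x. coord (L x (basis_vec k)) l)"
      unfolding L_def by (intro continuous_intros)
  next
    fix x and e :: real assume x: "x \<in> ?S" and e: "0 < e"
    have "\<forall>\<^sub>F y in at (?P x) within ?V.
        norm (?f y - ?f (?P x) - f' (?P x) (y - ?P x)) \<le> e * norm (y - ?P x)"
      using f'[of "?P x"] x e unfolding has_derivative_within_alt2 by blast
    moreover have "filterlim ?P (at (?P x) within ?V) (at x within ?S)"
      unfolding filterlim_at
    proof
      show "\<forall>\<^sub>F x' in at x within ?S. ?P x' \<in> ?V \<and> ?P x' \<noteq> ?P x"
        unfolding eventually_at_filter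
        by (rule always_eventually) (use x inj in \<open>auto dest: inj_onD\<close>)
      show "(?P \<longlongrightarrow> ?P x) (at x within ?S)"
        by (intro bounded_linear.tendsto[OF bounded_linear_coord_proj] tendsto_ident_at)
    qed
    ultimately have "\<forall>\<^sub>F x' in at x within ?S.
        norm (?f (?P x') - ?f (?P x) - f' (?P x) (?P x' - ?P x)) \<le> e * norm (?P x' - ?P x)"
      by (rule eventually_compose_filterlim)
    moreover have "\<forall>\<^sub>F x' in at x within ?S. x' \<in> ?S"
      by (simp add: eventually_at_filter)
    ultimately show "\<forall>\<^sub>F x' in at x within ?S. norm (x' - x - L x (x' - x)) \<le> e * norm (x' - x)"
    proof eventually_elim
      case (elim x')
      let ?d = "f' (?P x) (?P x' - ?P x)"
      have "x' - x - L x (x' - x) = ?Q (?f (?P x') - ?f (?P x) - ?d)"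
      proof (rule ell2_eqI)
        fix i
        show "coord (x' - x - L x (x' - x)) i = coord (?Q (?f (?P x') - ?f (?P x) - ?d)) i"
          unfolding f[OF x] f[OF elim(2)] by (simp add: L_def coord_coord_proj coord_proj_diff)
      qed
      then have "norm (x' - x - L x (x' - x)) \<le> norm (?f (?P x') - ?f (?P x) - ?d)"
        using norm_coord_proj_le by simp
      also have "\<dots> \<le> e * norm (?P x' - ?P x)" by (rule elim(1))
      also have "\<dots> \<le> e * norm (x' - x)"
        using e norm_coord_proj_le[of I1 "x' - x"] by (simp add: coord_proj_diff)
      finally show ?case .
    qed
  qed
  then show ?thesis by blast
qed

section \<open>Gaussian measures and one-dimensional substitution\<close>

abbreviation log_density :: "(nat \<Rightarrow> real) \<Rightarrow> ell2 \<Rightarrow> nat \<Rightarrow> real"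
  where "log_density a x i \<equiv> ln (1 / (sqrt (2 * pi) * a i)) - (coord x i)\<^sup>2 / (2 * (a i)\<^sup>2)"

lemma exp_log_density:
  assumes "0 < a i"
  shows "exp (log_density a x i) = normal_density 0 (a i) (coord x i)"
proof -
  have "sqrt (2 * pi * (a i)\<^sup>2) = sqrt (2 * pi) * a i"
    using assms by (simp add: real_sqrt_mult)
  moreover have "exp (p - q) = exp p * exp (- q)" for p q :: real
    by (simp add: exp_diff exp_minus divide_inverse)
  moreover have "0 < 1 / (sqrt (2 * pi) * a i)" using assms by simp
  ultimately show ?thesis
    by (simp only: normal_density_def exp_ln) simp
qed

lemma summable_on_insert_real:
  fixes f :: "'a \<Rightarrow> real"
  shows "f summable_on insert j J \<longleftrightarrow> f summable_on J"
proof
  assume "f summable_on insert j J"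
  then show "f summable_on J" by (rule summable_on_subset_banach) auto
next
  assume "f summable_on J"
  then have "f summable_on (J - {j})" by (rule summable_on_subset_banach) auto
  then have "f summable_on (J - {j}) \<union> {j}"
    by (rule summable_on_Un_disjoint) auto
  then show "f summable_on insert j J" by (simp add: insert_absorb)
qed

text \<open>The logarithmic constant in each summand is the normalisation of the Gaussian density,
  so a single index splits off as a probability density.\<close>

lemma F_dens_insert:
  assumes "0 < a j" "j \<notin> J" "log_density a x summable_on J"
  shows "F_dens a (insert j J) x = normal_density 0 (a j) (coord x j) * F_dens a J x"
proof -
  have "infsum (log_density a x) (insert j J) = log_density a x j + infsum (log_density a x) J"
    using assms infsum_Un_disjoint[of "log_density a x" "{j}" J] by simp
  then have "F_dens a (insert j J) x = exp (log_density a x j) * F_dens a J x"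
    unfolding F_dens_def by (simp only: exp_add)
  then show ?thesis by (simp only: exp_log_density[of a j x, OF assms(1)])
qed

lemma F_dens_nonneg: "0 \<le> F_dens a J x"
  by (simp add: F_dens_def)

text \<open>On \<open>S\<close> the unconditional sum equals an ordered series of measurable
  functions.\<close>

lemma borel_measurable_F_dens:
  assumes "\<And>x. x \<in> S \<Longrightarrow> log_density a x summable_on J"
  shows "F_dens a J \<in> borel_measurable (restrict_space borel S)"
proof -
  let ?h = "\<lambda>x i. if i \<in> J then log_density a x i else 0"
  have "F_dens a J x = exp (\<Sum>i. ?h x i)" if "x \<in> S" for x
  proof -
    have "((log_density a x) has_sum infsum (log_density a x) J) J"
      using assms[OF that] by simp
    then have "(?h x has_sum infsum (log_density a x) J) UNIV"
      by (rule has_sum_cong_neutral[THEN iffD1, rotated -1]) auto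
    then have "?h x sums infsum (log_density a x) J"
      by (rule has_sum_imp_sums)
    then show ?thesis by (simp add: F_dens_def sums_iff)
  qed
  moreover have "(\<lambda>x. exp (\<Sum>i. ?h x i)) \<in> borel_measurable (restrict_space borel S)"
  proof -
    have [measurable]: "(\<lambda>x. coord x i) \<in> borel_measurable (restrict_space borel S)" for i
      by (intro borel_measurable_continuous_on_restrict continuous_intros)
    have "(\<lambda>x. ?h x i) \<in> borel_measurable (restrict_space borel S)" for i
      by (cases "i \<in> J") auto
    then show ?thesis by measurable
  qed
  ultimately show ?thesis
    by (subst measurable_cong) (auto simp: space_restrict_space)
qed

section \<open>Gaussian measures and the separation of one coordinate\<close>

abbreviation gauss_factor :: "(nat \<Rightarrow> real) \<Rightarrow> nat \<Rightarrow> real measure"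
  where "gauss_factor a i \<equiv> density lborel (normal_density 0 (a i))"

text \<open>A version of the embedding that is total and measurable on the whole product space;
  sequences that are not square-summable get the default 0.\<close>

definition embed_seq :: "nat set \<Rightarrow> (nat \<Rightarrow> real) \<Rightarrow> ell2"
  where "embed_seq I x = (if (\<lambda>i. (x i)\<^sup>2) summable_on I
    then Abs_ell2 (\<lambda>i. if i \<in> I then x i else 0) else 0)"

lemma summable_on_nat_nonneg_iff:
  fixes f :: "nat \<Rightarrow> real"
  assumes "\<And>i. 0 \<le> f i"
  shows "f summable_on I \<longleftrightarrow> summable (\<lambda>i. if i \<in> I then f i else 0)"
proof -
  have "f summable_on I \<longleftrightarrow> (\<lambda>i. if i \<in> I then f i else 0) summable_on UNIV"
    by (rule summable_on_cong_neutral) auto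
  also have "\<dots> \<longleftrightarrow> summable (\<lambda>i. if i \<in> I then f i else 0)"
    using assms by (auto intro: summable_on_imp_summable summable_nonneg_imp_summable_on)
  finally show ?thesis .
qed

lemma coord_embed_seq:
  assumes "(\<lambda>i. (x i)\<^sup>2) summable_on I"
  shows "coord (embed_seq I x) i = (if i \<in> I then x i else 0)"
proof -
  have "(\<lambda>i. if i \<in> I then (x i)\<^sup>2 else 0) = (\<lambda>i. (if i \<in> I then x i else 0)\<^sup>2)" by auto
  then have "summable (\<lambda>i. (if i \<in> I then x i else 0)\<^sup>2)"
    using assms by (simp add: summable_on_nat_nonneg_iff)
  then show ?thesis using assms by (simp add: embed_seq_def Abs_ell2_inverse)
qed

lemma embed_seq_in: "embed_seq I x \<in> coord_space I"
proof (cases "(\<lambda>i. (x i)\<^sup>2) summable_on I")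
  case True
  then show ?thesis by (simp add: coord_space_iff coord_embed_seq)
next
  case False
  then show ?thesis by (simp add: coord_space_iff embed_seq_def)
qed

lemma sets_square_summable:
  "{x \<in> space (\<Pi>\<^sub>M i\<in>I. gauss_factor a i). (\<lambda>i. (x i)\<^sup>2) summable_on I}
    \<in> sets (\<Pi>\<^sub>M i\<in>I. gauss_factor a i)" (is "_ \<in> sets ?M")
proof -
  have comp: "(\<lambda>x. if i \<in> I then (x i)\<^sup>2 else 0) \<in> borel_measurable ?M" for i
    by (cases "i \<in> I") auto
  have "{x \<in> space ?M. (\<lambda>i. (x i)\<^sup>2) summable_on I}
      = {x \<in> space ?M. Cauchy (\<lambda>n. \<Sum>i<n. if i \<in> I then (x i)\<^sup>2 else 0)}"
    by (simp add: summable_on_nat_nonneg_iff summable_iff_convergent Cauchy_convergent_iff)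
  also have "\<dots> \<in> sets ?M"
    by (intro sets_Collect_Cauchy borel_measurable_sum comp)
  finally show ?thesis .
qed

lemma measurable_embed_seq:
  "embed_seq I \<in> borel_measurable (\<Pi>\<^sub>M i\<in>I. gauss_factor a i)" (is "_ \<in> borel_measurable ?M")
proof (rule borel_measurable_ell2I)
  fix i
  have "(\<lambda>x. if x \<in> {x \<in> space ?M. (\<lambda>i. (x i)\<^sup>2) summable_on I} then (if i \<in> I then x i else 0) else 0)
      \<in> borel_measurable ?M"
    by (rule measurable_If_set) (use sets_square_summable in \<open>cases "i \<in> I"; auto\<close>)+
  moreover have "coord (embed_seq I x) i =
      (if x \<in> {x \<in> space ?M. (\<lambda>i. (x i)\<^sup>2) summable_on I} then (if i \<in> I then x i else 0) else 0)"
    if "x \<in> space ?M" for x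
    using that by (auto simp: coord_embed_seq) (auto simp: embed_seq_def)
  ultimately show "(\<lambda>x. coord (embed_seq I x) i) \<in> borel_measurable ?M"
    by (subst measurable_cong)
qed

lemma space_gauss_measure: "space (gauss_measure a I) = coord_space I"
  by (simp add: gauss_measure_def space_restrict_space)

lemma sets_gauss_measure: "sets (gauss_measure a I) = sets (restrict_space borel (coord_space I))"
  by (simp add: gauss_measure_def)

text \<open>The indicator accounts for the restriction: off the square-summable sequences
  \<open>embed_seq\<close> is 0, where \<open>h\<close> may well be nonzero.\<close>

lemma nn_integral_gauss_measure:
  assumes [measurable]: "h \<in> borel_measurable borel"
  shows "(\<integral>\<^sup>+y. h y \<partial>gauss_measure a I) = (\<integral>\<^sup>+x. h (embed_seq I x)
    * indicator {x. (\<lambda>i. (x i)\<^sup>2) summable_on I} x \<partial>(\<Pi>\<^sub>M i\<in>I. gauss_factor a i))"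
proof -
  let ?M = "\<Pi>\<^sub>M i\<in>I. gauss_factor a i" and ?Q = "{x. (\<lambda>i. (x i)\<^sup>2) summable_on I}"
  let ?R = "restrict_space ?M ?Q"
  let ?emb = "\<lambda>x. Abs_ell2 (\<lambda>i. if i \<in> I then x i else 0)"
  have Q: "?Q \<inter> space ?M \<in> sets ?M"
    using sets_square_summable[of I a] by (simp add: Int_def conj_commute)
  have emb: "?emb x = embed_seq I x" if "x \<in> space ?R" for x
    using that by (simp add: embed_seq_def space_restrict_space)
  have "embed_seq I \<in> measurable ?R (restrict_space borel (coord_space I))"
    by (intro measurable_restrict_space2 measurable_restrict_space1 measurable_embed_seq)
      (auto simp: embed_seq_in)
  then have m: "?emb \<in> measurable ?R (restrict_space borel (coord_space I))"
    by (subst measurable_cong[OF emb])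
  have "(\<integral>\<^sup>+y. h y \<partial>gauss_measure a I) = (\<integral>\<^sup>+x. h (?emb x) \<partial>?R)"
    unfolding gauss_measure_def
    by (rule nn_integral_distr[OF m]) (auto intro: measurable_restrict_space1)
  also have "\<dots> = (\<integral>\<^sup>+x. h (embed_seq I x) \<partial>?R)"
    by (intro nn_integral_cong) (simp add: emb)
  also have "\<dots> = (\<integral>\<^sup>+x. h (embed_seq I x) * indicator ?Q x \<partial>?M)"
    by (rule nn_integral_restrict_space[OF Q])
  finally show ?thesis .
qed

text \<open>Fubini's theorem for the product measure, since square-summability is not affected by
  one coordinate. The set \<open>A\<close> may be empty, in which case
  \<open>gauss_measure a A\<close> is the point mass at 0.\<close>

lemma nn_integral_gauss_measure_insert:
  assumes a: "\<And>i. 0 < a i" and j: "j \<notin> A" and h [measurable]: "h \<in> borel_measurable borel"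
  shows "(\<integral>\<^sup>+y. h y \<partial>gauss_measure a (insert j A)) =
    (\<integral>\<^sup>+z. (\<integral>\<^sup>+s. ennreal (normal_density 0 (a j) s) * h (z + s *\<^sub>R basis_vec j) \<partial>lborel)
      \<partial>gauss_measure a A)"
proof -
  let ?M = "\<Pi>\<^sub>M i\<in>A. gauss_factor a i" and ?MI = "\<Pi>\<^sub>M i\<in>insert j A. gauss_factor a i"
  let ?N = "gauss_factor a j"
  let ?Q = "\<lambda>I. {x :: nat \<Rightarrow> real. (\<lambda>i. (x i)\<^sup>2) summable_on I}"
  have prob: "prob_space (gauss_factor a i)" for i
    using a by (intro prob_space_normal_density)
  interpret N: prob_space ?N by (rule prob)
  interpret M: prob_space ?M by (intro prob_space_PiM prob)
  interpret pair_sigma_finite ?N ?M ..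
  have Q_iff: "x(j := s) \<in> ?Q (insert j A) \<longleftrightarrow> x \<in> ?Q A" for x s
  proof -
    have "(\<lambda>i. ((x(j := s)) i)\<^sup>2) summable_on A \<longleftrightarrow> (\<lambda>i. (x i)\<^sup>2) summable_on A"
      using j by (intro summable_on_cong) auto
    moreover have "(\<lambda>i. ((x(j := s)) i)\<^sup>2) summable_on insert j A \<longleftrightarrow> (\<lambda>i. ((x(j := s)) i)\<^sup>2) summable_on A"
      by (rule summable_on_insert_real)
    ultimately show ?thesis by simp
  qed
  have emb: "embed_seq (insert j A) (x(j := s)) = embed_seq A x + s *\<^sub>R basis_vec j"
    if "x \<in> ?Q A" for x s
  proof (rule ell2_eqI)
    fix i
    have "(\<lambda>i. ((x(j := s)) i)\<^sup>2) summable_on insert j A" using that Q_iff[of x s] by simp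
    then show "coord (embed_seq (insert j A) (x(j := s))) i = coord (embed_seq A x + s *\<^sub>R basis_vec j) i"
      using that j by (simp add: coord_embed_seq del: fun_upd_apply) auto
  qed
  have [measurable]: "embed_seq I \<in> borel_measurable (\<Pi>\<^sub>M i\<in>I. gauss_factor a i)" for I
    by (rule measurable_embed_seq)
  have indQ [measurable]: "(\<lambda>x. indicator (?Q I) x :: ennreal) \<in> borel_measurable (\<Pi>\<^sub>M i\<in>I. gauss_factor a i)" for I
    by (rule borel_measurable_indicator') (use sets_square_summable[of I a] in simp)
  have upd: "(\<lambda>(s, x). x(j := s)) \<in> measurable (?N \<Otimes>\<^sub>M ?M) ?MI"
    by measurable
  have hz: "(\<lambda>z. \<integral>\<^sup>+s. ennreal (normal_density 0 (a j) s) * h (z + s *\<^sub>R basis_vec j) \<partial>lborel)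
      \<in> borel_measurable borel"
    by measurable
  have emb_m: "(\<lambda>p. embed_seq A (snd p) + fst p *\<^sub>R basis_vec j) \<in> borel_measurable (?N \<Otimes>\<^sub>M ?M)"
    by measurable
  have "(\<integral>\<^sup>+y. h y \<partial>gauss_measure a (insert j A))
      = (\<integral>\<^sup>+x. h (embed_seq (insert j A) x) * indicator (?Q (insert j A)) x \<partial>?MI)"
    by (rule nn_integral_gauss_measure) fact
  also have "\<dots> = (\<integral>\<^sup>+x. h (embed_seq (insert j A) x) * indicator (?Q (insert j A)) x
      \<partial>distr (?N \<Otimes>\<^sub>M ?M) ?MI (\<lambda>(s, x). x(j := s)))"
    by (subst distr_pair_PiM_eq_PiM) (simp_all add: prob)
  also have "\<dots> = (\<integral>\<^sup>+p. h (embed_seq (insert j A) ((snd p)(j := fst p)))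
      * indicator (?Q (insert j A)) ((snd p)(j := fst p)) \<partial>(?N \<Otimes>\<^sub>M ?M))"
    by (subst nn_integral_distr[OF upd]) (simp_all add: case_prod_beta)
  also have "\<dots> = (\<integral>\<^sup>+p. h (embed_seq A (snd p) + fst p *\<^sub>R basis_vec j) * indicator (?Q A) (snd p) \<partial>(?N \<Otimes>\<^sub>M ?M))"
  proof (intro nn_integral_cong)
    fix p :: "real \<times> (nat \<Rightarrow> real)"
    show "h (embed_seq (insert j A) ((snd p)(j := fst p))) * indicator (?Q (insert j A)) ((snd p)(j := fst p))
        = h (embed_seq A (snd p) + fst p *\<^sub>R basis_vec j) * indicator (?Q A) (snd p)"
      using Q_iff[of "snd p" "fst p"] emb[of "snd p" "fst p"]
      by (cases "snd p \<in> ?Q A") (auto simp: indicator_def)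
  qed
  also have "\<dots> = (\<integral>\<^sup>+x. (\<integral>\<^sup>+s. h (embed_seq A x + s *\<^sub>R basis_vec j) * indicator (?Q A) x \<partial>?N) \<partial>?M)"
    by (subst nn_integral_snd[symmetric])
      (auto intro!: borel_measurable_times_ennreal measurable_compose[OF emb_m h]
        measurable_compose[OF measurable_snd indQ])
  also have "\<dots> = (\<integral>\<^sup>+x. (\<integral>\<^sup>+s. ennreal (normal_density 0 (a j) s) * h (embed_seq A x + s *\<^sub>R basis_vec j) \<partial>lborel)
      * indicator (?Q A) x \<partial>?M)"
    by (intro nn_integral_cong) (simp add: nn_integral_density nn_integral_multc)
  also have "\<dots> = (\<integral>\<^sup>+z. (\<integral>\<^sup>+s. ennreal (normal_density 0 (a j) s) * h (z + s *\<^sub>R basis_vec j) \<partial>lborel)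
      \<partial>gauss_measure a A)"
    by (rule nn_integral_gauss_measure[OF hz, symmetric])
  finally show ?thesis .
qed

text \<open>The substitution rule is applied to the constant 1. It speaks about absolutely
  integrable functions only, but as an equivalence: if one side is not integrable, neither is the
  other, and then both sides are infinite.\<close>

lemma emeasure_image_eq_nn_integral_deriv:
  fixes \<tau> \<tau>' :: "real \<Rightarrow> real"
  assumes T [measurable]: "T \<in> sets borel" and im [measurable]: "\<tau> ` T \<in> sets borel"
    and der: "\<And>s. s \<in> T \<Longrightarrow> (\<tau> has_real_derivative \<tau>' s) (at s)"
    and inj: "inj_on \<tau> T"
    and meas: "(\<lambda>s. if s \<in> T then \<tau>' s else 0) \<in> borel_measurable borel"
  shows "emeasure lborel (\<tau> ` T) = (\<integral>\<^sup>+s. ennreal \<bar>\<tau>' s\<bar> * indicator T s \<partial>lborel)"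
proof -
  have cov: "(\<lambda>x. \<bar>\<tau>' x\<bar>) absolutely_integrable_on T \<and> integral T (\<lambda>x. \<bar>\<tau>' x\<bar>) = b
      \<longleftrightarrow> (\<lambda>_. 1 :: real) absolutely_integrable_on (\<tau> ` T) \<and> integral (\<tau> ` T) (\<lambda>_. 1 :: real) = b" for b
    using has_absolute_integral_change_of_variables_1'[of T \<tau> \<tau>' "\<lambda>_. 1" b] der inj T
    by (simp add: has_field_derivative_at_within)
  have nn: "(\<integral>\<^sup>+s. ennreal (f s) * indicator B s \<partial>lborel) = ennreal (integral B f)"
    if "f absolutely_integrable_on B" "\<And>s. 0 \<le> f s" for f :: "real \<Rightarrow> real" and B
    using that
    by (intro nn_integral_has_integral_lebesgue' integrable_integral)
      (auto simp: set_lebesgue_integral_eq_integral)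
  have ai: "f absolutely_integrable_on B"
    if "(\<integral>\<^sup>+s. ennreal (f s) * indicator B s \<partial>lborel) \<noteq> \<infinity>" "\<And>s. 0 \<le> f s"
      "(\<lambda>s. if s \<in> B then f s else 0) \<in> borel_measurable borel" for f :: "real \<Rightarrow> real" and B
  proof -
    have eq: "(\<lambda>s. indicator B s *\<^sub>R f s) = (\<lambda>s. if s \<in> B then f s else 0)"
      by (auto simp: indicator_def)
    have "(\<integral>\<^sup>+s. ennreal (norm (if s \<in> B then f s else 0)) \<partial>lborel)
        = (\<integral>\<^sup>+s. ennreal (f s) * indicator B s \<partial>lborel)"
      using that(2) by (intro nn_integral_cong) (auto simp: indicator_def)
    then have "integrable lborel (\<lambda>s. if s \<in> B then f s else 0)"
      using that(1,3) by (simp add: integrable_iff_bounded less_top)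
    then show ?thesis
      unfolding set_integrable_def eq using that(3) by (simp add: integrable_completion)
  qed
  have meas': "(\<lambda>s. if s \<in> T then \<bar>\<tau>' s\<bar> else 0) \<in> borel_measurable borel"
    using borel_measurable_abs[OF meas] by (simp add: if_distrib[of abs] cong: if_cong)
  have em: "emeasure lborel (\<tau> ` T) = (\<integral>\<^sup>+s. ennreal 1 * indicator (\<tau> ` T) s \<partial>lborel)"
    by simp
  show ?thesis
  proof (cases "(\<lambda>x. \<bar>\<tau>' x\<bar>) absolutely_integrable_on T")
    case True
    then have "(\<lambda>_. 1 :: real) absolutely_integrable_on (\<tau> ` T)"
      "integral (\<tau> ` T) (\<lambda>_. 1 :: real) = integral T (\<lambda>x. \<bar>\<tau>' x\<bar>)"
      using cov by blast+
    then show ?thesis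
      unfolding em using nn[OF True] nn[where f = "\<lambda>_. 1" and B = "\<tau> ` T"] by simp
  next
    case False
    then have "\<not> (\<lambda>_. 1 :: real) absolutely_integrable_on (\<tau> ` T)"
      using cov by blast
    then have "(\<integral>\<^sup>+s. ennreal 1 * indicator (\<tau> ` T) s \<partial>lborel) = \<infinity>"
      using ai[where f = "\<lambda>_. 1" and B = "\<tau> ` T"] by fastforce
    moreover have "(\<integral>\<^sup>+s. ennreal \<bar>\<tau>' s\<bar> * indicator T s \<partial>lborel) = \<infinity>"
      using ai[where f = "\<lambda>x. \<bar>\<tau>' x\<bar>" and B = T] False meas' by fastforce
    ultimately show ?thesis unfolding em by simp
  qed
qed

text \<open>The preceding formula on the preimages of Borel sets says that two measures are equal;
  integrating \<open>H\<close> against them gives the general case.\<close>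

lemma nn_integral_change_of_variables_inj:
  fixes \<tau> \<tau>' :: "real \<Rightarrow> real"
  assumes G [measurable]: "G \<in> sets borel" and im [measurable]: "\<tau> ` G \<in> sets borel"
    and der: "\<And>s. s \<in> G \<Longrightarrow> (\<tau> has_real_derivative \<tau>' s) (at s)"
    and inj: "inj_on \<tau> G"
    and meas: "(\<lambda>s. if s \<in> G then \<tau> s else 0) \<in> borel_measurable borel"
      "(\<lambda>s. if s \<in> G then \<tau>' s else 0) \<in> borel_measurable borel"
    and H [measurable]: "H \<in> borel_measurable borel"
  shows "(\<integral>\<^sup>+s. ennreal \<bar>\<tau>' s\<bar> * H (\<tau> s) * indicator G s \<partial>lborel)
    = (\<integral>\<^sup>+t. H t * indicator (\<tau> ` G) t \<partial>lborel)"
proof -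
  \<comment> \<open>Outside \<open>G\<close> the extended map takes the value 0, but the weight
    \<open>?w\<close> vanishes there, so no mass is sent to the point 0.\<close>
  let ?\<tau> = "\<lambda>s. if s \<in> G then \<tau> s else 0"
  let ?w = "\<lambda>s. ennreal \<bar>if s \<in> G then \<tau>' s else 0\<bar>"
  note [measurable] = meas
  have w: "?w \<in> borel_measurable lborel" by measurable
  have "density lborel (indicator (\<tau> ` G)) = distr (density lborel ?w) borel ?\<tau>"
  proof (rule measure_eqI)
    fix B :: "real set" assume "B \<in> sets (density lborel (indicator (\<tau> ` G)))"
    then have B [measurable]: "B \<in> sets borel" by simp
    let ?T = "{s \<in> space borel. s \<in> G \<and> ?\<tau> s \<in> B}"
    have T: "?T \<in> sets borel" by measurable
    have imT: "\<tau> ` ?T = \<tau> ` G \<inter> B" by auto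
    have imTm: "\<tau> ` ?T \<in> sets borel" unfolding imT using im B by (rule sets.Int)
    have "(\<lambda>s. if s \<in> ?T then \<tau>' s else 0) = (\<lambda>s. if s \<in> ?T then (if s \<in> G then \<tau>' s else 0) else 0)"
      by auto
    also have "\<dots> \<in> borel_measurable borel" using T by measurable
    finally have mT: "(\<lambda>s. if s \<in> ?T then \<tau>' s else 0) \<in> borel_measurable borel" .
    have "emeasure (density lborel (indicator (\<tau> ` G))) B = emeasure lborel (\<tau> ` G \<inter> B)"
      by (simp add: emeasure_density flip: indicator_inter_arith)
    also have "\<tau> ` G \<inter> B = \<tau> ` ?T" by (rule imT[symmetric])
    also have "emeasure lborel (\<tau> ` ?T) = (\<integral>\<^sup>+s. ennreal \<bar>\<tau>' s\<bar> * indicator ?T s \<partial>lborel)"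
      by (rule emeasure_image_eq_nn_integral_deriv[OF T imTm _ _ mT])
        (use der inj in \<open>auto intro: inj_on_subset\<close>)
    also have "\<dots> = (\<integral>\<^sup>+s. ?w s * indicator (?\<tau> -` B \<inter> space lborel) s \<partial>lborel)"
      by (intro nn_integral_cong) (auto simp: indicator_def)
    also have "\<dots> = emeasure (density lborel ?w) (?\<tau> -` B \<inter> space lborel)"
      using measurable_sets[OF meas(1) B] by (intro emeasure_density[OF w, symmetric]) simp
    also have "\<dots> = emeasure (distr (density lborel ?w) borel ?\<tau>) B"
      using B by (subst emeasure_distr) simp_all
    finally show "emeasure (density lborel (indicator (\<tau> ` G))) B
        = emeasure (distr (density lborel ?w) borel ?\<tau>) B" .
  qed simp
  then have "(\<integral>\<^sup>+t. H t \<partial>density lborel (indicator (\<tau> ` G)))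
      = (\<integral>\<^sup>+t. H t \<partial>distr (density lborel ?w) borel ?\<tau>)"
    by simp
  also have "\<dots> = (\<integral>\<^sup>+s. ?w s * H (?\<tau> s) \<partial>lborel)"
    by (simp add: nn_integral_distr nn_integral_density)
  also have "\<dots> = (\<integral>\<^sup>+s. ennreal \<bar>\<tau>' s\<bar> * H (\<tau> s) * indicator G s \<partial>lborel)"
    by (intro nn_integral_cong) (auto simp: indicator_def)
  finally show ?thesis
    by (simp add: nn_integral_density mult.commute)
qed

section \<open>The surface measure of a chart\<close>

text \<open>\<open>F_dens a (- I)\<close> reads only coordinates outside \<open>I\<close>, so it may
  be evaluated at the surface point in place of the graph function.\<close>

definition chart_density :: "(nat \<Rightarrow> real) \<Rightarrow> nat set \<Rightarrow> (ell2 \<Rightarrow> ell2 \<Rightarrow> ell2) \<Rightarrow> ell2 \<Rightarrow> ennreal"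
  where "chart_density a I L x = chart_normal I L x * ennreal (F_dens a (- I) x)"

definition chart_measure ::
  "(nat \<Rightarrow> real) \<Rightarrow> nat set \<Rightarrow> ell2 set \<Rightarrow> (ell2 \<Rightarrow> ell2 \<Rightarrow> ell2) \<Rightarrow> ell2 set \<Rightarrow> ennreal"
  where "chart_measure a I S L E =
    (\<integral>\<^sup>+y. (if y \<in> coord_proj I ` E then chart_density a I L (chart_point I S y) else 0)
      \<partial>gauss_measure a I)"

lemma local_surface_measure_eq:
  assumes "chart I (S \<inter> U) L" and E: "E \<subseteq> S \<inter> U"
  shows "local_surface_measure a S U I E = chart_measure a I (S \<inter> U) L E"
  unfolding local_surface_measure_def chart_measure_def
proof (intro nn_integral_cong)
  interpret chart I "S \<inter> U" L by fact
  fix y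
  show "surface_density a S U I y * indicator (coord_proj I ` E) y
    = (if y \<in> coord_proj I ` E then chart_density a I L (g y) else 0)"
  proof (cases "y \<in> coord_proj I ` E")
    case True
    then obtain x where x: "x \<in> E" "y = coord_proj I x" by blast
    then have xS: "x \<in> S \<inter> U" using E by blast
    then have gx: "g y = x" by (simp add: x(2))
    have "F_dens a (- I) (x - y) = F_dens a (- I) x"
      unfolding F_dens_def
      by (intro arg_cong[of _ _ exp] infsum_cong) (simp add: x(2) coord_coord_proj)
    then have "surface_density a S U I y = chart_density a I L x"
      using normal_factor_eq[OF assms(1) xS]
      by (simp add: surface_density_def graph_fun_eq gx chart_density_def)
    then show ?thesis using True gx by simp
  qed simp
qed

lemma restrict_space_open_subset:
  assumes "E \<in> sets (restrict_space borel (A \<inter> B))" "open B"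
  shows "E \<in> sets (restrict_space borel A)"
proof -
  obtain T where T: "T \<in> sets borel" "E = (A \<inter> B) \<inter> T"
    using assms(1) by (auto simp: sets_restrict_space)
  then have "E = A \<inter> (B \<inter> T)" by auto
  moreover have "B \<inter> T \<in> sets borel" using T(1) assms(2) by auto
  ultimately show ?thesis by (auto simp: sets_restrict_space)
qed

context chart
begin

lemma sets_V: "V \<in> sets borel"
proof -
  obtain T where "open T" "V = coord_space I \<inter> T"
    using open_image by (auto simp: openin_open)
  then show ?thesis using closed_coord_space by auto
qed

lemma measurable_chart_point: "g \<in> measurable (restrict_space borel V) (restrict_space borel S)"
  by (intro measurable_restrict_space2 borel_measurable_continuous_on_restrict continuous_on_chart_point)
    (use chart_point_in in \<open>auto simp: space_restrict_space\<close>)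

text \<open>The image is a preimage under the continuous inverse \<open>g\<close>, whose domain
  \<open>V\<close> is Borel.\<close>

lemma sets_proj_image:
  assumes "E \<in> sets (restrict_space borel S)"
  shows "coord_proj I ` E \<in> sets borel"
proof -
  have "E \<subseteq> S" using sets.sets_into_space[OF assms] by (simp add: space_restrict_space)
  then have "coord_proj I ` E = g -` E \<inter> space (restrict_space borel V)"
    by (auto simp: space_restrict_space)
  also have "\<dots> \<in> sets (restrict_space borel V)"
    using measurable_chart_point assms by (rule measurable_sets)
  finally show ?thesis
    using sets_V by (simp add: sets_restrict_space_iff)
qed

lemma measurable_chart_pullback:
  assumes \<phi>: "\<phi> \<in> borel_measurable (restrict_space borel S)"
    and E: "E \<in> sets (restrict_space borel S)"
  shows "(\<lambda>y. if y \<in> coord_proj I ` E then \<phi> (g y) else 0) \<in> borel_measurable borel"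
proof -
  have "E \<subseteq> S" using sets.sets_into_space[OF E] by (simp add: space_restrict_space)
  have "(\<lambda>y. \<phi> (g y)) \<in> borel_measurable (restrict_space borel V)"
    by (rule measurable_compose[OF measurable_chart_point \<phi>])
  then have "(\<lambda>y. \<phi> (g y)) \<in> borel_measurable (restrict_space borel (coord_proj I ` E))"
    by (rule measurable_restrict_mono) (use \<open>E \<subseteq> S\<close> in auto)
  then show ?thesis
    by (subst measurable_restrict_space_iff[symmetric]) (use sets_proj_image[OF E] in auto)
qed

lemma borel_measurable_chart_density:
  assumes "\<And>x. x \<in> S \<Longrightarrow> log_density a x summable_on - I"
  shows "chart_density a I L \<in> borel_measurable (restrict_space borel S)"
  unfolding chart_density_def[abs_def]
  by (intro borel_measurable_times_ennreal borel_measurable_chart_normal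
      measurable_compose[OF borel_measurable_F_dens measurable_ennreal] assms)

text \<open>The projection is injective on \<open>S\<close>, so disjoint sets have disjoint
  projections and the integrands add up.\<close>

lemma chart_measure_UN:
  assumes cond: "\<And>x. x \<in> S \<Longrightarrow> log_density a x summable_on - I"
    and E: "\<And>n::nat. E n \<in> sets (restrict_space borel S)" and disj: "disjoint_family E"
  shows "chart_measure a I S L (\<Union>n. E n) = (\<Sum>n. chart_measure a I S L (E n))"
proof -
  let ?h = "\<lambda>F y. if y \<in> coord_proj I ` F then chart_density a I L (g y) else 0"
  have ES: "E n \<subseteq> S" for n
    using sets.sets_into_space[OF E] by (simp add: space_restrict_space)
  have meas: "?h (E n) \<in> borel_measurable (gauss_measure a I)" for n
    using measurable_restrict_space1[OF measurable_chart_pullback[OF borel_measurable_chart_density[OF cond] E]]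
    by (simp cong: measurable_cong_sets add: sets_gauss_measure)
  have "?h (\<Union>n. E n) y = (\<Sum>n. ?h (E n) y)" for y
  proof (cases "\<exists>m. y \<in> coord_proj I ` E m")
    case True
    then obtain m where m: "y \<in> coord_proj I ` E m" by blast
    have "y \<notin> coord_proj I ` E n" if "n \<noteq> m" for n
    proof
      assume "y \<in> coord_proj I ` E n"
      then obtain x x' where "x \<in> E n" "x' \<in> E m" "coord_proj I x = coord_proj I x'"
        using m by auto
      then have "x = x'" using ES inj_on_proj by (meson inj_onD subsetD)
      then show False
        using \<open>x \<in> E n\<close> \<open>x' \<in> E m\<close> disj that by (auto simp: disjoint_family_on_def)
    qed
    then have "(\<Sum>n. ?h (E n) y) = (\<Sum>n\<in>{m}. ?h (E n) y)"
      by (intro suminf_finite) auto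
    then show ?thesis using m by auto
  next
    case False
    then show ?thesis by auto
  qed
  then have "chart_measure a I S L (\<Union>n. E n) = (\<integral>\<^sup>+y. (\<Sum>n. ?h (E n) y) \<partial>gauss_measure a I)"
    by (simp only: chart_measure_def)
  also have "\<dots> = (\<Sum>n. chart_measure a I S L (E n))"
    unfolding chart_measure_def by (rule nn_integral_suminf) (rule meas)
  finally show ?thesis .
qed

lemma chart_measure_empty [simp]: "chart_measure a I S L {} = 0"
  by (simp add: chart_measure_def)

end

lemma chart_measure_cong:
  assumes "chart I S L" "chart I S' L'" "E \<subseteq> S" "E \<subseteq> S'"
    and "\<And>x. x \<in> E \<Longrightarrow> chart_normal I L x = chart_normal I L' x"
  shows "chart_measure a I S L E = chart_measure a I S' L' E"
  unfolding chart_measure_def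
proof (intro nn_integral_cong)
  interpret A: chart I S L by fact
  interpret B: chart I S' L' by fact
  fix y
  show "(if y \<in> coord_proj I ` E then chart_density a I L (A.g y) else 0)
    = (if y \<in> coord_proj I ` E then chart_density a I L' (B.g y) else 0)"
  proof (cases "y \<in> coord_proj I ` E")
    case True
    then obtain x where x: "x \<in> E" "y = coord_proj I x" by blast
    then have "A.g y = x" "B.g y = x" using assms(3,4) by auto
    then show ?thesis using assms(5)[OF x(1)] by (simp add: chart_density_def)
  qed simp
qed

lemma coord_proj_insert_iff:
  assumes "z \<in> coord_space A" "j \<notin> A"
  shows "coord_proj (insert j A) x = z + s *\<^sub>R basis_vec j \<longleftrightarrow> coord_proj A x = z \<and> coord x j = s"
proof -
  have ins: "coord_proj (insert j A) x = coord_proj A x + coord x j *\<^sub>R basis_vec j"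
    using assms(2) by (intro ell2_eqI) (auto simp: coord_coord_proj)
  show ?thesis
  proof
    assume eq: "coord_proj (insert j A) x = z + s *\<^sub>R basis_vec j"
    have "coord z j = 0" using assms by (simp add: coord_space_iff)
    then have "coord x j = s"
      using arg_cong[OF eq, of "\<lambda>v. coord v j"] by (simp add: coord_coord_proj)
    with eq show "coord_proj A x = z \<and> coord x j = s" by (simp add: ins)
  qed (simp add: ins)
qed

text \<open>Splitting off coordinate \<open>j\<close> on one side and \<open>i\<close> on the other
  leaves two integrals over the same space, that of \<open>A = I - {j}\<close>, which are compared
  for each \<open>z\<close>. The points of \<open>E\<close> over \<open>z\<close> are the same in
  both charts, parametrised once by coordinate \<open>j\<close> and once by coordinate
  \<open>i\<close>.\<close>

lemma chart_measure_exchange: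
  assumes "chart I S L" "chart (insert i (I - {j})) (S \<inter> U) (pivot L j i)" and U: "open U"
    and ji: "j \<in> I" "i \<notin> I" and c: "\<And>x. x \<in> S \<inter> U \<Longrightarrow> coord (L x (basis_vec j)) i \<noteq> 0"
    and a: "\<And>i. 0 < a i" and cond: "\<And>x. x \<in> S \<Longrightarrow> log_density a x summable_on - I"
    and E: "E \<in> sets (restrict_space borel (S \<inter> U))"
  shows "chart_measure a I S L E
    = chart_measure a (insert i (I - {j})) (S \<inter> U) (pivot L j i) E"
proof -
  define A where "A = I - {j}"
  have IA: "I = insert j A" "j \<notin> A" "i \<notin> A" using ji by (auto simp: A_def)
  let ?L = "pivot L j i" and ?I = "insert i A"
  interpret A: chart I S L by fact
  interpret B: chart ?I "S \<inter> U" ?L unfolding A_def by fact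
  have ES: "E \<subseteq> S \<inter> U" using sets.sets_into_space[OF E] by (simp add: space_restrict_space)
  have E': "E \<in> sets (restrict_space borel S)"
    using E U by (rule restrict_space_open_subset)
  have cond_ins: "log_density a x summable_on insert j (- I)" if "x \<in> S" for x
    using cond[OF that] by (simp only: summable_on_insert_real)
  have cond': "log_density a x summable_on - ?I" if "x \<in> S" for x
    using cond_ins[OF that] by (rule summable_on_subset_banach) (auto simp: IA)
  let ?hA = "\<lambda>y. if y \<in> coord_proj I ` E then chart_density a I L (A.g y) else 0"
  let ?hB = "\<lambda>y. if y \<in> coord_proj ?I ` E then chart_density a ?I ?L (B.g y) else 0"
  have hA: "?hA \<in> borel_measurable borel"
    by (intro A.measurable_chart_pullback A.borel_measurable_chart_density cond E')
  have hB [measurable]: "?hB \<in> borel_measurable borel"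
    by (intro B.measurable_chart_pullback B.borel_measurable_chart_density cond' E) auto
  have slice: "(\<integral>\<^sup>+s. ennreal (normal_density 0 (a j) s) * ?hA (z + s *\<^sub>R basis_vec j) \<partial>lborel)
      = (\<integral>\<^sup>+t. ennreal (normal_density 0 (a i) t) * ?hB (z + t *\<^sub>R basis_vec i) \<partial>lborel)"
    if z: "z \<in> coord_space A" for z
  proof -
    let ?p = "\<lambda>s. z + s *\<^sub>R basis_vec j"
    let ?q = "\<lambda>t. z + t *\<^sub>R basis_vec i"
    have p [measurable]: "?p \<in> borel_measurable borel" by measurable
    have q [measurable]: "?q \<in> borel_measurable borel" by measurable
    \<comment> \<open>\<open>G\<close> holds the values of coordinate \<open>j\<close> at the points
      of \<open>E\<close> over \<open>z\<close>, and \<open>\<tau>\<close> sends such a value to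
      coordinate \<open>i\<close> of the same point. Its derivative \<open>\<tau>'\<close> is the
      pivot entry.\<close>
    define G where "G = {s. ?p s \<in> coord_proj I ` E}"
    define \<tau> where "\<tau> s = coord (A.g (?p s)) i" for s
    define \<tau>' where "\<tau>' s = coord (L (A.g (?p s)) (basis_vec j)) i" for s
    define H where "H t = ennreal (normal_density 0 (a i) t) * ?hB (?q t)" for t
    have iff: "coord_proj I x = ?p s \<longleftrightarrow> coord_proj A x = z \<and> coord x j = s"
      "coord_proj ?I x = ?q s \<longleftrightarrow> coord_proj A x = z \<and> coord x i = s" for x s
      unfolding IA(1) by (intro coord_proj_insert_iff z IA)+
    have G: "A.g (?p s) \<in> E" "coord_proj A (A.g (?p s)) = z" "coord (A.g (?p s)) j = s"
      if "s \<in> G" for s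
    proof -
      have "?p s \<in> coord_proj I ` E" using that by (simp add: G_def)
      then obtain x where x: "x \<in> E" "coord_proj I x = ?p s" by (metis imageE)
      then have "A.g (?p s) = x" using ES by (metis A.chart_point_proj IntD1 subsetD)
      then show "A.g (?p s) \<in> E" "coord_proj A (A.g (?p s)) = z" "coord (A.g (?p s)) j = s"
        using x iff(1) by auto
    qed
    have q\<tau>: "coord_proj ?I (A.g (?p s)) = ?q (\<tau> s)" if "s \<in> G" for s
      using G[OF that] by (simp add: iff(2) \<tau>_def)
    have gB: "B.g (?q (\<tau> s)) = A.g (?p s)" if "s \<in> G" for s
      using q\<tau>[OF that] B.chart_point_proj[of "A.g (?p s)"] G(1)[OF that] ES by auto
    have im: "\<tau> ` G = {t. ?q t \<in> coord_proj ?I ` E}"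
    proof (intro equalityI subsetI)
      fix t assume "t \<in> \<tau> ` G"
      then obtain s where s: "s \<in> G" "t = \<tau> s" by blast
      then have "?q t = coord_proj ?I (A.g (?p s))" using q\<tau> by simp
      then show "t \<in> {t. ?q t \<in> coord_proj ?I ` E}" using G(1)[OF s(1)] by blast
    next
      fix t assume "t \<in> {t. ?q t \<in> coord_proj ?I ` E}"
      then obtain x where x: "x \<in> E" "coord_proj ?I x = ?q t" by force
      then have px: "coord_proj I x = ?p (coord x j)" using iff by blast
      then have "A.g (?p (coord x j)) = x" using x ES by (metis A.chart_point_proj IntD1 subsetD)
      moreover have "coord x j \<in> G" using px x(1) unfolding G_def by (metis imageI mem_Collect_eq)
      moreover have "coord x i = t" using x(2) iff(2) by blast
      ultimately show "t \<in> \<tau> ` G" by (auto simp: \<tau>_def intro!: image_eqI[of _ _ "coord x j"])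
    qed
    have "?p -` (coord_proj I ` E) \<inter> space borel \<in> sets borel"
      using p A.sets_proj_image[OF E'] by (rule measurable_sets)
    then have G_sets: "G \<in> sets borel" by (simp add: G_def vimage_def)
    have "?q -` (coord_proj ?I ` E) \<inter> space borel \<in> sets borel"
      using q B.sets_proj_image[OF E] by (rule measurable_sets)
    then have im_sets: "\<tau> ` G \<in> sets borel" by (simp add: im vimage_def)
    have der: "(\<tau> has_real_derivative \<tau>' s) (at s)" if "s \<in> G" for s
      unfolding \<tau>_def \<tau>'_def
      by (rule A.slice_has_real_derivative) (use that ES ji in \<open>auto simp: G_def\<close>)
    have inj: "inj_on \<tau> G"
    proof (rule inj_onI)
      fix s s' assume s: "s \<in> G" "s' \<in> G" "\<tau> s = \<tau> s'"
      then have "A.g (?p s) = A.g (?p s')" using gB by metis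
      then show "s = s'" using G(3) s by metis
    qed
    have "(\<lambda>x. coord x i) \<in> borel_measurable (restrict_space borel S)"
      by (intro borel_measurable_continuous_on_restrict continuous_intros)
    from measurable_compose[OF p A.measurable_chart_pullback[OF this E']]
    have m1: "(\<lambda>s. if s \<in> G then \<tau> s else 0) \<in> borel_measurable borel"
      by (simp add: G_def \<tau>_def cong: if_cong)
    have "(\<lambda>x. coord (L x (basis_vec j)) i) \<in> borel_measurable (restrict_space borel S)"
      by (intro borel_measurable_continuous_on_restrict A.continuous_on_L)
    from measurable_compose[OF p A.measurable_chart_pullback[OF this E']]
    have m2: "(\<lambda>s. if s \<in> G then \<tau>' s else 0) \<in> borel_measurable borel"
      by (simp add: G_def \<tau>'_def cong: if_cong)
    have H_meas: "H \<in> borel_measurable borel"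
      unfolding H_def[abs_def]
      by (intro borel_measurable_times_ennreal measurable_compose[OF q hB]) measurable
    have eq: "ennreal (normal_density 0 (a j) s) * ?hA (?p s)
        = ennreal \<bar>\<tau>' s\<bar> * H (\<tau> s) * indicator G s" for s
    proof (cases "s \<in> G")
      case True
      let ?x = "A.g (?p s)"
      have x: "?x \<in> E" "?x \<in> S" "?x \<in> S \<inter> U" using G(1)[OF True] ES by auto
      \<comment> \<open>In both charts the one-dimensional density supplies the index by which the
        complement of the index set falls short of \<open>- A\<close>, so the two weights
        coincide.\<close>
      have Fj: "normal_density 0 (a j) s * F_dens a (- I) ?x = F_dens a (- A) ?x"
        using F_dens_insert[OF a _ cond[OF x(2)], of j] G(3)[OF True] ji
        by (simp add: IA Compl_insert insert_absorb)
      have Fi: "normal_density 0 (a i) (\<tau> s) * F_dens a (- ?I) ?x = F_dens a (- A) ?x"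
        using F_dens_insert[OF a _ cond'[OF x(2)], of i] IA
        by (simp add: \<tau>_def Compl_insert insert_absorb)
      have nrm: "chart_normal I L ?x = ennreal \<bar>\<tau>' s\<bar> * chart_normal ?I ?L ?x"
        using A.chart_normal_pivot[OF x(2) ji c[OF x(3)]] by (simp add: \<tau>'_def A_def)
      have hB_x: "?hB (?q (\<tau> s)) = chart_density a ?I ?L ?x"
        using q\<tau>[OF True] x(1) gB[OF True] by (auto simp: image_iff)
      have "?p s \<in> coord_proj I ` E" using True by (simp only: G_def mem_Collect_eq)
      then have hA_x: "?hA (?p s) = chart_density a I L ?x" by (rule if_P)
      have "ennreal (normal_density 0 (a j) s) * ?hA (?p s)
          = chart_normal I L ?x * ennreal (normal_density 0 (a j) s * F_dens a (- I) ?x)"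
        unfolding hA_x unfolding chart_density_def
        by (simp add: ennreal_mult F_dens_nonneg mult_ac)
      also have "\<dots> = ennreal \<bar>\<tau>' s\<bar> * (chart_normal ?I ?L ?x
          * ennreal (normal_density 0 (a i) (\<tau> s) * F_dens a (- ?I) ?x))"
        unfolding Fi Fj nrm by (simp add: mult_ac)
      also have "\<dots> = ennreal \<bar>\<tau>' s\<bar> * H (\<tau> s)"
        unfolding H_def hB_x unfolding chart_density_def
        by (simp add: ennreal_mult F_dens_nonneg mult_ac)
      finally show ?thesis using True by simp
    next
      case False
      then show ?thesis by (simp add: G_def)
    qed
    have "(\<integral>\<^sup>+s. ennreal (normal_density 0 (a j) s) * ?hA (?p s) \<partial>lborel)
        = (\<integral>\<^sup>+s. ennreal \<bar>\<tau>' s\<bar> * H (\<tau> s) * indicator G s \<partial>lborel)"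
      by (intro nn_integral_cong eq)
    also have "\<dots> = (\<integral>\<^sup>+t. H t * indicator (\<tau> ` G) t \<partial>lborel)"
      by (rule nn_integral_change_of_variables_inj[OF G_sets im_sets der inj m1 m2 H_meas])
    \<comment> \<open>\<open>?hB\<close> vanishes off the projection of \<open>E\<close>, and
      \<open>\<tau>\<close> maps \<open>G\<close> onto the part of that projection on the
      line.\<close>
    also have "\<dots> = (\<integral>\<^sup>+t. H t \<partial>lborel)"
      by (intro nn_integral_cong) (auto simp: im H_def indicator_def)
    finally show ?thesis by (simp only: H_def)
  qed
  have "chart_measure a I S L E = (\<integral>\<^sup>+y. ?hA y \<partial>gauss_measure a (insert j A))"
    by (simp only: chart_measure_def IA(1)[symmetric])
  also have "\<dots> = (\<integral>\<^sup>+z. (\<integral>\<^sup>+s. ennreal (normal_density 0 (a j) s) * ?hA (z + s *\<^sub>R basis_vec j) \<partial>lborel)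
      \<partial>gauss_measure a A)"
    by (rule nn_integral_gauss_measure_insert[OF a IA(2) hA])
  also have "\<dots> = (\<integral>\<^sup>+z. (\<integral>\<^sup>+t. ennreal (normal_density 0 (a i) t) * ?hB (z + t *\<^sub>R basis_vec i) \<partial>lborel)
      \<partial>gauss_measure a A)"
    by (intro nn_integral_cong slice) (simp add: space_gauss_measure)
  also have "\<dots> = (\<integral>\<^sup>+y. ?hB y \<partial>gauss_measure a ?I)"
    by (rule nn_integral_gauss_measure_insert[OF a IA(3) hB, symmetric])
  also have "\<dots> = chart_measure a ?I (S \<inter> U) ?L E"
    by (simp only: chart_measure_def)
  finally show ?thesis by (simp only: A_def)
qed

section \<open>Agreement on overlaps and gluing\<close>

text \<open>\<open>L2 x\<close> fixes the tangent vector \<open>L1 x (basis_vec k)\<close> and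
  depends only on its projection, which is \<open>basis_vec k\<close>. For \<open>k\<close> in
  \<open>I\<close> the two matrices therefore have the same columns.\<close>

lemma chart_normal_unique:
  assumes "chart I S1 L1" "chart I S2 L2" and x: "x \<in> S1" "x \<in> S2"
    and O': "open O'" "x \<in> O'" "S1 \<inter> O' \<subseteq> S2"
  shows "chart_normal I L1 x = chart_normal I L2 x"
proof -
  interpret A: chart I S1 L1 by fact
  interpret B: chart I S2 L2 by fact
  have "L1 x (basis_vec k) = L2 x (basis_vec k)" if "k \<in> I" for k
  proof -
    have "L1 x (basis_vec k) = L2 x (L1 x (basis_vec k))"
      by (rule tangent_agree[OF assms(1,2) x that O', symmetric])
    also have "\<dots> = L2 x (coord_proj I (L1 x (basis_vec k)))"
      by (simp add: B.L_proj x)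
    also have "\<dots> = L2 x (basis_vec k)"
      using x by (simp add: A.proj_L B.L_proj)
    finally show ?thesis .
  qed
  then show ?thesis
    unfolding chart_normal_def by (intro arg_cong[of _ _ esqrt] minor_sq_sum_cong) simp
qed

text \<open>The second chart is kept and the first one is moved towards it. Each exchange is
  available only near \<open>x0\<close>, so \<open>W\<close> depends on that point and shrinks from
  step to step.\<close>

lemma chart_measure_local_eq:
  assumes "chart I1 (S \<inter> U1) L1" "chart I2 (S \<inter> U2) L2" "I2 \<in> exch I1"
    and "open U1" "open U2" "x0 \<in> S \<inter> U1 \<inter> U2" and a: "\<And>i. 0 < a i"
    and "\<And>x. x \<in> S \<inter> U1 \<Longrightarrow> log_density a x summable_on - I1"
  shows "\<exists>W. open W \<and> x0 \<in> W \<and> (\<forall>E\<in>sets (restrict_space borel (S \<inter> U1 \<inter> U2 \<inter> W)).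
    chart_measure a I1 (S \<inter> U1) L1 E = chart_measure a I2 (S \<inter> U2) L2 E)"
  using assms
proof (induction "card (I1 - I2)" arbitrary: I1 U1 L1)
  case 0
  then have "finite (I1 - I2)" "finite (I2 - I1)" "card (I2 - I1) = 0"
    by (auto simp: exch_def)
  with 0 have "I1 - I2 = {}" "I2 - I1 = {}" by auto
  then have I: "I1 = I2" by blast
  have "chart_measure a I1 (S \<inter> U1) L1 E = chart_measure a I2 (S \<inter> U2) L2 E"
    if "E \<in> sets (restrict_space borel (S \<inter> U1 \<inter> U2 \<inter> UNIV))" for E
  proof -
    have E: "E \<subseteq> S \<inter> U1 \<inter> U2"
      using sets.sets_into_space[OF that] by (simp add: space_restrict_space)
    show ?thesis
      unfolding I
    proof (rule chart_measure_cong)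
      show "chart I2 (S \<inter> U1) L1" "chart I2 (S \<inter> U2) L2" using 0 I by auto
      fix x assume "x \<in> E"
      with E show "chart_normal I2 L1 x = chart_normal I2 L2 x"
        by (intro chart_normal_unique[of I2 "S \<inter> U1" L1 "S \<inter> U2" L2 x U2])
          (use 0 I in auto)
    qed (use E in auto)
  qed
  then show ?case by (intro exI[of _ UNIV]) auto
next
  case (Suc n)
  note chart1 = Suc.prems(1) and chart2 = Suc.prems(2) and exch = Suc.prems(3)
  have x0: "x0 \<in> S \<inter> U1" "x0 \<in> S \<inter> U2" "x0 \<in> U2" using Suc.prems(6) by auto
  have "I1 - I2 \<noteq> {}" using Suc.hyps(2) by (metis card.empty nat.distinct(1))
  then obtain j where j: "j \<in> I1" "j \<notin> I2" by blast
  obtain i where i: "i \<in> I2" "i \<notin> I1" "coord (L1 x0 (basis_vec j)) i \<noteq> 0"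
    using ex_pivot[OF chart1 chart2 x0(1,2) \<open>open U2\<close> x0(3) _ j] by blast
  let ?I = "insert i (I1 - {j})" and ?L = "pivot L1 j i"
  obtain U where U: "open U" "x0 \<in> U" "chart ?I (S \<inter> U1 \<inter> U) ?L"
    "\<And>x. x \<in> S \<inter> U1 \<inter> U \<Longrightarrow> coord (L1 x (basis_vec j)) i \<noteq> 0"
    using chart.ex_chart_exchange[OF chart1 j(1) i(2) x0(1) i(3)] by blast
  have chart3: "chart ?I (S \<inter> (U1 \<inter> U)) ?L" using U(3) by (simp add: Int_assoc)
  \<comment> \<open>Because \<open>i\<close> is taken from \<open>I2\<close>, the exchange removes
    \<open>j\<close> from the difference and adds nothing to it.\<close>
  have "?I - I2 = (I1 - I2) - {j}" using i by auto
  then have card: "n = card (?I - I2)"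
    using Suc.hyps(2) j by simp
  have exch': "I2 \<in> exch ?I"
    using exch exch_eq[OF exch_swap[OF j(1) i(2)]] by simp
  have cond: "log_density a x summable_on - ?I" if "x \<in> S \<inter> (U1 \<inter> U)" for x
  proof -
    have "log_density a x summable_on insert j (- I1)"
      using Suc.prems(8)[of x] that by (simp only: summable_on_insert_real) simp
    then show ?thesis by (rule summable_on_subset_banach) auto
  qed
  have "open (U1 \<inter> U)" using U(1) \<open>open U1\<close> by auto
  moreover have "x0 \<in> S \<inter> (U1 \<inter> U) \<inter> U2" using x0 U(2) by auto
  ultimately obtain W where W: "open W" "x0 \<in> W"
    "\<And>E. E \<in> sets (restrict_space borel (S \<inter> (U1 \<inter> U) \<inter> U2 \<inter> W)) \<Longrightarrow>
      chart_measure a ?I (S \<inter> (U1 \<inter> U)) ?L E = chart_measure a I2 (S \<inter> U2) L2 E"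
    using Suc.hyps(1)[OF card chart3 chart2 exch' _ \<open>open U2\<close> _ a cond] by blast
  have "chart_measure a I1 (S \<inter> U1) L1 E = chart_measure a I2 (S \<inter> U2) L2 E"
    if E: "E \<in> sets (restrict_space borel (S \<inter> U1 \<inter> U2 \<inter> (W \<inter> U)))" for E
  proof -
    have "E \<in> sets (restrict_space borel ((S \<inter> U1 \<inter> U) \<inter> (U2 \<inter> W)))"
      using E by (simp add: Int_ac)
    then have E1: "E \<in> sets (restrict_space borel (S \<inter> U1 \<inter> U))"
      by (rule restrict_space_open_subset) (use W(1) \<open>open U2\<close> in auto)
    have "chart_measure a I1 (S \<inter> U1) L1 E = chart_measure a ?I (S \<inter> U1 \<inter> U) ?L E"
      by (rule chart_measure_exchange[OF chart1 U(3) U(1) j(1) i(2) U(4) a Suc.prems(8) E1])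
    also have "\<dots> = chart_measure a ?I (S \<inter> (U1 \<inter> U)) ?L E" by (simp add: Int_assoc)
    also have "\<dots> = chart_measure a I2 (S \<inter> U2) L2 E"
      by (rule W(3)) (use E in \<open>simp add: Int_ac\<close>)
    finally show ?thesis .
  qed
  then show ?case using W U by (intro exI[of _ "W \<inter> U"]) auto
qed

text \<open>Countably many of the neighbourhoods on which the measures agree suffice. Made disjoint,
  they cut \<open>E\<close> into pieces with equal values, and both sides are countably
  additive.\<close>

lemma chart_measure_eq:
  assumes chart1: "chart I1 (S \<inter> U1) L1" and chart2: "chart I2 (S \<inter> U2) L2"
    and exch: "I2 \<in> exch I1" and op: "open U1" "open U2" and a: "\<And>i. 0 < a i"
    and cond1: "\<And>x. x \<in> S \<inter> U1 \<Longrightarrow> log_density a x summable_on - I1"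
    and cond2: "\<And>x. x \<in> S \<inter> U2 \<Longrightarrow> log_density a x summable_on - I2"
    and E: "E \<in> sets (restrict_space borel (S \<inter> U1 \<inter> U2))"
  shows "chart_measure a I1 (S \<inter> U1) L1 E = chart_measure a I2 (S \<inter> U2) L2 E"
proof -
  interpret A: chart I1 "S \<inter> U1" L1 by fact
  interpret B: chart I2 "S \<inter> U2" L2 by fact
  let ?X = "S \<inter> U1 \<inter> U2"
  define good where "good W \<longleftrightarrow> open W \<and> (\<forall>E\<in>sets (restrict_space borel (?X \<inter> W)).
    chart_measure a I1 (S \<inter> U1) L1 E = chart_measure a I2 (S \<inter> U2) L2 E)" for W
  have "\<exists>W. x \<in> W \<and> good W" if "x \<in> ?X" for x
    using chart_measure_local_eq[OF chart1 chart2 exch op that a cond1] unfolding good_def by blast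
  then have cover: "?X \<subseteq> \<Union>(Collect good)" by blast
  obtain \<F> where \<F>: "\<F> \<subseteq> Collect good" "countable \<F>" "\<Union>\<F> = \<Union>(Collect good)"
    by (rule Lindelof[of "Collect good"]) (auto simp: good_def)
  have EX: "E \<subseteq> ?X" using sets.sets_into_space[OF E] by (simp add: space_restrict_space)
  show ?thesis
  \<comment> \<open>Enumerating the family by \<open>from_nat_into\<close> requires it to be
    non-empty; an empty one forces \<open>E\<close> to be empty.\<close>
  proof (cases "\<F> = {}")
    case True
    then have "E = {}" using cover \<F> EX by auto
    then show ?thesis by simp
  next
    case False
    define W where "W = from_nat_into \<F>"
    have W: "good (W n)" for n
      using from_nat_into[OF False, of n] \<F>(1) by (auto simp: W_def)
    have W_sets: "disjointed W n \<in> sets borel" for n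
    proof -
      have "range W \<subseteq> sets borel" using W by (auto simp: good_def)
      then show ?thesis using sets.range_disjointed_sets by blast
    qed
    obtain T where T: "T \<in> sets borel" "E = ?X \<inter> T"
      using E by (auto simp: sets_restrict_space)
    define D where "D n = E \<inter> disjointed W n" for n
    have D: "D n \<in> sets (restrict_space borel (?X \<inter> W n))" for n
    proof -
      have "D n = (?X \<inter> W n) \<inter> (T \<inter> disjointed W n)"
        using T(2) disjointed_subset[of W n] by (auto simp: D_def)
      then show ?thesis using T(1) W_sets by (auto simp: sets_restrict_space)
    qed
    then have D': "D n \<in> sets (restrict_space borel ?X)" for n
      by (rule restrict_space_open_subset) (use W in \<open>auto simp: good_def\<close>)
    have D1: "D n \<in> sets (restrict_space borel (S \<inter> U1))" for n
      using D' op(2) by (rule restrict_space_open_subset)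
    have D2: "D n \<in> sets (restrict_space borel (S \<inter> U2))" for n
    proof -
      have "D n \<in> sets (restrict_space borel (S \<inter> U2 \<inter> U1))"
        using D'[of n] by (simp add: Int_ac)
      then show ?thesis using op(1) by (rule restrict_space_open_subset)
    qed
    have disj: "disjoint_family D"
      using disjoint_family_disjointed[of W] by (auto simp: disjoint_family_on_def D_def)
    have WF: "(\<Union>n. W n) = \<Union>\<F>"
      unfolding W_def using False \<F>(2) by (simp add: range_from_nat_into)
    have "E \<subseteq> (\<Union>n. disjointed W n)"
      using order_trans[OF EX cover] by (simp only: UN_disjointed_eq WF \<F>(3))
    then have UN: "(\<Union>n. D n) = E" by (auto simp: D_def)
    have "chart_measure a I1 (S \<inter> U1) L1 E = (\<Sum>n. chart_measure a I1 (S \<inter> U1) L1 (D n))"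
      unfolding UN[symmetric] by (rule A.chart_measure_UN[OF cond1 D1 disj])
    also have "\<dots> = (\<Sum>n. chart_measure a I2 (S \<inter> U2) L2 (D n))"
      using W D by (intro suminf_cong) (auto simp: good_def)
    also have "\<dots> = chart_measure a I2 (S \<inter> U2) L2 E"
      using B.chart_measure_UN[OF cond2 D2 disj] by (simp only: UN)
    finally show ?thesis .
  qed
qed

lemma locally_finite_pairing_log_density:
  assumes "locally_finite_pairing a I S U I1" "x \<in> S \<inter> U"
  shows "log_density a x summable_on - I1"
proof -
  have "coordinate_pairing I S U I1" using assms(1) by (simp add: locally_finite_pairing_def)
  from coordinate_pairing_chart[OF this] obtain L where "chart I1 (S \<inter> U) L" ..
  then interpret chart I1 "S \<inter> U" L .
  have "graph_fun S U I1 (coord_proj I1 x) \<in> C_set a (- I1)"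
    using assms by (auto simp: locally_finite_pairing_def)
  then have "(\<lambda>i. \<bar>log_density a (x - coord_proj I1 x) i\<bar>) summable_on - I1"
    using assms(2) by (simp add: C_set_def graph_fun_eq)
  moreover have "(\<lambda>i. \<bar>log_density a (x - coord_proj I1 x) i\<bar>) summable_on - I1
      \<longleftrightarrow> (\<lambda>i. norm (log_density a x i)) summable_on - I1"
    by (rule summable_on_cong) (simp add: coord_coord_proj)
  ultimately show ?thesis
    by (subst summable_on_iff_abs_summable_on_real) simp
qed

theorem proposition82:
  fixes a :: "nat \<Rightarrow> real" and I :: "nat set" and S :: "ell2 set"
    and \<Lambda> :: "'i set" and U :: "'i \<Rightarrow> ell2 set" and J :: "'i \<Rightarrow> nat set"
  assumes "\<And>i. 0 < a i" and "summable a"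
    and "I \<noteq> {}"
    and "measurable_surface a I S"
    and "\<And>i. i \<in> \<Lambda> \<Longrightarrow> locally_finite_pairing a I S (U i) (J i)"
    and "S \<subseteq> (\<Union>i\<in>\<Lambda>. U i)"
  shows "\<exists>\<mu>S :: ell2 measure. space \<mu>S = S \<and> sets \<mu>S = sets (restrict_space borel S) \<and>
    (\<forall>i\<in>\<Lambda>. \<forall>E\<in>sets (restrict_space borel (S \<inter> U i)).
      emeasure \<mu>S E = local_surface_measure a S (U i) (J i) E)"
proof -
  note a = assms(1) and lf = assms(5)
  have pairing: "coordinate_pairing I S (U i) (J i)" if "i \<in> \<Lambda>" for i
    using lf[OF that] by (simp add: locally_finite_pairing_def)
  have op: "open (U i)" if "i \<in> \<Lambda>" for i
    using pairing[OF that] by (simp add: coordinate_pairing_def)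
  have "\<forall>i\<in>\<Lambda>. \<exists>L. chart (J i) (S \<inter> U i) L"
    using pairing coordinate_pairing_chart by blast
  then obtain L where chart: "\<And>i. i \<in> \<Lambda> \<Longrightarrow> chart (J i) (S \<inter> U i) (L i)"
    by metis
  have cond: "log_density a x summable_on - J i" if "i \<in> \<Lambda>" "x \<in> S \<inter> U i" for i x
    using lf[OF that(1)] that(2) by (rule locally_finite_pairing_log_density)
  \<comment> \<open>All index sets are related to the one set \<open>I\<close>, hence to each
    other.\<close>
  have exch: "J i' \<in> exch (J i)" if "i \<in> \<Lambda>" "i' \<in> \<Lambda>" for i i'
  proof -
    have "I \<in> exch (J k)" if "k \<in> \<Lambda>" for k
      using pairing[OF that] by (intro index_sim_exch) (simp add: coordinate_pairing_def index_class_def)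
    then show ?thesis using that exch_trans exch_sym by blast
  qed
  let ?m = "\<lambda>i. chart_measure a (J i) (S \<inter> U i) (L i)"
  have lsm: "local_surface_measure a S (U i) (J i) E = ?m i E"
    if "i \<in> \<Lambda>" "E \<in> sets (restrict_space borel (S \<inter> U i))" for i E
    using sets.sets_into_space[OF that(2)]
    by (intro local_surface_measure_eq chart that(1)) (simp add: space_restrict_space)
  have agree: "?m i E = ?m i' E"
    if "i \<in> \<Lambda>" "i' \<in> \<Lambda>" "E \<in> sets (restrict_space borel (S \<inter> U i \<inter> U i'))" for i i' E
    by (rule chart_measure_eq[OF chart chart exch op op a cond cond that(3)]) (use that in auto)
  have "S \<noteq> {}" using assms(4) by (simp add: measurable_surface_def surface_def)
  obtain \<F> where \<F>: "\<F> \<subseteq> U ` \<Lambda>" "countable \<F>" "\<Union>\<F> = \<Union>(U ` \<Lambda>)"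
    by (rule Lindelof[of "U ` \<Lambda>"]) (use op in auto)
  have "\<F> \<noteq> {}" using \<F>(3) \<open>S \<noteq> {}\<close> assms(6) by auto
  then have "\<exists>i\<in>\<Lambda>. from_nat_into \<F> n = U i" for n
    using from_nat_into[of \<F> n] \<F>(1) by blast
  then obtain k where k: "\<And>n. k n \<in> \<Lambda>" "\<And>n. from_nat_into \<F> n = U (k n)" by metis
  define D where "D = disjointed (\<lambda>n. U (k n))"
  have D_sets: "D n \<in> sets borel" for n
  proof -
    have "range (\<lambda>n. U (k n)) \<subseteq> sets borel" using op k(1) by auto
    then show ?thesis using sets.range_disjointed_sets unfolding D_def by blast
  qed
  have D_sub: "D n \<subseteq> U (k n)" for n
    unfolding D_def by (rule disjointed_subset)
  have D_disj: "disjoint_family D"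
    unfolding D_def by (rule disjoint_family_disjointed)
  have D_cover: "S \<subseteq> (\<Union>n. D n)"
  proof -
    have "(\<Union>n. D n) = (\<Union>n. from_nat_into \<F> n)"
      unfolding D_def UN_disjointed_eq k(2) ..
    also have "\<dots> = \<Union>\<F>" using \<open>\<F> \<noteq> {}\<close> \<F>(2) by (simp add: range_from_nat_into)
    finally show ?thesis using \<F>(3) assms(6) by simp
  qed
  \<comment> \<open>Every point of \<open>S\<close> is measured in the first chart of the enumerated
    subcover that contains it.\<close>
  define \<mu> where "\<mu> E = (\<Sum>n. ?m (k n) (E \<inter> D n))" for E
  have piece: "E \<inter> D n \<in> sets (restrict_space borel (S \<inter> U (k n)))"
    if E: "E \<in> sets (restrict_space borel S)" for E n
  proof -
    obtain T where T: "T \<in> sets borel" "E = S \<inter> T"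
      using E by (auto simp: sets_restrict_space)
    then have "E \<inter> D n = (S \<inter> U (k n)) \<inter> (T \<inter> D n)" using D_sub[of n] by auto
    then show ?thesis using T(1) D_sets[of n] by (auto simp: sets_restrict_space)
  qed
  define \<mu>S where "\<mu>S = measure_of S (sets (restrict_space borel S)) \<mu>"
  have sp: "space (restrict_space borel S) = S" by (simp add: space_restrict_space)
  have sa: "sigma_algebra S (sets (restrict_space borel S))"
    using sets.sigma_algebra_axioms[of "restrict_space borel S"] by (simp add: sp)
  have pos: "positive (sets (restrict_space borel S)) \<mu>"
    using chart[OF k(1)] by (simp add: positive_def \<mu>_def chart.chart_measure_empty)
  have ca: "countably_additive (sets (restrict_space borel S)) \<mu>"
  proof (rule countably_additiveI)
    fix E :: "nat \<Rightarrow> ell2 set"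
    assume E: "range E \<subseteq> sets (restrict_space borel S)" and disj: "disjoint_family E"
    have Em: "E m \<inter> D n \<in> sets (restrict_space borel (S \<inter> U (k n)))" for m n
      using E by (intro piece) auto
    have "\<mu> (\<Union>m. E m) = (\<Sum>n. ?m (k n) (\<Union>m. E m \<inter> D n))"
      unfolding \<mu>_def by (simp only: Int_UN_distrib2 UN_extend_simps)
    also have "\<dots> = (\<Sum>n. \<Sum>m. ?m (k n) (E m \<inter> D n))"
    proof (intro suminf_cong chart.chart_measure_UN[OF chart] k(1) Em cond)
      show "disjoint_family (\<lambda>m. E m \<inter> D n)" for n
        using disj by (auto simp: disjoint_family_on_def)
    qed auto
    \<comment> \<open>Writing the outer series as an integral over the counting measure allows the
      two summations to be interchanged.\<close>
    also have "\<dots> = (\<integral>\<^sup>+n. (\<Sum>m. ?m (k n) (E m \<inter> D n)) \<partial>count_space UNIV)"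
      by (simp add: nn_integral_count_space_nat)
    also have "\<dots> = (\<Sum>m. \<mu> (E m))"
      by (subst nn_integral_suminf) (simp_all add: nn_integral_count_space_nat \<mu>_def)
    finally show "(\<Sum>m. \<mu> (E m)) = \<mu> (\<Union>m. E m)" by simp
  qed
  have em: "emeasure \<mu>S E = \<mu> E" if "E \<in> sets (restrict_space borel S)" for E
    unfolding \<mu>S_def by (rule emeasure_measure_of_sigma[OF sa pos ca that])
  have "emeasure \<mu>S E = local_surface_measure a S (U i) (J i) E"
    if i: "i \<in> \<Lambda>" and E: "E \<in> sets (restrict_space borel (S \<inter> U i))" for i E
  proof -
    have ES: "E \<subseteq> S \<inter> U i"
      using sets.sets_into_space[OF E] by (simp add: space_restrict_space)
    have E': "E \<in> sets (restrict_space borel S)"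
      using E op[OF i] by (rule restrict_space_open_subset)
    obtain T where T: "T \<in> sets borel" "E = (S \<inter> U i) \<inter> T"
      using E by (auto simp: sets_restrict_space)
    have En: "E \<inter> D n \<in> sets (restrict_space borel (S \<inter> U (k n) \<inter> U i))" for n
    proof -
      have "E \<inter> D n = (S \<inter> U (k n) \<inter> U i) \<inter> (T \<inter> D n)" using T(2) D_sub[of n] by auto
      then show ?thesis using T(1) D_sets[of n] by (auto simp: sets_restrict_space)
    qed
    have Ei: "E \<inter> D n \<in> sets (restrict_space borel (S \<inter> U i))" for n
    proof -
      have "E \<inter> D n = (S \<inter> U i) \<inter> (T \<inter> D n)" using T(2) by auto
      then show ?thesis using T(1) D_sets[of n] by (auto simp: sets_restrict_space)
    qed
    have "emeasure \<mu>S E = (\<Sum>n. ?m (k n) (E \<inter> D n))"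
      using em[OF E'] by (simp add: \<mu>_def)
    \<comment> \<open>Each piece lies in the overlap of \<open>U (k n)\<close> with
      \<open>U i\<close>, so it may be measured in chart \<open>i\<close>, where additivity
      reassembles \<open>E\<close>.\<close>
    also have "\<dots> = (\<Sum>n. ?m i (E \<inter> D n))"
      by (intro suminf_cong agree k(1) i En)
    also have "\<dots> = ?m i (\<Union>n. E \<inter> D n)"
    proof (rule chart.chart_measure_UN[OF chart[OF i] _ Ei, symmetric])
      show "disjoint_family (\<lambda>n. E \<inter> D n)"
        using D_disj by (auto simp: disjoint_family_on_def)
    qed (use cond[OF i] in auto)
    also have "(\<Union>n. E \<inter> D n) = E" using D_cover ES by auto
    finally show ?thesis using lsm[OF i E] by simp
  qed
  moreover have "space \<mu>S = S"
    unfolding \<mu>S_def using sets.space_closed[of "restrict_space borel S"]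
    by (intro space_measure_of) (simp add: sp)
  moreover have "sets \<mu>S = sets (restrict_space borel S)"
    unfolding \<mu>S_def using sets.sets_measure_of_eq[of "restrict_space borel S"] by (simp add: sp)
  ultimately show ?thesis by blast
qed

end
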